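(* Let $\mathcal{J}=(a,b)$ be a finite interval, $m\geq3$, $\varepsilon_0>0$, and for each $\varepsilon\in[0,\varepsilon_0]$ let $Q_\varepsilon\in L_1(\mathcal{J};\mathbb{C})$ and $\alpha(\varepsilon),\beta(\varepsilon)\in\mathbb{C}^{m\times m}$. Let $L_\varepsilon$ be the operator in $L_2(\mathcal{J};\mathbb{C})$ given by $L_\varepsilon y=i^mD^{[m]}_\varepsilon y$ on $$\operatorname{Dom}(L_\varepsilon)=\{y\in\operatorname{Dom}(L^\varepsilon_{\max}):\ \alpha(\varepsilon)\mathcal{Y}_\varepsilon(a)+\beta(\varepsilon)\mathcal{Y}_\varepsilon(b)=0\},$$ where $\mathcal{Y}_\varepsilon(x)=(D^{[0]}_\varepsilon y(x),\dots,D^{[m-1]}_\varepsilon y(x))\in\mathbb{C}^m$. Suppose the resolvent set $\rho(L_0)$ is nonempty and, as $\varepsilon\to0+$, (1) $\|(Q_\varepsilon-Q_0)^\vee\|_C\to0$, where $c^\vee(t):=\int_a^tc(s)\,ds$ and $\|\cdot\|_C$ is the sup-norm on $[a,b]$; (2) $\alpha(\varepsilon)\to\alpha(0)$ and $\beta(\varepsilon)\to\beta(0)$. Then $L_\varepsilon$ converges to $L_0$ in the norm resolvent sense: there is $\mu\in\rho(L_0)$ with $\mu\in\rho(L_\varepsilon)$ for all sufficiently small $\varepsilon$ and $\|(L_\varepsilon-\mu)^{-1}-(L_0-\mu)^{-1}\|\to0$ as $\varepsilon\to0+$.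
   Context: Quasi-derivatives associated with $Q_\varepsilon$: $D^{[k]}_\varepsilon y=y^{(k)}$ for $k=0,\dots,m-2$; $D^{[m-1]}_\varepsilon y=y^{(m-1)}+i^{-m}Q_\varepsilon y$; $D^{[m]}_\varepsilon y=(D^{[m-1]}_\varepsilon y)'-i^{-m}Q_\varepsilon D^{[1]}_\varepsilon y$. The maximal operator $L^\varepsilon_{\max}$ acts by $y\mapsto i^mD^{[m]}_\varepsilon y$ on $\{y: D^{[k]}_\varepsilon y\in AC([a,b];\mathbb{C}),\ k=0,\dots,m-1,\ D^{[m]}_\varepsilon y\in L_2(\mathcal{J};\mathbb{C})\}$. This regularizes the formal expression $i^my^{(m)}+q_\varepsilon y$ with $q_\varepsilon=Q_\varepsilon'$. *)

theory Defs
  imports "HOL-Analysis.Analysis"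
begin

definition abs_cont_on :: "real \<Rightarrow> real \<Rightarrow> (real \<Rightarrow> complex) \<Rightarrow> bool" where
  "abs_cont_on a b f \<longleftrightarrow>
     (\<forall>e>0. \<exists>d>0. \<forall>(n::nat) (u::nat \<Rightarrow> real) (v::nat \<Rightarrow> real).
        (\<forall>i<n. a \<le> u i \<and> u i \<le> v i \<and> v i \<le> b) \<longrightarrow>
        (\<forall>i<n. \<forall>j<n. i \<noteq> j \<longrightarrow> {u i<..<v i} \<inter> {u j<..<v j} = {}) \<longrightarrow>
        (\<Sum>i<n. v i - u i) < d \<longrightarrow>
        (\<Sum>i<n. cmod (f (v i) - f (u i))) < e)"

section \<open>The space L_2(a,b) (functions, identified up to a.e. equality where needed)\<close>

definition L2 :: "real \<Rightarrow> real \<Rightarrow> (real \<Rightarrow> complex) \<Rightarrow> bool" where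
  "L2 a b f \<longleftrightarrow> f \<in> borel_measurable (lebesgue_on {a..b}) \<and>
                integrable (lebesgue_on {a..b}) (\<lambda>x. (cmod (f x))\<^sup>2)"

definition L2norm :: "real \<Rightarrow> real \<Rightarrow> (real \<Rightarrow> complex) \<Rightarrow> real" where
  "L2norm a b f = sqrt (\<integral>x. (cmod (f x))\<^sup>2 \<partial>lebesgue_on {a..b})"

text \<open>\<open>quasi_derivs m Q a b y D\<close>: the functions \<open>D k\<close> (k = 0..m) are the quasi-derivatives
  D^[k] y of y on [a,b]: D 0 = y, D^[k] y = y^(k) for k \<le> m-2,
  D^[m-1] y = y^(m-1) + i^(-m) Q y, D^[m] y = (D^[m-1] y)' - i^(-m) Q D^[1] y,
  where D^[0],...,D^[m-1] are absolutely continuous on [a,b] and derivatives are taken a.e.\<close>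

definition quasi_derivs ::
  "nat \<Rightarrow> (real \<Rightarrow> complex) \<Rightarrow> real \<Rightarrow> real \<Rightarrow> (real \<Rightarrow> complex) \<Rightarrow> (nat \<Rightarrow> real \<Rightarrow> complex) \<Rightarrow> bool"
  where
  "quasi_derivs m Q a b y D \<longleftrightarrow>
     (\<forall>x\<in>{a..b}. D 0 x = y x) \<and>
     (\<forall>k<m. abs_cont_on a b (D k)) \<and>
     (\<forall>k. k + 2 < m \<longrightarrow>
        (AE x in lebesgue_on {a..b}. (D k has_vector_derivative D (k + 1) x) (at x within {a..b}))) \<and>
     (AE x in lebesgue_on {a..b}.
        (D (m - 2) has_vector_derivative (D (m - 1) x - inverse (\<i> ^ m) * Q x * D 0 x)) (at x within {a..b})) \<and>
     (AE x in lebesgue_on {a..b}.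
        (D (m - 1) has_vector_derivative (D m x + inverse (\<i> ^ m) * Q x * D 1 x)) (at x within {a..b}))"

definition L_op ::
  "nat \<Rightarrow> (real \<Rightarrow> complex) \<Rightarrow> (nat \<Rightarrow> nat \<Rightarrow> complex) \<Rightarrow> (nat \<Rightarrow> nat \<Rightarrow> complex) \<Rightarrow> real \<Rightarrow> real
    \<Rightarrow> (real \<Rightarrow> complex) \<Rightarrow> (real \<Rightarrow> complex) \<Rightarrow> bool" where
  "L_op m Q \<alpha> \<beta> a b y f \<longleftrightarrow>
     (\<exists>D. quasi_derivs m Q a b y D \<and> L2 a b (D m) \<and>
          (\<forall>j<m. (\<Sum>k<m. \<alpha> j k * D k a) + (\<Sum>k<m. \<beta> j k * D k b) = 0) \<and>
          (AE x in lebesgue_on {a..b}. f x = \<i> ^ m * D m x))"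

definition in_resolvent_set ::
  "real \<Rightarrow> real \<Rightarrow> ((real \<Rightarrow> complex) \<Rightarrow> (real \<Rightarrow> complex) \<Rightarrow> bool) \<Rightarrow> complex \<Rightarrow> bool" where
  "in_resolvent_set a b T \<mu> \<longleftrightarrow>
     \<comment> \<open>T - \<mu> is injective\<close>
     (\<forall>y f. T y f \<longrightarrow> (AE x in lebesgue_on {a..b}. f x - \<mu> * y x = 0) \<longrightarrow>
            (AE x in lebesgue_on {a..b}. y x = 0)) \<and>
     \<comment> \<open>T - \<mu> is onto L_2\<close>
     (\<forall>g. L2 a b g \<longrightarrow> (\<exists>y f. T y f \<and> (AE x in lebesgue_on {a..b}. f x - \<mu> * y x = g x))) \<and>
     \<comment> \<open>the inverse is bounded\<close>
     (\<exists>C. \<forall>y f. T y f \<longrightarrow> L2norm a b y \<le> C * L2norm a b (\<lambda>x. f x - \<mu> * y x))"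

definition resolvent ::
  "real \<Rightarrow> real \<Rightarrow> ((real \<Rightarrow> complex) \<Rightarrow> (real \<Rightarrow> complex) \<Rightarrow> bool) \<Rightarrow> complex
    \<Rightarrow> (real \<Rightarrow> complex) \<Rightarrow> (real \<Rightarrow> complex)" where
  "resolvent a b T \<mu> g = (SOME y. \<exists>f. T y f \<and> (AE x in lebesgue_on {a..b}. f x - \<mu> * y x = g x))"

definition resolvent_diff_norm ::
  "real \<Rightarrow> real \<Rightarrow> ((real \<Rightarrow> complex) \<Rightarrow> (real \<Rightarrow> complex) \<Rightarrow> bool)
    \<Rightarrow> ((real \<Rightarrow> complex) \<Rightarrow> (real \<Rightarrow> complex) \<Rightarrow> bool) \<Rightarrow> complex \<Rightarrow> real" where
  "resolvent_diff_norm a b T S \<mu> =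
     (SUP g\<in>{g. L2 a b g \<and> L2norm a b g \<le> 1}.
        L2norm a b (\<lambda>x. resolvent a b T \<mu> g x - resolvent a b S \<mu> g x))"

end

(* Write (L - \<mu>) y = g as a first-order system Y' = A_q Y + F for the vector Y of quasi-derivatives,
   with integrable coefficients. The L1 norm of q - p, where q, p are the coefficients for the parameters
   epsilon and 0, need not be small, only its primitive c is. But A_q = A_p - (q - p) N with a
   constant nilpotent matrix N, so Z = exp(c N) Y solves the system of p with an extra source bounded by
   a multiple of sup |c| * sup |Y|. If the boundary value problem for p has trivial kernel, its solution
   is bounded by the L1 norm of the source plus the boundary defect; hence
   sup |Y - Y0| <= const * (sup |c| + distance of the boundary matrices) * sup |Y|. This yields uniqueness,
   and by the Fredholm alternative existence, for the perturbed problem, and the convergence of the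
   resolvents, for every \<mu> in the resolvent set of the limit operator. *)

theory Submission
  imports Defs "Jordan_Normal_Form.Determinant"
begin

section \<open>Absolute continuity on an interval\<close>

text \<open>The exponential leaves no product of c with p or q behind, and the argument rests on
  this. Both p and q enter their matrices only as multiples of N, which commute with exp(c N), and
  the entry carrying \<mu> commutes with N as well; so the new source is the commutator of exp(c N)
  with the constant shift matrix, applied to Y. It is linear in c up to a term in c^2, which
  survives only for m = 3 and is harmless once |c| <= 1. The resulting estimate contains sup |Y| of
  the unknown solution itself. As soon as its factor is at most 1/2 it can be absorbed, which bounds
  Y by the L1 norm of g with a constant independent of the perturbation; the same estimate then
  compares Y with Y0. The interval being finite, L2 embeds into L1 and sup norms control L2 norms,
  so these bounds become bounds of operator norms. All equations hold only almost everywhere, for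
  absolutely continuous components. The systems are therefore handled as Volterra integral
  equations, and the equivalence of the two forms needs both halves of Lebesgue's fundamental
  theorem of calculus.\<close>

lemma AE_lebesgue_on_iff_negligible:
  fixes a b :: real
  shows "(AE x in lebesgue_on {a..b}. P x) \<longleftrightarrow> (\<exists>N. negligible N \<and> (\<forall>x\<in>{a..b} - N. P x))"
proof -
  have "(AE x in lebesgue_on {a..b}. P x) \<longleftrightarrow> (AE x in lebesgue. x \<in> {a..b} \<longrightarrow> P x)"
    by (subst AE_restrict_space_iff) auto
  also have "\<dots> \<longleftrightarrow> (\<exists>N. negligible N \<and> (\<forall>x\<in>{a..b} - N. P x))"
    unfolding Bex_def eventually_ae_filter negligible_iff_null_sets
    by (rule ex_cong1) (simp add: subset_eq Ball_def del: null_sets_completion_iff null_sets_completion_iff2, meson)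
  finally show ?thesis .
qed

definition nonoverlapping :: "real \<Rightarrow> real \<Rightarrow> 'i set \<Rightarrow> ('i \<Rightarrow> real) \<Rightarrow> ('i \<Rightarrow> real) \<Rightarrow> bool" where
  "nonoverlapping a b I u v \<longleftrightarrow> finite I \<and> (\<forall>i\<in>I. a \<le> u i \<and> u i \<le> v i \<and> v i \<le> b) \<and>
     (\<forall>i\<in>I. \<forall>j\<in>I. i \<noteq> j \<longrightarrow> {u i<..<v i} \<inter> {u j<..<v j} = {})"

lemma abs_cont_on_iff:
  "abs_cont_on a b f \<longleftrightarrow> (\<forall>e>0. \<exists>d>0. \<forall>n u v. nonoverlapping a b {..<n::nat} u v \<longrightarrow>
     (\<Sum>i<n. v i - u i) < d \<longrightarrow> (\<Sum>i<n. cmod (f (v i) - f (u i))) < e)"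
  unfolding abs_cont_on_def nonoverlapping_def
  by (simp only: Ball_def lessThan_iff imp_conjL finite_lessThan simp_thms)

lemma abs_cont_onE:
  assumes "abs_cont_on a b f" "e > 0"
  obtains d where "d > 0"
    "\<And>n u v. nonoverlapping a b {..<n::nat} u v \<Longrightarrow> (\<Sum>i<n. v i - u i) < d \<Longrightarrow>
      (\<Sum>i<n. cmod (f (v i) - f (u i))) < e"
proof -
  obtain d where "d > 0" "\<forall>n u v. nonoverlapping a b {..<n::nat} u v \<longrightarrow>
      (\<Sum>i<n. v i - u i) < d \<longrightarrow> (\<Sum>i<n. cmod (f (v i) - f (u i))) < e"
    using assms unfolding abs_cont_on_iff by blast
  then show ?thesis using that by blast
qed

lemma abs_cont_onI:
  assumes "\<And>e. e > 0 \<Longrightarrow> \<exists>d>0. \<forall>n u v. nonoverlapping a b {..<n::nat} u v \<longrightarrow>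
     (\<Sum>i<n. v i - u i) < d \<longrightarrow> (\<Sum>i<n. cmod (f (v i) - f (u i))) < e"
  shows "abs_cont_on a b f"
  using assms unfolding abs_cont_on_iff by presburger

lemma nonoverlapping_bounds:
  assumes "nonoverlapping a b I u v" "i \<in> I"
  shows "u i \<in> {a..b}" "v i \<in> {a..b}" "u i \<le> v i"
  using assms unfolding nonoverlapping_def by (meson atLeastAtMost_iff order_trans)+

lemma abs_cont_on_family:
  assumes "abs_cont_on a b f" "e > 0"
  obtains d where "d > 0"
    "\<And>I u v. nonoverlapping a b I u v \<Longrightarrow> (\<Sum>i\<in>I. v i - u i) < d \<Longrightarrow>
      (\<Sum>i\<in>I. cmod (f (v i) - f (u i))) < e"
proof -
  obtain d where d: "d > 0" "\<And>n u v. nonoverlapping a b {..<n::nat} u v \<Longrightarrow>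
      (\<Sum>i<n. v i - u i) < d \<Longrightarrow> (\<Sum>i<n. cmod (f (v i) - f (u i))) < e"
    using abs_cont_onE[OF assms] by blast
  show ?thesis
  proof (rule that[OF d(1)])
    fix I :: "'a set" and u v :: "'a \<Rightarrow> real"
    assume I: "nonoverlapping a b I u v" "(\<Sum>i\<in>I. v i - u i) < d"
    have fin: "finite I" using I(1) by (simp add: nonoverlapping_def)
    obtain h where h: "bij_betw h {..<card I} I"
      using ex_bij_betw_nat_finite[OF fin] by (auto simp: atLeast0LessThan)
    have hI: "h i \<in> I" if "i < card I" for i
      using h that by (auto simp: bij_betw_def)
    have hinj: "h i \<noteq> h j" if "i < card I" "j < card I" "i \<noteq> j" for i j
      using h that by (auto simp: bij_betw_def inj_on_def)
    have sm: "(\<Sum>i<card I. g (h i)) = sum g I" for g :: "'a \<Rightarrow> real"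
      using sum.reindex_bij_betw[OF h] .
    have "nonoverlapping a b {..<card I} (\<lambda>i. u (h i)) (\<lambda>i. v (h i))"
      using I(1) hI hinj unfolding nonoverlapping_def by simp
    from d(2)[OF this] show "(\<Sum>i\<in>I. cmod (f (v i) - f (u i))) < e"
      using sm[of "\<lambda>i. cmod (f (v i) - f (u i))"] sm[of "\<lambda>i. v i - u i"] I(2) by simp
  qed
qed

text \<open>Closure of absolute continuity under congruence, sums, differences and products is
  obtained from this one criterion. A product satisfies it with K a common bound of the two factors
  on the interval.\<close>

lemma abs_cont_on_lipschitz2:
  assumes f: "abs_cont_on a b f" and g: "abs_cont_on a b g" and K: "K \<ge> 0"
    and h: "\<And>x y. x \<in> {a..b} \<Longrightarrow> y \<in> {a..b} \<Longrightarrow>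
      cmod (h x - h y) \<le> K * (cmod (f x - f y) + cmod (g x - g y))"
  shows "abs_cont_on a b h"
proof (rule abs_cont_onI)
  fix e :: real assume "e > 0"
  \<comment> \<open>The 1 in the denominator covers \<open>K = 0\<close> and makes the final
    inequality \<open>K * (r + r) < e\<close> strict.\<close>
  define r where "r = e / (2 * (K + 1))"
  have r: "r > 0" using \<open>e > 0\<close> K by (simp add: r_def)
  have "(K + 1) * (2 * r) = e" using K by (simp add: r_def field_simps)
  then have Kr: "K * (r + r) < e" using r by (simp add: algebra_simps)
  obtain d1 where d1: "d1 > 0" "\<And>n u v. nonoverlapping a b {..<n::nat} u v \<Longrightarrow>
      (\<Sum>i<n. v i - u i) < d1 \<Longrightarrow> (\<Sum>i<n. cmod (f (v i) - f (u i))) < r"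
    using abs_cont_onE[OF f r] by blast
  obtain d2 where d2: "d2 > 0" "\<And>n u v. nonoverlapping a b {..<n::nat} u v \<Longrightarrow>
      (\<Sum>i<n. v i - u i) < d2 \<Longrightarrow> (\<Sum>i<n. cmod (g (v i) - g (u i))) < r"
    using abs_cont_onE[OF g r] by blast
  have "(\<Sum>i<n. cmod (h (v i) - h (u i))) < e"
    if A: "nonoverlapping a b {..<n} u v" "(\<Sum>i<n. v i - u i) < min d1 d2" for n :: nat and u v
  proof -
    have "(\<Sum>i<n. cmod (h (v i) - h (u i)))
        \<le> (\<Sum>i<n. K * (cmod (f (v i) - f (u i)) + cmod (g (v i) - g (u i))))"
      by (intro sum_mono h nonoverlapping_bounds[OF A(1)])
    also have "\<dots> = K * ((\<Sum>i<n. cmod (f (v i) - f (u i))) + (\<Sum>i<n. cmod (g (v i) - g (u i))))"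
      by (simp add: sum.distrib flip: sum_distrib_left)
    also have "\<dots> \<le> K * (r + r)"
      using d1(2)[OF A(1)] d2(2)[OF A(1)] A(2) K by (intro mult_left_mono) auto
    finally show ?thesis using Kr by linarith
  qed
  moreover have "min d1 d2 > 0" using d1(1) d2(1) by simp
  ultimately show "\<exists>d>0. \<forall>n u v. nonoverlapping a b {..<n::nat} u v \<longrightarrow>
     (\<Sum>i<n. v i - u i) < d \<longrightarrow> (\<Sum>i<n. cmod (h (v i) - h (u i))) < e"
    by blast
qed

lemma abs_cont_on_cong:
  assumes "abs_cont_on a b f" "\<And>x. x \<in> {a..b} \<Longrightarrow> f x = g x"
  shows "abs_cont_on a b g"
  by (rule abs_cont_on_lipschitz2[OF assms(1) assms(1), where K = 1]) (auto simp: assms(2))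

lemma abs_cont_on_subinterval:
  assumes "abs_cont_on a b f" "a \<le> c" "d \<le> b"
  shows "abs_cont_on c d f"
proof (rule abs_cont_onI)
  fix e :: real assume "e > 0"
  obtain r where r: "r > 0" "\<And>n u v. nonoverlapping a b {..<n::nat} u v \<Longrightarrow>
      (\<Sum>i<n. v i - u i) < r \<Longrightarrow> (\<Sum>i<n. cmod (f (v i) - f (u i))) < e"
    using abs_cont_onE[OF assms(1) \<open>e > 0\<close>] by blast
  have "nonoverlapping a b I u v" if "nonoverlapping c d I u v" for I :: "nat set" and u v
    using that assms(2,3) unfolding nonoverlapping_def by (meson order_trans)
  then show "\<exists>r>0. \<forall>n u v. nonoverlapping c d {..<n::nat} u v \<longrightarrow>
     (\<Sum>i<n. v i - u i) < r \<longrightarrow> (\<Sum>i<n. cmod (f (v i) - f (u i))) < e"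
    using r by blast
qed

lemma abs_cont_on_imp_continuous_on:
  assumes "abs_cont_on a b f"
  shows "continuous_on {a..b} f"
  unfolding continuous_on_iff
proof (intro ballI allI impI)
  fix x e :: real assume x: "x \<in> {a..b}" and "e > 0"
  obtain d where d: "d > 0"
    "\<And>I u v. nonoverlapping a b I u v \<Longrightarrow> (\<Sum>i\<in>I. v i - u i) < d \<Longrightarrow>
      (\<Sum>i\<in>(I::unit set). cmod (f (v i) - f (u i))) < e"
    using abs_cont_on_family[OF assms \<open>e > 0\<close>, where ?'a = unit] by blast
  have "dist (f y) (f x) < e" if y: "y \<in> {a..b}" "dist y x < d" for y
  proof -
    have "nonoverlapping a b {()} (\<lambda>_. min x y) (\<lambda>_. max x y)"
      using x y by (auto simp: nonoverlapping_def)
    from d(2)[OF this] have "cmod (f (max x y) - f (min x y)) < e"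
      using y(2) by (auto simp: dist_real_def min_def max_def)
    then show ?thesis by (auto simp: dist_norm norm_minus_commute min_def max_def split: if_splits)
  qed
  then show "\<exists>d>0. \<forall>y\<in>{a..b}. dist y x < d \<longrightarrow> dist (f y) (f x) < e"
    using d(1) by blast
qed

lemma abs_cont_on_add:
  "abs_cont_on a b f \<Longrightarrow> abs_cont_on a b g \<Longrightarrow> abs_cont_on a b (\<lambda>x. f x + g x)"
  by (erule (1) abs_cont_on_lipschitz2[where K = 1])
    (auto simp: add_diff_add norm_triangle_ineq)

lemma abs_cont_on_diff:
  assumes "abs_cont_on a b f" "abs_cont_on a b g"
  shows "abs_cont_on a b (\<lambda>x. f x - g x)"
proof (rule abs_cont_on_lipschitz2[OF assms, where K = 1])
  fix x y
  show "cmod (f x - g x - (f y - g y)) \<le> 1 * (cmod (f x - f y) + cmod (g x - g y))"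
    using norm_triangle_ineq4[of "f x - f y" "g x - g y"] by (simp add: algebra_simps)
qed simp

lemma abs_cont_on_const: "abs_cont_on a b (\<lambda>x. c)"
  by (rule abs_cont_onI) (auto intro: exI[of _ 1])

lemma abs_cont_on_mult:
  assumes "abs_cont_on a b f" "abs_cont_on a b g"
  shows "abs_cont_on a b (\<lambda>x. f x * g x)"
proof -
  have bnd: "bounded (f ` {a..b})" "bounded (g ` {a..b})"
    using assms by (auto intro!: compact_imp_bounded compact_continuous_image abs_cont_on_imp_continuous_on)
  obtain F where F: "\<And>x. x \<in> {a..b} \<Longrightarrow> cmod (f x) \<le> F"
    using bnd(1) unfolding bounded_iff by blast
  obtain G where G: "\<And>x. x \<in> {a..b} \<Longrightarrow> cmod (g x) \<le> G"
    using bnd(2) unfolding bounded_iff by blast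
  define K where "K = max 0 (max F G)"
  have K: "cmod (f x) \<le> K" "cmod (g x) \<le> K" if "x \<in> {a..b}" for x
    using F[OF that] G[OF that] by (auto simp: K_def)
  have K0: "K \<ge> 0" by (simp add: K_def)
  show ?thesis
  proof (rule abs_cont_on_lipschitz2[OF assms, where K = K])
    fix x y assume "x \<in> {a..b}" "y \<in> {a..b}"
    have "cmod (f x * g x - f y * g y) = cmod ((f x - f y) * g x + f y * (g x - g y))"
      by (simp add: algebra_simps)
    also have "\<dots> \<le> cmod (f x - f y) * cmod (g x) + cmod (f y) * cmod (g x - g y)"
      by (metis norm_mult norm_triangle_ineq)
    also have "\<dots> \<le> cmod (f x - f y) * K + K * cmod (g x - g y)"
      using K K0 \<open>x \<in> {a..b}\<close> \<open>y \<in> {a..b}\<close> by (intro add_mono mult_mono) auto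
    finally show "cmod (f x * g x - f y * g y) \<le> K * (cmod (f x - f y) + cmod (g x - g y))"
      by (simp add: algebra_simps)
  qed (rule K0)
qed

section \<open>Fundamental theorem of calculus for absolutely continuous functions\<close>

text \<open>At points of the exceptional null set the gauge is taken inside an open set of small measure,
  where absolute continuity makes the increments of \<open>f\<close> negligible.\<close>

lemma abs_cont_on_has_integral_derivative:
  assumes ab: "a \<le> b" and ac: "abs_cont_on a b f"
    and der: "AE x in lebesgue_on {a..b}. (f has_vector_derivative g x) (at x within {a..b})"
  shows "(g has_integral (f b - f a)) {a..b}"
proof -
  obtain N where N: "negligible N"
    and derN: "\<And>x. x \<in> {a..b} - N \<Longrightarrow> (f has_vector_derivative g x) (at x within {a..b})"
    using der unfolding AE_lebesgue_on_iff_negligible by blast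
  \<comment> \<open>With h = 0 on N, a tag in N contributes only the increment of f and not the
    uncontrolled value of g.\<close>
  define h where "h x = (if x \<in> N then 0 else g x)" for x
  have "(h has_integral (f b - f a)) {a..b}"
    unfolding has_integral_real
  proof (intro allI impI)
    fix e :: real assume "e > 0"
    then have e2: "e / 2 > 0" by simp
    obtain d where d: "d > 0"
      "\<And>I u v. nonoverlapping a b I u v \<Longrightarrow> (\<Sum>i\<in>I. v i - u i) < d \<Longrightarrow>
        (\<Sum>i\<in>(I::(real \<times> real set) set). cmod (f (v i) - f (u i))) < e / 2"
      using abs_cont_on_family[OF ac e2, where ?'a = "real \<times> real set"] by blast
    obtain U where U: "open U" "N \<subseteq> U" "U - N \<in> lmeasurable" "emeasure lebesgue (U - N) < ennreal d"
      using sets_lebesgue_outer_open[of N d] d(1) N negligible_imp_sets by blast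
    have Nnull: "N \<in> null_sets lebesgue" using N by (simp add: negligible_iff_null_sets)
    have Um: "U \<in> lmeasurable" "measure lebesgue U < d"
    proof -
      have "emeasure lebesgue U = emeasure lebesgue (U - N)"
        using emeasure_Diff_null_set[OF Nnull, of U] U(1) by (simp add: borel_open)
      then show "U \<in> lmeasurable" "measure lebesgue U < d"
        using U(1,4) d(1) by (auto simp: fmeasurable_def measure_def borel_open
            enn2real_less_iff top.not_eq_extremum less_top order_less_trans[OF _ ennreal_less_top])
    qed
    \<comment> \<open>The tags outside N contribute at most \<open>e' * (b - a)\<close>, which has
      to stay below \<open>e / 2\<close>; the 1 covers a = b.\<close>
    define e' where "e' = e / (2 * (b - a + 1))"
    have e': "e' > 0" using \<open>e > 0\<close> ab by (simp add: e'_def)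
    have "\<exists>\<delta>>0. x \<in> {a..b} - N \<longrightarrow> (\<forall>y\<in>{a..b}. \<bar>y - x\<bar> < \<delta> \<longrightarrow>
        cmod (f y - f x - (y - x) *\<^sub>R g x) \<le> e' * \<bar>y - x\<bar>)" for x
    proof (cases "x \<in> {a..b} - N")
      case True
      from derN[OF this] e' show ?thesis
        unfolding has_vector_derivative_def has_derivative_within_alt by auto
    qed (auto intro: exI[of _ 1])
    then obtain \<delta> where \<delta>: "\<And>x. \<delta> x > 0"
      "\<And>x y. x \<in> {a..b} - N \<Longrightarrow> y \<in> {a..b} \<Longrightarrow> \<bar>y - x\<bar> < \<delta> x \<Longrightarrow>
        cmod (f y - f x - (y - x) *\<^sub>R g x) \<le> e' * \<bar>y - x\<bar>"
      by metis
    define \<gamma> where "\<gamma> x = (if x \<in> N then U else ball x (\<delta> x))" for x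
    have "gauge \<gamma>"
      unfolding gauge_def \<gamma>_def using U \<delta>(1) by auto
    moreover have "norm ((\<Sum>(x,k)\<in>p. measure lborel k *\<^sub>R h x) - (f b - f a)) < e"
      if p: "p tagged_division_of {a..b}" and fine: "\<gamma> fine p" for p
    proof -
      have fin: "finite p" using p by blast
      have pk: "\<exists>u v. k = {u..v} \<and> u \<le> x \<and> x \<le> v \<and> a \<le> u \<and> v \<le> b \<and> Sup k = v \<and> Inf k = u
          \<and> measure lborel k = v - u \<and> interior k = {u<..<v}" if xk: "(x,k) \<in> p" for x k
      proof -
        obtain u v where k: "k = cbox u v" using tagged_division_ofD(4)[OF p xk] by blast
        have "x \<in> k" "k \<subseteq> {a..b}" using tagged_division_ofD(2,3)[OF p xk] by auto
        then show ?thesis unfolding k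
          by (intro exI[of _ u] exI[of _ v]) auto
      qed
      define D where "D = (\<lambda>(x::real,k). measure lborel k *\<^sub>R h x - (f (Sup k) - f (Inf k)))"
      define B where "B = {xk\<in>p. fst xk \<in> N}"
      have "(\<Sum>(x,k)\<in>p. measure lborel k *\<^sub>R h x) - (f b - f a) = sum D p"
        unfolding additive_tagged_division_1[OF ab p, symmetric] D_def
        by (simp add: sum_subtractf split_def)
      also have "\<dots> = sum D (p - B) + sum D B"
        using sum.subset_diff[of B p D] fin by (auto simp: B_def)
      also have "norm \<dots> \<le> norm (sum D (p - B)) + norm (sum D B)"
        by (rule norm_triangle_ineq)
      also have "\<dots> < e / 2 + e / 2"
      proof (rule add_le_less_mono)
        have "norm (sum D (p - B)) \<le> (\<Sum>xk\<in>p - B. e' * measure lborel (snd xk))"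
        proof (rule sum_norm_le)
          fix xk assume "xk \<in> p - B"
          then obtain x k where xk: "xk = (x,k)" "(x,k) \<in> p" "x \<notin> N"
            by (cases xk) (auto simp: B_def)
          obtain u v where uv: "k = {u..v}" "u \<le> x" "x \<le> v" "a \<le> u" "v \<le> b"
            "Sup k = v" "Inf k = u" "measure lborel k = v - u"
            using pk[OF xk(2)] by auto
          have kb: "{u..v} \<subseteq> ball x (\<delta> x)"
            using fineD[OF fine xk(2)] xk(3) uv(1) by (simp add: \<gamma>_def)
          have "u \<in> ball x (\<delta> x)" "v \<in> ball x (\<delta> x)"
            using kb uv(2,3) by (auto simp del: mem_ball)
          then have uvx: "\<bar>u - x\<bar> < \<delta> x" "\<bar>v - x\<bar> < \<delta> x"
            by (auto simp: dist_real_def abs_minus_commute)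
          have 1: "cmod (f v - f x - (v - x) *\<^sub>R g x) \<le> e' * (v - x)"
            using \<delta>(2)[of x v] uv uvx xk(3) by auto
          have 2: "cmod (f u - f x - (u - x) *\<^sub>R g x) \<le> e' * (x - u)"
            using \<delta>(2)[of x u] uv uvx xk(3) by auto
          \<comment> \<open>Straddling: both endpoints are compared with the tag between them, so
            the error is at most e' times the length of the interval.\<close>
          have "D xk = (f u - f x - (u - x) *\<^sub>R g x) - (f v - f x - (v - x) *\<^sub>R g x)"
            using xk uv(6-8) by (simp add: D_def h_def scaleR_diff_left)
          then have "norm (D xk) \<le> e' * (x - u) + e' * (v - x)"
            using norm_triangle_ineq4 1 2 by (metis add.commute add_mono order_trans)
          then show "norm (D xk) \<le> e' * measure lborel (snd xk)"
            unfolding xk(1) snd_conv uv(8) by (simp add: algebra_simps)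
        qed
        also have "\<dots> \<le> (\<Sum>xk\<in>p. e' * measure lborel (snd xk))"
          using fin e' by (intro sum_mono2) auto
        also have "\<dots> = e' * (b - a)"
          using additive_content_tagged_division[of p a b] p ab
          by (simp add: split_def flip: sum_distrib_left)
        also have "\<dots> \<le> e / 2"
          using ab \<open>e > 0\<close> by (simp add: e'_def field_simps)
        finally show "norm (sum D (p - B)) \<le> e / 2" .
      next
        have "norm (sum D B) \<le> (\<Sum>xk\<in>B. cmod (f (Sup (snd xk)) - f (Inf (snd xk))))"
          by (rule sum_norm_le) (auto simp: D_def B_def h_def norm_minus_commute)
        also have "\<dots> < e / 2"
        proof (rule d(2))
          have 1: "finite B" using fin by (simp add: B_def)
          have 2: "a \<le> Inf (snd i) \<and> Inf (snd i) \<le> Sup (snd i) \<and> Sup (snd i) \<le> b" if "i \<in> B" for i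
            using pk[of "fst i" "snd i"] that by (auto simp: B_def)
          have 3: "{Inf (snd i)<..<Sup (snd i)} \<inter> {Inf (snd j)<..<Sup (snd j)} = {}"
            if "i \<in> B" "j \<in> B" "i \<noteq> j" for i j
          proof -
            have ij: "(fst i, snd i) \<in> p" "(fst j, snd j) \<in> p" "(fst i, snd i) \<noteq> (fst j, snd j)"
              using that by (auto simp: B_def)
            show ?thesis
              using tagged_division_ofD(5)[OF p ij] pk[OF ij(1)] pk[OF ij(2)] by auto
          qed
          show "nonoverlapping a b B (\<lambda>i. Inf (snd i)) (\<lambda>i. Sup (snd i))"
            unfolding nonoverlapping_def using 1 2 3 by blast
          have Bp: "B tagged_division_of \<Union>(snd ` B)"
          proof -
            have "B tagged_partial_division_of {a..b}"
              using p tagged_partial_division_subset[of p "{a..b}" B]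
              by (auto simp: tagged_division_of_def B_def)
            from tagged_partial_division_of_Union_self[OF this] show ?thesis by simp
          qed
          have "(\<Sum>i\<in>B. Sup (snd i) - Inf (snd i)) = (\<Sum>(x,k)\<in>B. measure lborel k)"
            by (rule sum.cong) (use pk in \<open>force simp: B_def\<close>)+
          \<comment> \<open>Different tags can share an interval only if it is degenerate, and then
            its content is 0; so the sum over tagged pairs equals the sum over intervals.\<close>
          also have "\<dots> = sum (measure lborel) (snd ` B)"
            by (rule sum.over_tagged_division_lemma[OF Bp]) (simp add: content_eq_0_interior)
          also have "\<dots> = (\<Sum>k\<in>snd ` B. measure lebesgue k)"
          proof (rule sum.cong[OF refl])
            fix k assume "k \<in> snd ` B"
            then obtain x where "(x, k) \<in> p" by (auto simp: B_def)
            then obtain u v where "k = {u..v}" using pk by blast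
            then show "measure lborel k = measure lebesgue k" by simp
          qed
          also have "\<dots> = measure lebesgue (\<Union>(snd ` B))"
            using content_division[OF division_of_tagged_division[OF Bp]] .
          also have "\<dots> \<le> measure lebesgue U"
          proof (rule measure_mono_fmeasurable)
            show "\<Union>(snd ` B) \<subseteq> U"
              using fine by (force simp: fine_def B_def \<gamma>_def)
            show "\<Union>(snd ` B) \<in> sets lebesgue"
              using lmeasurable_division[OF division_of_tagged_division[OF Bp]] by auto
          qed (rule Um)
          also have "\<dots> < d" by (rule Um)
          finally show "(\<Sum>i\<in>B. Sup (snd i) - Inf (snd i)) < d" .
        qed
        finally show "norm (sum D B) < e / 2" .
      qed
      finally show ?thesis by simp
    qed
    ultimately show "\<exists>\<gamma>. gauge \<gamma> \<and> (\<forall>p. p tagged_division_of {a..b} \<and> \<gamma> fine p \<longrightarrow>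
        norm ((\<Sum>(x,k)\<in>p. measure lborel k *\<^sub>R h x) - (f b - f a)) < e)"
      by (intro exI[of _ \<gamma>] conjI allI impI) (assumption, elim conjE)
  qed
  then show ?thesis
    by (rule has_integral_spike[OF N, rotated]) (auto simp: h_def)
qed

section \<open>The indefinite integral: differentiation almost everywhere and absolute
  continuity\<close>

text \<open>Where the indefinite integral fails to have derivative \<open>f\<close> by a margin \<open>\<eta>\<close>, a Vitali family of
  bad intervals with an endpoint as tag forms a tagged partial division; the Henstock lemma bounds
  its total length.\<close>

lemma AE_has_vector_derivative_integral:
  fixes f :: "real \<Rightarrow> 'a::euclidean_space"
  assumes f: "f integrable_on {a..b}"
  shows "AE x in lebesgue_on {a..b}.
    ((\<lambda>t. integral {a..t} f) has_vector_derivative f x) (at x within {a..b})"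
proof -
  define F where "F t = integral {a..t} f" for t
  define bad where "bad n x y \<longleftrightarrow>
      norm (F y - F x - (y - x) *\<^sub>R f x) > inverse (real (Suc n)) * \<bar>y - x\<bar>" for n x y
  define E where "E n = {x\<in>{a..b}. \<forall>d>0. \<exists>y\<in>{a..b}. y \<noteq> x \<and> \<bar>y - x\<bar> < d \<and> bad n x y}" for n
  have "negligible (E n)" for n
    unfolding negligible_outer_le
  proof (intro allI impI)
    fix e :: real assume "e > 0"
    define \<eta> where "\<eta> = inverse (real (Suc n))"
    have \<eta>: "\<eta> > 0" by (simp add: \<eta>_def)
    \<comment> \<open>The 5 anticipates the Vitali enlargement: the selected bad intervals will have
      total length below \<open>e / 5\<close>, their fivefold enlargements at most e.\<close>
    have e1: "\<eta> * (e / 5) > 0" using \<eta> \<open>e > 0\<close> by simp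
    have fc: "f integrable_on cbox a b" using f by simp
    obtain \<gamma> where \<gamma>: "gauge \<gamma>" "\<And>p. p tagged_partial_division_of cbox a b \<Longrightarrow> \<gamma> fine p \<Longrightarrow>
        (\<Sum>(x,k)\<in>p. norm (measure lborel k *\<^sub>R f x - integral k f)) < \<eta> * (e / 5)"
    proof (rule Henstock_lemma[OF fc e1])
      fix \<gamma>
      assume "gauge \<gamma>" and *: "\<And>p. p tagged_partial_division_of cbox a b \<Longrightarrow> \<gamma> fine p \<Longrightarrow>
        (\<Sum>(x,k)\<in>p. norm (measure lborel k *\<^sub>R f x - integral k f)) < \<eta> * (e / 5)"
      then show thesis by (intro that[of \<gamma>] *)
    qed
    \<comment> \<open>A pair consists of a tag and the other endpoint of its interval;
      \<open>c\<close> and \<open>r\<close> present the same interval as a closed ball, the form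
      required by the Vitali covering lemma.\<close>
    define I where "I = (\<lambda>(x::real,y). {min x y..max x y})"
    define c where "c = (\<lambda>(x::real,y). (x + y) / 2)"
    define r where "r = (\<lambda>(x::real,y). \<bar>y - x\<bar> / 2)"
    define K where "K = {(x,y). x \<in> {a..b} \<and> y \<in> {a..b} \<and> y \<noteq> x \<and> I (x,y) \<subseteq> \<gamma> x \<and>
        norm (F y - F x - (y - x) *\<^sub>R f x) > \<eta> * \<bar>y - x\<bar>}"
    have I_cball: "cball (c i) (r i) = I i" for i
      by (cases i) (auto simp: c_def r_def I_def cball_eq_atLeastAtMost field_simps min_def max_def abs_if)
    have "E n \<subseteq> (\<Union>i\<in>K. cball (c i) (r i))"
    proof
      fix x assume x: "x \<in> E n"
      obtain d where d: "d > 0" "ball x d \<subseteq> \<gamma> x"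
        using \<gamma>(1) unfolding gauge_def open_contains_ball by blast
      obtain y where y: "y \<in> {a..b}" "y \<noteq> x" "\<bar>y - x\<bar> < d" "bad n x y"
        using x d(1) unfolding E_def by blast
      have "I (x,y) \<subseteq> ball x d"
        using y(3) by (auto simp: I_def dist_real_def)
      then have "(x,y) \<in> K" using x y d(2) by (auto simp: K_def E_def bad_def \<eta>_def)
      moreover have "x \<in> cball (c (x,y)) (r (x,y))" unfolding I_cball by (simp add: I_def)
      ultimately show "x \<in> (\<Union>i\<in>K. cball (c i) (r i))" by blast
    qed
    moreover have "0 < r i \<and> r i \<le> b - a" if "i \<in> K" for i
      using that by (auto simp: K_def r_def)
    ultimately obtain C where C: "countable C" "C \<subseteq> K"
      "pairwise (\<lambda>i j. disjnt (cball (c i) (r i)) (cball (c j) (r j))) C"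
      "E n \<subseteq> (\<Union>i\<in>C. cball (c i) (5 * r i))"
      by (rule Vitali_covering_lemma_cballs[where S = "E n" and K = K and a = c and r = r and B = "b - a"])
    \<comment> \<open>Finite subfamilies suffice: C is countable, and a uniform bound on finite
      unions passes to the whole union.\<close>
    have len: "measure lebesgue (\<Union>i\<in>C'. cball (c i) (5 * r i)) \<le> e" if C': "C' \<subseteq> C" "finite C'" for C'
    proof -
      have disj: "I i \<inter> I j = {}" if "i \<in> C'" "j \<in> C'" "i \<noteq> j" for i j
        using C(3) C'(1) that unfolding I_cball pairwise_def disjnt_def by blast
      define T where "T = (\<lambda>i. (fst i :: real, I i))"
      have Ine: "fst i \<in> I i" for i by (cases i) (simp add: I_def)
      have injT: "inj_on T C'"
        using disj Ine unfolding inj_on_def T_def by (metis Int_iff Pair_inject emptyE)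
      have K: "i \<in> K" if "i \<in> C'" for i using C(2) C'(1) that by blast
      have "T ` C' tagged_partial_division_of cbox a b"
        unfolding tagged_partial_division_of_def
      proof (intro conjI allI impI)
        fix x k assume "(x,k) \<in> T ` C'"
        then obtain y where i: "(x,y) \<in> C'" "k = I (x,y)" by (auto simp: T_def)
        show "x \<in> k" "k \<subseteq> cbox a b" "\<exists>a b. k = cbox a b"
          using K[OF i(1)] unfolding i(2) by (auto simp: I_def K_def)
      next
        fix x1 k1 x2 k2
        assume *: "(x1,k1) \<in> T ` C' \<and> (x2,k2) \<in> T ` C' \<and> (x1,k1) \<noteq> (x2,k2)"
        then have "k1 \<inter> k2 = {}" using disj unfolding T_def by fastforce
        then show "interior k1 \<inter> interior k2 = {}" using interior_subset by blast
      qed (use C'(2) in simp)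
      moreover have "\<gamma> fine T ` C'"
        using K by (fastforce simp: fine_def T_def K_def)
      ultimately have "(\<Sum>(x,k)\<in>T ` C'. norm (measure lborel k *\<^sub>R f x - integral k f)) < \<eta> * (e / 5)"
        by (rule \<gamma>(2))
      then have H: "(\<Sum>i\<in>C'. norm (measure lborel (I i) *\<^sub>R f (fst i) - integral (I i) f)) < \<eta> * (e / 5)"
        unfolding sum.reindex[OF injT] by (simp add: T_def o_def)
      have bad: "\<eta> * (2 * r i) \<le> norm (measure lborel (I i) *\<^sub>R f (fst i) - integral (I i) f)"
        if "i \<in> C'" for i
      proof -
        obtain x y where i: "i = (x,y)" by (cases i)
        have xy: "x \<in> {a..b}" "y \<in> {a..b}" "norm (F y - F x - (y - x) *\<^sub>R f x) > \<eta> * \<bar>y - x\<bar>"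
          using K[OF that] unfolding i by (auto simp: K_def)
        have int: "integral {u..v} f = F v - F u" if "u \<in> {a..b}" "v \<in> {a..b}" "u \<le> v" for u v
        proof -
          have "f integrable_on {a..v}"
            using that f by (auto intro: integrable_on_subinterval)
          then show ?thesis
            unfolding F_def using that Henstock_Kurzweil_Integration.integral_combine[of a u v f]
            by (simp add: algebra_simps)
        qed
        have "norm (measure lborel (I i) *\<^sub>R f (fst i) - integral (I i) f)
            = norm (F y - F x - (y - x) *\<^sub>R f x)"
        proof (cases "x \<le> y")
          case True
          then show ?thesis using int[of x y] xy by (simp add: i I_def norm_minus_commute)
        next
          case False
          then have "measure lborel (I i) *\<^sub>R f (fst i) - integral (I i) f
              = F y - F x - (y - x) *\<^sub>R f x"
            using int[of y x] xy by (simp add: i I_def algebra_simps)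
          then show ?thesis by simp
        qed
        then show ?thesis using xy(3) by (simp add: i r_def)
      qed
      have "measure lebesgue (\<Union>i\<in>C'. cball (c i) (5 * r i))
          \<le> (\<Sum>i\<in>C'. measure lebesgue (cball (c i) (5 * r i)))"
        by (rule measure_UNION_le) (use C'(2) in auto)
      also have "\<dots> = (\<Sum>i\<in>C'. 10 * r i)"
      proof (rule sum.cong)
        fix i assume "i \<in> C'"
        then have "r i > 0" using K[of i] by (cases i) (auto simp: K_def r_def)
        then show "measure lebesgue (cball (c i) (5 * r i)) = 10 * r i"
          by (simp add: cball_eq_atLeastAtMost)
      qed simp
      also have "\<dots> = 5 / \<eta> * (\<Sum>i\<in>C'. \<eta> * (2 * r i))"
        using \<eta> by (simp add: sum_distrib_left)
      also have "\<dots> \<le> 5 / \<eta> * (\<eta> * (e / 5))"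
        using sum_mono[OF bad, of C' "\<lambda>i. i"] H \<eta> by (intro mult_left_mono) auto
      also have "\<dots> = e" using \<eta> by simp
      finally show ?thesis .
    qed
    have "(\<Union>i\<in>C. cball (c i) (5 * r i)) \<in> lmeasurable"
      "measure lebesgue (\<Union>i\<in>C. cball (c i) (5 * r i)) \<le> e"
      using fmeasurable_UN_bound[OF C(1) _ len] measure_UN_bound[OF C(1) _ len] by auto
    then show "\<exists>T. E n \<subseteq> T \<and> T \<in> lmeasurable \<and> measure lebesgue T \<le> e"
      using C(4) by blast
  qed
  then have N: "negligible (\<Union>n. E n)" by (intro negligible_Union_nat) auto
  have "(F has_vector_derivative f x) (at x within {a..b})" if x: "x \<in> {a..b} - (\<Union>n. E n)" for x
    unfolding has_vector_derivative_def has_derivative_within_alt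
  proof (intro conjI allI impI)
    fix e :: real assume "e > 0"
    then obtain n where n: "inverse (real (Suc n)) < e" using reals_Archimedean by blast
    have "x \<in> {a..b}" "x \<notin> E n" using x by blast+
    then obtain d where d: "d > 0" "\<And>y. y \<in> {a..b} \<Longrightarrow> y \<noteq> x \<Longrightarrow> \<bar>y - x\<bar> < d \<Longrightarrow> \<not> bad n x y"
      unfolding E_def by blast
    have "norm (F y - F x - (y - x) *\<^sub>R f x) \<le> e * norm (y - x)"
      if "y \<in> {a..b}" "norm (y - x) < d" for y
    proof (cases "y = x")
      case False
      then have "norm (F y - F x - (y - x) *\<^sub>R f x) \<le> inverse (real (Suc n)) * \<bar>y - x\<bar>"
        using d(2)[of y] that by (simp add: bad_def del: of_nat_Suc)
      also have "\<dots> \<le> e * \<bar>y - x\<bar>" using n by (intro mult_right_mono) auto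
      finally show ?thesis by simp
    qed simp
    then show "\<exists>d>0. \<forall>y\<in>{a..b}. norm (y - x) < d \<longrightarrow>
        norm (F y - F x - (y - x) *\<^sub>R f x) \<le> e * norm (y - x)"
      using d(1) by blast
  qed (rule bounded_linear_scaleR_left)
  then show ?thesis
    unfolding AE_lebesgue_on_iff_negligible F_def using N by blast
qed

text \<open>The integral of the part of s above level N tends to 0 by dominated convergence. This
  uniform integrability allows an integrable function to be treated as a bounded one plus an
  L1-small remainder.\<close>

lemma integral_excess_small:
  fixes s :: "real \<Rightarrow> real"
  assumes s: "s absolutely_integrable_on {a..b}" "\<And>x. x \<in> {a..b} \<Longrightarrow> s x \<ge> 0" and e: "e > 0"
  obtains N where "N \<ge> 0" "(\<lambda>x. max 0 (s x - N)) integrable_on {a..b}"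
    "integral {a..b} (\<lambda>x. max 0 (s x - N)) < e"
proof -
  have int: "(\<lambda>x. max 0 (s x - real n)) integrable_on {a..b}" for n
  proof -
    have "(\<lambda>x. max (s x - real n) 0) absolutely_integrable_on {a..b}"
      by (intro absolutely_integrable_max_1 set_integral_diff s(1)) auto
    then show ?thesis by (simp add: max.commute set_lebesgue_integral_eq_integral(1))
  qed
  have "(\<lambda>n. integral {a..b} (\<lambda>x. max 0 (s x - real n))) \<longlonglongrightarrow> integral {a..b} (\<lambda>x. 0)"
  proof (rule dominated_convergence(2)[where h = s])
    show "s integrable_on {a..b}" using s(1) by (rule set_lebesgue_integral_eq_integral(1))
    show "norm (max 0 (s x - real n)) \<le> s x" if "x \<in> {a..b}" for n x
      using s(2)[OF that] by auto
    show "(\<lambda>n. max 0 (s x - real n)) \<longlonglongrightarrow> 0" for x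
    proof (rule tendsto_eventually)
      obtain n0 :: nat where "s x \<le> real n0" using real_arch_simple by blast
      then show "\<forall>\<^sub>F n in sequentially. max 0 (s x - real n) = 0"
        by (intro eventually_sequentiallyI[of n0]) auto
    qed
  qed (rule int)
  then have "\<forall>\<^sub>F n in sequentially. integral {a..b} (\<lambda>x. max 0 (s x - real n)) < e"
    using e by (auto intro: order_tendstoD(2))
  then obtain n where "integral {a..b} (\<lambda>x. max 0 (s x - real n)) < e"
    by (auto simp: eventually_sequentially)
  then show ?thesis using int by (intro that[of "real n"]) auto
qed

text \<open>Passing to the open intervals changes no integral, and then at most one of the indicator
  terms is nonzero at any point, so their sum is dominated by g.\<close>

lemma sum_integral_nonoverlapping_le:
  fixes g :: "real \<Rightarrow> real"
  assumes g: "g integrable_on {a..b}" "\<And>x. x \<in> {a..b} \<Longrightarrow> g x \<ge> 0" and I: "nonoverlapping a b I u v"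
  shows "(\<Sum>i\<in>I. integral {u i..v i} g) \<le> integral {a..b} g"
proof -
  have fin: "finite I" using I by (simp add: nonoverlapping_def)
  have sub: "{u i<..<v i} \<subseteq> {a..b}" if "i \<in> I" for i
    using nonoverlapping_bounds[OF I that] by auto
  have gi: "(\<lambda>x. if x \<in> {u i<..<v i} then g x else 0) integrable_on {a..b}"
    "integral {u i..v i} g = integral {a..b} (\<lambda>x. if x \<in> {u i<..<v i} then g x else 0)" if "i \<in> I" for i
  proof -
    have "g integrable_on {u i..v i}"
      using nonoverlapping_bounds[OF I that] by (intro integrable_on_subinterval[OF g(1)]) auto
    then have "g integrable_on {u i<..<v i}" by (simp add: integrable_on_Icc_iff_Ioo)
    then have "(g has_integral integral {u i<..<v i} g) {u i<..<v i}" by (rule integrable_integral)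
    then have *: "((\<lambda>x. if x \<in> {u i<..<v i} then g x else 0) has_integral integral {u i<..<v i} g) {a..b}"
      using has_integral_restrict[OF sub[OF that]] by blast
    show "(\<lambda>x. if x \<in> {u i<..<v i} then g x else 0) integrable_on {a..b}"
      using * by blast
    show "integral {u i..v i} g = integral {a..b} (\<lambda>x. if x \<in> {u i<..<v i} then g x else 0)"
      using integral_unique[OF *] by (simp add: integral_open_interval_real)
  qed
  have "(\<Sum>i\<in>I. integral {u i..v i} g)
      = integral {a..b} (\<lambda>x. \<Sum>i\<in>I. if x \<in> {u i<..<v i} then g x else 0)"
    using gi by (simp add: Henstock_Kurzweil_Integration.integral_sum[OF fin])
  also have "\<dots> \<le> integral {a..b} g"
  proof (rule integral_le)
    show "(\<lambda>x. \<Sum>i\<in>I. if x \<in> {u i<..<v i} then g x else 0) integrable_on {a..b}"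
      by (intro integrable_sum fin gi(1))
    fix x assume x: "x \<in> {a..b}"
    show "(\<Sum>i\<in>I. if x \<in> {u i<..<v i} then g x else 0) \<le> g x"
    proof (cases "\<exists>j\<in>I. x \<in> {u j<..<v j}")
      case True
      then obtain j where j: "j \<in> I" "x \<in> {u j<..<v j}" by blast
      have "x \<notin> {u i<..<v i}" if "i \<in> I" "i \<noteq> j" for i
        using I that j unfolding nonoverlapping_def by blast
      then have "(\<Sum>i\<in>I. if x \<in> {u i<..<v i} then g x else 0) = (\<Sum>i\<in>I. if i = j then g x else 0)"
        using j(2) by (intro sum.cong) auto
      then show ?thesis using fin j(1) by simp
    next
      case False
      then have "(\<Sum>i\<in>I. if x \<in> {u i<..<v i} then g x else 0) = 0" by (intro sum.neutral) auto
      then show ?thesis using g(2)[OF x] by simp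
    qed
  qed (rule g(1))
  finally show ?thesis .
qed

lemma abs_cont_on_integral:
  fixes f :: "real \<Rightarrow> complex"
  assumes f: "f absolutely_integrable_on {a..b}"
  shows "abs_cont_on a b (\<lambda>t. integral {a..t} f)"
proof (rule abs_cont_onI)
  fix e :: real assume "e > 0"
  then have e2: "e / 2 > 0" by simp
  have nf: "(\<lambda>x. cmod (f x)) absolutely_integrable_on {a..b}"
    using f by (rule set_integrable_norm)
  obtain N where N: "N \<ge> 0" "(\<lambda>x. max 0 (cmod (f x) - N)) integrable_on {a..b}"
    "integral {a..b} (\<lambda>x. max 0 (cmod (f x) - N)) < e / 2"
    using integral_excess_small[OF nf _ e2] by auto
  \<comment> \<open>Since \<open>cmod (f x) \<le> N + g x\<close>, the bounded part contributes N
    times the total length of a family of intervals, and the excess contributes less than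
    \<open>e / 2\<close> over any family.\<close>
  define g where "g x = max 0 (cmod (f x) - N)" for x
  define d where "d = e / (2 * (N + 1))"
  have d: "d > 0" "N * d < e / 2"
  proof -
    show "d > 0" using \<open>e > 0\<close> N(1) by (simp add: d_def)
    moreover have "(N + 1) * d = e / 2" using N(1) by (simp add: d_def field_simps)
    ultimately show "N * d < e / 2" by (simp add: algebra_simps)
  qed
  have "(\<Sum>i<n. cmod (integral {a..v i} f - integral {a..u i} f)) < e"
    if I: "nonoverlapping a b {..<n} u v" and len: "(\<Sum>i<n. v i - u i) < d" for n :: nat and u v
  proof -
    have "cmod (integral {a..v i} f - integral {a..u i} f) \<le> N * (v i - u i) + integral {u i..v i} g"
      if "i \<in> {..<n}" for i
    proof -
      note b = nonoverlapping_bounds[OF I that]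
      have fi: "f absolutely_integrable_on {a..v i}" "f absolutely_integrable_on {u i..v i}"
        using b by (auto intro: absolutely_integrable_on_subinterval[OF f])
      have gi: "g integrable_on {u i..v i}"
        using b N(2) unfolding g_def by (auto intro: integrable_on_subinterval)
      have "integral {a..v i} f - integral {a..u i} f = integral {u i..v i} f"
        using Henstock_Kurzweil_Integration.integral_combine[of a "u i" "v i" f] b fi(1)
        by (simp add: set_lebesgue_integral_eq_integral(1) algebra_simps)
      also have "cmod \<dots> \<le> integral {u i..v i} (\<lambda>x. N + g x)"
        by (rule Henstock_Kurzweil_Integration.integral_norm_bound_integral)
          (use fi(2) gi[unfolded g_def] in \<open>auto simp: set_lebesgue_integral_eq_integral(1) g_def intro!: integrable_add\<close>)
      also have "\<dots> = N * (v i - u i) + integral {u i..v i} g"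
        using gi b(3) by (subst Henstock_Kurzweil_Integration.integral_add) auto
      finally show ?thesis .
    qed
    then have "(\<Sum>i<n. cmod (integral {a..v i} f - integral {a..u i} f))
        \<le> (\<Sum>i<n. N * (v i - u i) + integral {u i..v i} g)" by (rule sum_mono)
    also have "\<dots> = N * (\<Sum>i<n. v i - u i) + (\<Sum>i<n. integral {u i..v i} g)"
      by (simp add: sum.distrib sum_distrib_left)
    also have "\<dots> \<le> N * d + integral {a..b} g"
      using sum_integral_nonoverlapping_le[of g a b, OF N(2)[folded g_def] _ I] len N(1)
      by (intro add_mono mult_left_mono) (auto simp: g_def)
    also have "\<dots> < e" using d(2) N(3)[folded g_def] by simp
    finally show ?thesis .
  qed
  then show "\<exists>d>0. \<forall>n u v. nonoverlapping a b {..<n::nat} u v \<longrightarrow> (\<Sum>i<n. v i - u i) < d \<longrightarrow>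
      (\<Sum>i<n. cmod (integral {a..v i} f - integral {a..u i} f)) < e"
    using d(1) by blast
qed

lemma abs_cont_on_eq_integral:
  assumes ac: "abs_cont_on a b f" and t: "t \<in> {a..b}"
    and der: "AE x in lebesgue_on {a..b}. (f has_vector_derivative g x) (at x within {a..b})"
  shows "f t = f a + integral {a..t} g"
proof -
  obtain N where N: "negligible N"
    "\<And>x. x \<in> {a..b} - N \<Longrightarrow> (f has_vector_derivative g x) (at x within {a..b})"
    using der unfolding AE_lebesgue_on_iff_negligible by blast
  have "(g has_integral (f t - f a)) {a..t}"
  proof (rule abs_cont_on_has_integral_derivative)
    show "abs_cont_on a t f" using ac t by (intro abs_cont_on_subinterval[OF ac]) auto
    have "(f has_vector_derivative g x) (at x within {a..t})" if "x \<in> {a..t} - N" for x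
      using N(2)[of x] that t by (auto intro: has_vector_derivative_within_subset)
    then show "AE x in lebesgue_on {a..t}. (f has_vector_derivative g x) (at x within {a..t})"
      unfolding AE_lebesgue_on_iff_negligible using N(1) by blast
  qed (use t in auto)
  from integral_unique[OF this] show ?thesis by simp
qed

section \<open>Linear systems with integrable coefficients\<close>

lemma absolutely_integrable_mult_continuous:
  fixes f g :: "real \<Rightarrow> 'a::{euclidean_space, real_normed_algebra}"
  assumes f: "f absolutely_integrable_on {a..b}" and g: "continuous_on {a..b} g"
  shows "(\<lambda>x. f x * g x) absolutely_integrable_on {a..b}"
proof -
  have "bounded (g ` {a..b})"
    by (intro compact_imp_bounded compact_continuous_image g) simp
  moreover have "bilinear (\<lambda>(y::'a) x. x * y)"
    using bounded_bilinear.flip[OF bounded_bilinear_mult] bilinear_conv_bounded_bilinear by blast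
  ultimately show ?thesis
    using absolutely_integrable_bounded_measurable_product[of "\<lambda>y x. x * y" g "{a..b}" f]
      continuous_imp_measurable_on_sets_lebesgue[OF g] f by simp
qed

text \<open>Absorption of a self-referential estimate: boundedness makes the supremum M finite, so
  \<open>M \<le> X + M / 2\<close> can be solved for M.\<close>

lemma bound_by_halving:
  fixes f :: "'a \<Rightarrow> real"
  assumes bdd: "bdd_above (f ` S)" and nonneg: "\<And>x. x \<in> S \<Longrightarrow> 0 \<le> f x"
    and step: "\<And>M x. 0 \<le> M \<Longrightarrow> (\<And>y. y \<in> S \<Longrightarrow> f y \<le> M) \<Longrightarrow> x \<in> S \<Longrightarrow> f x \<le> X + M / 2"
    and x: "x \<in> S"
  shows "f x \<le> 2 * X"
proof -
  define M where "M = Sup (f ` S)"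
  have M: "f y \<le> M" if "y \<in> S" for y
    unfolding M_def using bdd that by (intro cSUP_upper) auto
  have "0 \<le> M" using nonneg[OF x] M[OF x] by linarith
  then have "M \<le> X + M / 2"
    using step[OF _ M] x unfolding M_def by (intro cSUP_least) auto
  with M[OF x] show ?thesis by linarith
qed

text \<open>A Bielecki weight. The bounded part N of s is beaten by the growth rate l, and the
  excess over N has integral below 1/4 while the weight is increasing; each part contributes at most
  a quarter of the weight at t.\<close>

lemma exponential_weight:
  fixes s :: "real \<Rightarrow> real"
  assumes s: "s absolutely_integrable_on {a..b}" "\<And>x. x \<in> {a..b} \<Longrightarrow> s x \<ge> 0"
  obtains l where "l > 0"
    "\<And>t. t \<in> {a..b} \<Longrightarrow> integral {a..t} (\<lambda>x. s x * exp (l * (x - a))) \<le> exp (l * (t - a)) / 2"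
proof -
  obtain N where N: "N \<ge> 0" "(\<lambda>x. max 0 (s x - N)) integrable_on {a..b}"
    "integral {a..b} (\<lambda>x. max 0 (s x - N)) < 1 / 4"
    using integral_excess_small[OF s, of "1 / 4"] by auto
  define g where "g x = max 0 (s x - N)" for x
  \<comment> \<open>The factor 4 gives \<open>N / l \<le> 1 / 4\<close>; the added 1 keeps l
    positive when N = 0.\<close>
  define l where "l = 4 * (N + 1)"
  have l: "l > 0" using N(1) by (simp add: l_def)
  define w where "w x = exp (l * (x - a))" for x
  have "integral {a..t} (\<lambda>x. s x * w x) \<le> w t / 2" if t: "t \<in> {a..b}" for t
  proof -
    have sub: "{a..t} \<subseteq> {a..b}" using t by auto
    have ab: "a \<le> t" "t \<le> b" using t by auto
    have w0: "(w has_integral (w t / l - w a / l)) {a..t}"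
      using ab l unfolding w_def
      by (intro fundamental_theorem_of_calculus)
        (auto intro!: derivative_eq_intros simp flip: has_real_derivative_iff_has_vector_derivative)
    then have wi: "((\<lambda>x. N * w x) has_integral (N * (w t / l - w a / l))) {a..t}"
      by (rule has_integral_mult_right)
    have gi: "g integrable_on {a..t}" "integral {a..t} g \<le> 1 / 4"
    proof -
      show 1: "g integrable_on {a..t}"
        using N(2) ab unfolding g_def by (auto intro: integrable_on_subinterval)
      have "integral {a..t} g \<le> integral {a..b} g"
        using 1 N(2) sub unfolding g_def by (intro integral_subset_le) auto
      then show "integral {a..t} g \<le> 1 / 4" using N(3) by (simp add: g_def[abs_def])
    qed
    have gw: "(\<lambda>x. g x * w t) integrable_on {a..t}"
      using gi(1) by (rule integrable_on_mult_left)
    have "integral {a..t} (\<lambda>x. s x * w x) \<le> integral {a..t} (\<lambda>x. N * w x + g x * w t)"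
    proof (rule integral_le)
      have "s absolutely_integrable_on {a..t}"
        using s(1) ab by (auto intro: absolutely_integrable_on_subinterval)
      then have "(\<lambda>x. s x * w x) absolutely_integrable_on {a..t}"
        by (rule absolutely_integrable_mult_continuous) (auto simp: w_def intro!: continuous_intros)
      then show "(\<lambda>x. s x * w x) integrable_on {a..t}" by (rule set_lebesgue_integral_eq_integral(1))
      show "(\<lambda>x. N * w x + g x * w t) integrable_on {a..t}"
        using wi gw by (intro integrable_add) auto
      fix x assume x: "x \<in> {a..t}"
      have "s x \<le> N + g x" "g x \<ge> 0" by (auto simp: g_def)
      moreover have "0 < w x" "w x \<le> w t" using x l by (auto simp: w_def)
      ultimately have "s x * w x \<le> (N + g x) * w x" "g x * w x \<le> g x * w t"
        by (auto intro: mult_right_mono mult_left_mono)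
      then show "s x * w x \<le> N * w x + g x * w t" by (simp add: algebra_simps)
    qed
    also have "\<dots> = N * (w t / l - w a / l) + integral {a..t} g * w t"
      using wi gw integral_unique[OF w0]
      by (subst Henstock_Kurzweil_Integration.integral_add) (auto simp: has_integral_integrable)
    also have "\<dots> \<le> w t / 4 + 1 / 4 * w t"
    proof (intro add_mono mult_right_mono gi(2))
      have "N * (w t / l - w a / l) \<le> N * (w t / l)"
        using N(1) l by (intro mult_left_mono) (auto simp: w_def)
      also have "\<dots> = N / l * w t" by simp
      also have "\<dots> \<le> 1 / 4 * w t"
        using N(1) by (intro mult_right_mono) (auto simp: l_def w_def field_simps)
      finally show "N * (w t / l - w a / l) \<le> w t / 4" by simp
    qed (simp add: w_def)
    finally show ?thesis by simp
  qed
  then show ?thesis using that[OF l] unfolding w_def by blast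
qed

section \<open>Volterra equations: initial value problems and a Gronwall bound\<close>

locale linear_system =
  fixes m :: nat and a b :: real and A :: "nat \<Rightarrow> nat \<Rightarrow> real \<Rightarrow> complex"
  assumes ab: "a < b"
    and A: "\<And>k j. k < m \<Longrightarrow> j < m \<Longrightarrow> A k j absolutely_integrable_on {a..b}"
begin

definition solves :: "(nat \<Rightarrow> real \<Rightarrow> complex) \<Rightarrow> (nat \<Rightarrow> real \<Rightarrow> complex) \<Rightarrow> bool" where
  "solves F Z \<longleftrightarrow> (\<forall>k<m. abs_cont_on a b (Z k) \<and>
     (AE x in lebesgue_on {a..b}.
        (Z k has_vector_derivative (\<Sum>j<m. A k j x * Z j x) + F k x) (at x within {a..b})))"

definition L1 :: "(nat \<Rightarrow> real \<Rightarrow> complex) \<Rightarrow> bool" where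
  "L1 F \<longleftrightarrow> (\<forall>k<m. F k absolutely_integrable_on {a..b})"

definition L1norm :: "(nat \<Rightarrow> real \<Rightarrow> complex) \<Rightarrow> real" where
  "L1norm F = (\<Sum>k<m. integral {a..b} (\<lambda>x. cmod (F k x)))"

text \<open>The Volterra operator of the homogeneous system; a solution Z is a fixed point of
  initial value plus integral of the source plus \<open>V\<close> applied to Z.\<close>

definition V :: "nat \<Rightarrow> (nat \<Rightarrow> real \<Rightarrow> complex) \<Rightarrow> real \<Rightarrow> complex" where
  "V k Z t = integral {a..t} (\<lambda>x. \<Sum>j<m. A k j x * Z j x)"

lemma coeff_integrable:
  assumes "k < m" "\<And>j. j < m \<Longrightarrow> continuous_on {a..b} (Z j)"
  shows "(\<lambda>x. \<Sum>j<m. A k j x * Z j x) absolutely_integrable_on {a..b}"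
  by (intro absolutely_integrable_sum absolutely_integrable_mult_continuous A assms) auto

lemma solves_continuous: "solves F Z \<Longrightarrow> k < m \<Longrightarrow> continuous_on {a..b} (Z k)"
  unfolding solves_def by (blast intro: abs_cont_on_imp_continuous_on)

lemma integral_subinterval:
  fixes f :: "real \<Rightarrow> complex"
  assumes "f absolutely_integrable_on {a..b}" "t \<in> {a..b}"
  shows "f absolutely_integrable_on {a..t}" "f integrable_on {a..t}"
proof -
  show "f absolutely_integrable_on {a..t}"
    using assms by (auto intro: absolutely_integrable_on_subinterval)
  then show "f integrable_on {a..t}" by (rule set_lebesgue_integral_eq_integral(1))
qed

lemma solves_integral_eq:
  assumes Z: "solves F Z" and F: "L1 F" and k: "k < m" and t: "t \<in> {a..b}"
  shows "Z k t = Z k a + integral {a..t} (F k) + V k Z t"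
proof -
  have "Z k t = Z k a + integral {a..t} (\<lambda>x. (\<Sum>j<m. A k j x * Z j x) + F k x)"
    using Z k t unfolding solves_def by (intro abs_cont_on_eq_integral) auto
  also have "integral {a..t} (\<lambda>x. (\<Sum>j<m. A k j x * Z j x) + F k x) = V k Z t + integral {a..t} (F k)"
    unfolding V_def
    using integral_subinterval(2)[OF coeff_integrable[OF k solves_continuous[OF Z]] t]
      integral_subinterval(2)[OF _ t] F k
    by (intro Henstock_Kurzweil_Integration.integral_add) (auto simp: L1_def)
  finally show ?thesis by simp
qed

text \<open>A continuous solution of the integral equation is, up to a constant, an indefinite
  integral of an absolutely integrable function, so absolute continuity and the differential
  equation come for free. The initial value is read off at t = a, where both integrals
  vanish.\<close>

lemma solvesI:
  assumes cont: "\<And>k. k < m \<Longrightarrow> continuous_on {a..b} (Z k)" and F: "L1 F"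
    and eq: "\<And>k t. k < m \<Longrightarrow> t \<in> {a..b} \<Longrightarrow> Z k t = c k + integral {a..t} (F k) + V k Z t"
  shows "solves F Z" and "\<And>k. k < m \<Longrightarrow> Z k a = c k"
proof -
  show "Z k a = c k" if "k < m" for k
    using eq[OF that, of a] ab by (simp add: V_def)
  show "solves F Z"
    unfolding solves_def
  proof (intro allI impI)
    fix k assume k: "k < m"
    define f where "f x = (\<Sum>j<m. A k j x * Z j x) + F k x" for x
    have f: "f absolutely_integrable_on {a..b}"
      unfolding f_def using coeff_integrable[OF k cont] F k by (auto simp: L1_def)
    have Zk: "c k + integral {a..t} f = Z k t" if t: "t \<in> {a..b}" for t
    proof -
      have "integral {a..t} f = V k Z t + integral {a..t} (F k)"
        unfolding V_def f_def
        using integral_subinterval(2)[OF coeff_integrable[OF k cont] t]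
          integral_subinterval(2)[OF _ t] F k
        by (intro Henstock_Kurzweil_Integration.integral_add) (auto simp: L1_def)
      then show ?thesis using eq[OF k t] by simp
    qed
    have "abs_cont_on a b (Z k)"
      by (rule abs_cont_on_cong[OF abs_cont_on_add[OF abs_cont_on_const abs_cont_on_integral[OF f]] Zk])
    moreover have "AE x in lebesgue_on {a..b}. (Z k has_vector_derivative f x) (at x within {a..b})"
    proof -
      have "AE x in lebesgue_on {a..b}.
          ((\<lambda>t. integral {a..t} f) has_vector_derivative f x) (at x within {a..b})"
        by (intro AE_has_vector_derivative_integral set_lebesgue_integral_eq_integral(1) f)
      moreover have "AE x in lebesgue_on {a..b}. x \<in> {a..b}"
        by (rule AE_I2) simp
      ultimately show ?thesis
      proof eventually_elim
        case (elim x)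
        then have "((\<lambda>t. c k + integral {a..t} f) has_vector_derivative f x) (at x within {a..b})"
          by (auto intro!: derivative_eq_intros)
        then show ?case
          by (rule has_vector_derivative_transform[OF elim(2), rotated]) (simp add: Zk)
      qed
    qed
    ultimately show "abs_cont_on a b (Z k) \<and> (AE x in lebesgue_on {a..b}.
        (Z k has_vector_derivative (\<Sum>j<m. A k j x * Z j x) + F k x) (at x within {a..b}))"
      by (simp add: f_def)
  qed
qed

text \<open>In the sup norm weighted by 1 / w the Volterra operator has norm at most 1/2 on the
  whole interval, however large the coefficients are: s dominates every row sum of the matrix of
  moduli, and w is the exponential weight belonging to s.\<close>

lemma weighted_contraction:
  obtains w :: "real \<Rightarrow> real" where "continuous_on {a..b} w" "\<And>t. t \<in> {a..b} \<Longrightarrow> 1 \<le> w t"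
    "\<And>Z M k t. (\<And>j t. j < m \<Longrightarrow> t \<in> {a..b} \<Longrightarrow> cmod (Z j t) \<le> M * w t) \<Longrightarrow>
      (\<And>j. j < m \<Longrightarrow> continuous_on {a..b} (Z j)) \<Longrightarrow> 0 \<le> M \<Longrightarrow> k < m \<Longrightarrow> t \<in> {a..b} \<Longrightarrow>
      cmod (V k Z t) \<le> M * w t / 2"
proof -
  define s where "s x = (\<Sum>k<m. \<Sum>j<m. cmod (A k j x))" for x
  have s: "s absolutely_integrable_on {a..b}"
    unfolding s_def by (intro absolutely_integrable_sum set_integrable_norm A) auto
  have s0: "s x \<ge> 0" for x by (simp add: s_def sum_nonneg)
  obtain l where l: "l > 0"
    "\<And>t. t \<in> {a..b} \<Longrightarrow> integral {a..t} (\<lambda>x. s x * exp (l * (x - a))) \<le> exp (l * (t - a)) / 2"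
    using exponential_weight[OF s s0] by blast
  define w where "w x = exp (l * (x - a))" for x
  have wc: "continuous_on {a..b} w" by (auto simp: w_def intro!: continuous_intros)
  show ?thesis
  proof (rule that[OF wc])
    show "1 \<le> w t" if "t \<in> {a..b}" for t using l(1) that by (simp add: w_def)
    fix Z :: "nat \<Rightarrow> real \<Rightarrow> complex" and M k t
    assume Z: "\<And>j t. j < m \<Longrightarrow> t \<in> {a..b} \<Longrightarrow> cmod (Z j t) \<le> M * w t"
      "\<And>j. j < m \<Longrightarrow> continuous_on {a..b} (Z j)" and M: "0 \<le> M" and k: "k < m" and t: "t \<in> {a..b}"
    have sw: "(\<lambda>x. s x * w x) absolutely_integrable_on {a..b}"
      by (rule absolutely_integrable_mult_continuous[OF s wc])
    have swt: "(\<lambda>x. M * (s x * w x)) integrable_on {a..t}"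
      using t by (intro integrable_on_mult_right set_lebesgue_integral_eq_integral(1)
          absolutely_integrable_on_subinterval[OF sw]) auto
    have "cmod (V k Z t) \<le> integral {a..t} (\<lambda>x. M * (s x * w x))"
      unfolding V_def
    proof (rule Henstock_Kurzweil_Integration.integral_norm_bound_integral[OF _ swt])
      show "(\<lambda>x. \<Sum>j<m. A k j x * Z j x) integrable_on {a..t}"
        using integral_subinterval(2)[OF coeff_integrable[OF k Z(2)] t] .
      fix x assume "x \<in> {a..t}"
      then have x: "x \<in> {a..b}" using t by auto
      have "cmod (\<Sum>j<m. A k j x * Z j x) \<le> (\<Sum>j<m. cmod (A k j x) * (M * w x))"
        by (rule sum_norm_le) (use x in \<open>auto simp: norm_mult intro!: mult_left_mono Z(1)\<close>)
      also have "\<dots> = (\<Sum>j<m. cmod (A k j x)) * (M * w x)" by (simp add: sum_distrib_right)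
      also have "\<dots> \<le> s x * (M * w x)"
      proof (rule mult_right_mono)
        show "(\<Sum>j<m. cmod (A k j x)) \<le> s x"
          unfolding s_def using k
          by (intro member_le_sum[where f = "\<lambda>k. \<Sum>j<m. cmod (A k j x)"]) (auto simp: sum_nonneg)
      qed (use M in \<open>simp add: w_def\<close>)
      finally show "cmod (\<Sum>j<m. A k j x * Z j x) \<le> M * (s x * w x)" by (simp add: algebra_simps)
    qed
    also have "\<dots> = M * integral {a..t} (\<lambda>x. s x * w x)" by simp
    also have "\<dots> \<le> M * (w t / 2)"
      using l(2)[OF t] M unfolding w_def by (intro mult_left_mono)
    finally show "cmod (V k Z t) \<le> M * w t / 2" by simp
  qed
qed

lemma V_continuous:
  assumes "k < m" "\<And>j. j < m \<Longrightarrow> continuous_on {a..b} (Z j)"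
  shows "continuous_on {a..b} (V k Z)"
  using indefinite_integral_continuous_1[OF set_lebesgue_integral_eq_integral(1)[OF coeff_integrable[OF assms]]]
  unfolding V_def[abs_def] .

lemma V_diff:
  assumes "k < m" "\<And>j. j < m \<Longrightarrow> continuous_on {a..b} (Z j)"
    "\<And>j. j < m \<Longrightarrow> continuous_on {a..b} (Z' j)" "t \<in> {a..b}"
  shows "V k (\<lambda>j x. Z j x - Z' j x) t = V k Z t - V k Z' t"
  unfolding V_def right_diff_distrib sum_subtractf
  by (intro Henstock_Kurzweil_Integration.integral_diff integral_subinterval(2) coeff_integrable assms)

lemma continuous_family_bounded:
  fixes Z :: "nat \<Rightarrow> real \<Rightarrow> complex"
  assumes "\<And>j. j < m \<Longrightarrow> continuous_on {a..b} (Z j)"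
  obtains M where "0 \<le> M" "\<And>j t. j < m \<Longrightarrow> t \<in> {a..b} \<Longrightarrow> cmod (Z j t) \<le> M"
proof -
  have "\<exists>M. \<forall>t\<in>{a..b}. cmod (Z j t) \<le> M" if "j < m" for j
  proof -
    have "bounded (Z j ` {a..b})"
      by (intro compact_imp_bounded compact_continuous_image assms that) simp
    then show ?thesis unfolding bounded_iff by auto
  qed
  then obtain B where B: "\<And>j t. j < m \<Longrightarrow> t \<in> {a..b} \<Longrightarrow> cmod (Z j t) \<le> B j" by metis
  have "cmod (Z j t) \<le> (\<Sum>j<m. \<bar>B j\<bar>)" if "j < m" "t \<in> {a..b}" for j t
    using B[OF that] member_le_sum[of j "{..<m}" "\<lambda>j. \<bar>B j\<bar>"] that by auto
  then show ?thesis by (intro that[of "\<Sum>j<m. \<bar>B j\<bar>"]) (auto simp: sum_nonneg)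
qed

text \<open>Picard iteration, convergent on all of [a,b] at once because the Volterra operator
  halves the weighted norm.\<close>

theorem initial_value_problem:
  assumes F: "L1 F"
  shows "\<exists>Z. solves F Z \<and> (\<forall>k<m. Z k a = c k)"
proof -
  obtain w :: "real \<Rightarrow> real" where w: "continuous_on {a..b} w" "\<And>t. t \<in> {a..b} \<Longrightarrow> 1 \<le> w t"
    "\<And>Z M k t. (\<And>j t. j < m \<Longrightarrow> t \<in> {a..b} \<Longrightarrow> cmod (Z j t) \<le> M * w t) \<Longrightarrow>
      (\<And>j. j < m \<Longrightarrow> continuous_on {a..b} (Z j)) \<Longrightarrow> 0 \<le> M \<Longrightarrow> k < m \<Longrightarrow> t \<in> {a..b} \<Longrightarrow>
      cmod (V k Z t) \<le> M * w t / 2"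
    using weighted_contraction by blast
  define \<Phi> where "\<Phi> Z k t = c k + integral {a..t} (F k) + V k Z t" for Z k t
  define S where "S = rec_nat (\<lambda>k t. 0) (\<lambda>_. \<Phi>)"
  have S0: "S 0 = (\<lambda>k t. 0)" and SS: "S (Suc n) = \<Phi> (S n)" for n by (simp_all add: S_def)
  have Sc: "continuous_on {a..b} (S n k)" if "k < m" for n k
    using that
  proof (induction n arbitrary: k)
    case (Suc n)
    have "continuous_on {a..b} (\<lambda>t. c k + integral {a..t} (F k) + V k (S n) t)"
      using F Suc.prems unfolding L1_def
      by (intro continuous_intros V_continuous Suc.IH indefinite_integral_continuous_1
          set_lebesgue_integral_eq_integral(1)) auto
    then show ?case by (simp add: SS \<Phi>_def[abs_def])
  qed (simp add: S0)
  have \<Phi>_diff: "\<Phi> Z k t - \<Phi> Z' k t = V k (\<lambda>j x. Z j x - Z' j x) t"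
    if "\<And>j. j < m \<Longrightarrow> continuous_on {a..b} (Z j)" "\<And>j. j < m \<Longrightarrow> continuous_on {a..b} (Z' j)"
      "k < m" "t \<in> {a..b}" for Z Z' k t
    using V_diff[of k Z Z' t] that by (simp add: \<Phi>_def)
  obtain M where M: "0 \<le> M" "\<And>j t. j < m \<Longrightarrow> t \<in> {a..b} \<Longrightarrow> cmod (S 1 j t) \<le> M"
    using continuous_family_bounded[of "S 1"] Sc by blast
  have step: "cmod (S (Suc n) k t - S n k t) \<le> M / 2 ^ n * w t" if "k < m" "t \<in> {a..b}" for n k t
    using that
  proof (induction n arbitrary: k t)
    case 0
    then show ?case using M(2)[OF 0] mult_left_mono[OF w(2)[OF 0(2)] M(1)] by (simp add: S0)
  next
    case (Suc n)
    have "cmod (V k (\<lambda>j x. S (Suc n) j x - S n j x) t) \<le> M / 2 ^ n * w t / 2"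
      using Suc M(1) by (intro w(3) continuous_intros Sc) auto
    moreover have "S (Suc (Suc n)) k t - S (Suc n) k t = V k (\<lambda>j x. S (Suc n) j x - S n j x) t"
      using \<Phi>_diff[of "S (Suc n)" "S n" k t, OF Sc Sc Suc.prems] by (simp only: SS)
    ultimately show ?case by simp
  qed
  obtain W where W: "0 \<le> W" "\<And>t. t \<in> {a..b} \<Longrightarrow> w t \<le> W"
  proof -
    have "bounded (w ` {a..b})" by (intro compact_imp_bounded compact_continuous_image w(1)) simp
    then obtain B where B: "\<forall>t\<in>{a..b}. norm (w t) \<le> B" unfolding bounded_iff by auto
    then show ?thesis using that[of "max 0 B"] by fastforce
  qed
  \<comment> \<open>The limit is defined by the series of increments; starting the iteration from 0
    makes its partial sums equal to \<open>S n\<close>.\<close>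
  define Z where "Z k t = (\<Sum>n. S (Suc n) k t - S n k t)" for k t
  have Z: "uniform_limit {a..b} (\<lambda>n. S n k) (Z k) sequentially" if k: "k < m" for k
  proof -
    have "uniform_limit {a..b} (\<lambda>n t. \<Sum>i<n. S (Suc i) k t - S i k t) (Z k) sequentially"
      unfolding Z_def[abs_def]
    proof (rule Weierstrass_m_test)
      show "norm (S (Suc n) k t - S n k t) \<le> M * W * (1 / 2) ^ n" if "t \<in> {a..b}" for n t
      proof -
        have "norm (S (Suc n) k t - S n k t) \<le> M / 2 ^ n * w t" by (rule step[OF k that])
        also have "\<dots> \<le> M / 2 ^ n * W" using W(2)[OF that] M(1) by (intro mult_left_mono) auto
        finally show ?thesis by (simp add: power_divide algebra_simps)
      qed
      show "summable (\<lambda>n. M * W * (1 / 2) ^ n)" by (intro summable_mult summable_geometric) simp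
    qed
    moreover have "(\<Sum>i<n. S (Suc i) k t - S i k t) = S n k t" for n t
      using sum_lessThan_telescope[of "\<lambda>i. S i k t" n] by (simp add: S0)
    ultimately show ?thesis by simp
  qed
  have Zc: "continuous_on {a..b} (Z k)" if "k < m" for k
    by (rule uniform_limit_theorem[OF _ Z[OF that]]) (simp_all add: Sc[OF that])
  have "Z k t = \<Phi> Z k t" if k: "k < m" and t: "t \<in> {a..b}" for k t
  proof -
    have "(\<lambda>n. S (Suc n) k t) \<longlonglongrightarrow> \<Phi> Z k t"
    proof (rule LIMSEQ_I)
      fix r :: real assume r: "r > 0"
      \<comment> \<open>Closeness e of the iterates yields an error \<open>e * w t / 2\<close>;
        dividing r by \<open>w t\<close> makes this \<open>r / 2\<close> at the point t
        considered.\<close>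
      define e where "e = r / w t"
      have wt: "w t \<ge> 1" by (rule w(2)[OF t])
      have e: "e > 0" using r wt by (simp add: e_def)
      have "\<forall>\<^sub>F n in sequentially. \<forall>j\<in>{..<m}. \<forall>x\<in>{a..b}. dist (S n j x) (Z j x) < e"
        using Z e by (intro eventually_ball_finite) (auto simp: uniform_limit_iff)
      then obtain n0 where n0: "\<And>n j x. n \<ge> n0 \<Longrightarrow> j < m \<Longrightarrow> x \<in> {a..b} \<Longrightarrow> dist (S n j x) (Z j x) < e"
        unfolding eventually_sequentially by blast
      have "norm (S (Suc n) k t - \<Phi> Z k t) < r" if n: "n \<ge> n0" for n
      proof -
        have "cmod (V k (\<lambda>j x. S n j x - Z j x) t) \<le> e * w t / 2"
        proof (rule w(3))
          show "cmod (S n j x - Z j x) \<le> e * w x" if "j < m" "x \<in> {a..b}" for j x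
            using n0[OF n that, unfolded dist_norm] mult_left_mono[OF w(2)[OF that(2)], of e] e by linarith
        qed (use e k t in \<open>auto intro!: continuous_intros Sc Zc\<close>)
        also have "\<dots> = r / 2" using wt by (simp add: e_def)
        also have "\<dots> < r" using r by simp
        finally show ?thesis
          unfolding SS using \<Phi>_diff[of "S n" Z k t, OF Sc Zc k t] by simp
      qed
      then show "\<exists>no. \<forall>n\<ge>no. norm (S (Suc n) k t - \<Phi> Z k t) < r" by blast
    qed
    moreover have "(\<lambda>n. S (Suc n) k t) \<longlonglongrightarrow> Z k t"
      using tendsto_uniform_limitI[OF Z[OF k] t] by (rule LIMSEQ_Suc)
    ultimately show ?thesis by (rule LIMSEQ_unique[OF _, rotated])
  qed
  then have eq: "Z k t = c k + integral {a..t} (F k) + V k Z t" if "k < m" "t \<in> {a..b}" for k t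
    using that unfolding \<Phi>_def by blast
  show ?thesis
    using solvesI[where Z = Z and F = F and c = c, OF Zc F eq] by blast
qed

lemma L1norm_nonneg: "L1 F \<Longrightarrow> 0 \<le> L1norm F"
  unfolding L1norm_def L1_def
  by (intro sum_nonneg Henstock_Kurzweil_Integration.integral_nonneg
      set_lebesgue_integral_eq_integral(1) set_integrable_norm) auto

lemma norm_integral_le_L1norm:
  assumes F: "L1 F" and k: "k < m" and t: "t \<in> {a..b}"
  shows "cmod (integral {a..t} (F k)) \<le> L1norm F"
proof -
  have Fk: "F k absolutely_integrable_on {a..b}" using F k by (simp add: L1_def)
  have nF: "(\<lambda>x. cmod (F j x)) integrable_on {a..b}" if "j < m" for j
    using F that unfolding L1_def by (intro set_lebesgue_integral_eq_integral(1) set_integrable_norm) auto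
  have nFt: "(\<lambda>x. cmod (F k x)) integrable_on {a..t}"
    using nF[OF k] t by (auto intro: integrable_on_subinterval)
  have "cmod (integral {a..t} (F k)) \<le> integral {a..t} (\<lambda>x. cmod (F k x))"
    by (intro Henstock_Kurzweil_Integration.integral_norm_bound_integral integral_subinterval(2)[OF Fk t] nFt) auto
  also have "\<dots> \<le> integral {a..b} (\<lambda>x. cmod (F k x))"
    using t by (intro integral_subset_le nFt nF k) auto
  also have "\<dots> \<le> L1norm F"
    unfolding L1norm_def using k
    by (intro member_le_sum[where f = "\<lambda>k. integral {a..b} (\<lambda>x. cmod (F k x))"])
      (auto intro!: Henstock_Kurzweil_Integration.integral_nonneg nF)
  finally show ?thesis .
qed

text \<open>A Gronwall bound obtained by absorption: in the weighted norm the Volterra term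
  contributes at most half of the norm of Z. The constant \<open>2 * W\<close> combines this factor
  2 with an upper bound W of the weight.\<close>

theorem solves_bound:
  obtains C where "0 \<le> C" "\<And>F Z k t. solves F Z \<Longrightarrow> L1 F \<Longrightarrow> k < m \<Longrightarrow> t \<in> {a..b} \<Longrightarrow>
    cmod (Z k t) \<le> C * ((\<Sum>k<m. cmod (Z k a)) + L1norm F)"
proof -
  obtain w :: "real \<Rightarrow> real" where w: "continuous_on {a..b} w" "\<And>t. t \<in> {a..b} \<Longrightarrow> 1 \<le> w t"
    "\<And>Z M k t. (\<And>j t. j < m \<Longrightarrow> t \<in> {a..b} \<Longrightarrow> cmod (Z j t) \<le> M * w t) \<Longrightarrow>
      (\<And>j. j < m \<Longrightarrow> continuous_on {a..b} (Z j)) \<Longrightarrow> 0 \<le> M \<Longrightarrow> k < m \<Longrightarrow> t \<in> {a..b} \<Longrightarrow>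
      cmod (V k Z t) \<le> M * w t / 2"
    using weighted_contraction by blast
  obtain W where W: "0 \<le> W" "\<And>t. t \<in> {a..b} \<Longrightarrow> w t \<le> W"
  proof -
    have "bounded (w ` {a..b})" by (intro compact_imp_bounded compact_continuous_image w(1)) simp
    then obtain B where B: "\<forall>t\<in>{a..b}. norm (w t) \<le> B" unfolding bounded_iff by auto
    then show ?thesis using that[of "max 0 B"] by fastforce
  qed
  show ?thesis
  proof (rule that[of "2 * W"])
    fix F Z k t assume Z: "solves F Z" and F: "L1 F" and k: "k < m" and t: "t \<in> {a..b}"
    define P where "P = (\<Sum>k<m. cmod (Z k a)) + L1norm F"
    have P: "0 \<le> P" using L1norm_nonneg[OF F] by (simp add: P_def sum_nonneg)
    define f where "f = (\<lambda>(j, x). cmod (Z j x) / w x)"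
    define I where "I = {..<m} \<times> {a..b}"
    have fM: "f y \<le> M \<longleftrightarrow> cmod (Z (fst y) (snd y)) \<le> M * w (snd y)" if "y \<in> I" for y M
      using w(2)[of "snd y"] that by (auto simp: f_def I_def split_beta field_simps)
    obtain M0 where M0: "0 \<le> M0" "\<And>j t. j < m \<Longrightarrow> t \<in> {a..b} \<Longrightarrow> cmod (Z j t) \<le> M0"
      using continuous_family_bounded[of Z] solves_continuous[OF Z] by blast
    have "f (k, t) \<le> 2 * P"
    proof (rule bound_by_halving[where S = I])
      have "f y \<le> M0" if "y \<in> I" for y
      proof -
        have "cmod (Z (fst y) (snd y)) \<le> M0" "1 \<le> w (snd y)"
          using that M0(2) w(2) by (auto simp: I_def)
        then show ?thesis unfolding fM[OF that] using mult_left_mono[of 1 "w (snd y)" M0] M0(1) by simp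
      qed
      then show "bdd_above (f ` I)" by (intro bdd_aboveI2[where M = M0])
      show "0 \<le> f y" if "y \<in> I" for y
        using w(2)[of "snd y"] that by (auto simp: f_def I_def split_beta)
      show "(k, t) \<in> I" using k t by (simp add: I_def)
      fix M y assume M: "0 \<le> M" "\<And>y. y \<in> I \<Longrightarrow> f y \<le> M" and y: "y \<in> I"
      obtain j x where jx: "y = (j, x)" "j < m" "x \<in> {a..b}" using y by (auto simp: I_def)
      have "cmod (V j Z x) \<le> M * w x / 2"
      proof (rule w(3))
        show "cmod (Z i s) \<le> M * w s" if "i < m" "s \<in> {a..b}" for i s
          using M(2)[of "(i, s)"] fM[of "(i, s)" M] that by (simp add: I_def)
      qed (use jx M solves_continuous[OF Z] in auto)
      moreover have "cmod (Z j a) + cmod (integral {a..x} (F j)) \<le> P"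
        unfolding P_def using norm_integral_le_L1norm[OF F jx(2,3)] jx(2)
        by (intro add_mono member_le_sum[where f = "\<lambda>k. cmod (Z k a)"]) auto
      moreover have "cmod (Z j x) \<le> cmod (Z j a) + cmod (integral {a..x} (F j)) + cmod (V j Z x)"
        unfolding solves_integral_eq[OF Z F jx(2,3)]
        by (meson norm_triangle_ineq order_trans add_right_mono)
      moreover have "P \<le> P * w x" using mult_left_mono[OF w(2)[OF jx(3)] P] by simp
      ultimately have "cmod (Z j x) \<le> (P + M / 2) * w x" by (simp add: algebra_simps)
      then show "f y \<le> P + M / 2" using fM[OF y] jx(1) by simp
    qed
    then have "cmod (Z k t) \<le> 2 * P * w t" using fM[of "(k, t)" "2 * P"] k t by (simp add: I_def)
    also have "\<dots> \<le> 2 * P * W" using W(2)[OF t] P by (intro mult_left_mono) auto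
    finally show "cmod (Z k t) \<le> 2 * W * ((\<Sum>k<m. cmod (Z k a)) + L1norm F)"
      by (simp add: P_def algebra_simps)
  qed (use W in simp)
qed

end

text \<open>A trivial kernel means a nonzero determinant. Only a right inverse is asserted; for
  boundary value problems the left inverse is recovered from uniqueness of the solution.\<close>

lemma injective_square_system_inverse:
  fixes G :: "nat \<Rightarrow> nat \<Rightarrow> 'a::field"
  assumes inj: "\<And>z. (\<forall>i<n. (\<Sum>j<n. G i j * z j) = 0) \<Longrightarrow> \<forall>j<n. z j = 0"
  obtains B where "\<And>h i. i < n \<Longrightarrow> (\<Sum>j<n. G i j * (\<Sum>l<n. B j l * h l)) = h i"
proof -
  define M where "M = Matrix.mat n n (\<lambda>(i, j). G i j)"
  have M: "M \<in> carrier_mat n n" by (simp add: M_def)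
  have "det M \<noteq> 0"
  proof
    assume "det M = 0"
    then obtain v where v: "v \<in> carrier_vec n" "v \<noteq> 0\<^sub>v n" "M *\<^sub>v v = 0\<^sub>v n"
      using det_0_iff_vec_prod_zero_field[OF M] by blast
    have "(\<Sum>j<n. G i j * Matrix.vec_index v j) = 0" if "i < n" for i
    proof -
      have "Matrix.vec_index (M *\<^sub>v v) i = 0" using v(3) that by simp
      then show ?thesis
        using that v(1) by (simp add: M_def scalar_prod_def atLeast0LessThan)
    qed
    then have "Matrix.vec_index v j = 0" if "j < n" for j
      using inj[of "Matrix.vec_index v"] that by blast
    then have "v = 0\<^sub>v n" using v(1) by (intro eq_vecI) auto
    then show False using v(2) by contradiction
  qed
  then have "M \<in> Units (ring_mat TYPE('a) n ())" by (rule det_non_zero_imp_unit[OF M])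
  then obtain N where N: "N \<in> carrier_mat n n" "M * N = 1\<^sub>m n"
    unfolding Units_def ring_mat_def by auto
  define B where "B j l = N $$ (j, l)" for j l
  have GB: "(\<Sum>j<n. G i j * B j l) = (if i = l then 1 else 0)" if "i < n" "l < n" for i l
  proof -
    have "(M * N) $$ (i, l) = (if i = l then 1 else 0)" using N(2) that by simp
    then show ?thesis
      using that N(1) M by (simp add: M_def B_def scalar_prod_def atLeast0LessThan)
  qed
  show ?thesis
  proof (rule that)
    fix h i assume i: "i < n"
    have "(\<Sum>j<n. G i j * (\<Sum>l<n. B j l * h l)) = (\<Sum>j<n. \<Sum>l<n. G i j * B j l * h l)"
      by (simp add: sum_distrib_left mult.assoc)
    also have "\<dots> = (\<Sum>l<n. (\<Sum>j<n. G i j * B j l) * h l)"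
      by (subst sum.swap) (simp add: sum_distrib_right)
    also have "\<dots> = (\<Sum>l<n. if i = l then h l else 0)"
      by (intro sum.cong) (auto simp: GB i)
    also have "\<dots> = h i" using i by simp
    finally show "(\<Sum>j<n. G i j * (\<Sum>l<n. B j l * h l)) = h i" .
  qed
qed

section \<open>Boundary forms and the Fredholm alternative\<close>

definition bc :: "nat \<Rightarrow> real \<Rightarrow> real \<Rightarrow> (nat \<Rightarrow> nat \<Rightarrow> complex) \<Rightarrow> (nat \<Rightarrow> nat \<Rightarrow> complex)
    \<Rightarrow> (nat \<Rightarrow> real \<Rightarrow> complex) \<Rightarrow> nat \<Rightarrow> complex" where
  "bc m a b \<alpha> \<beta> Z i = (\<Sum>k<m. \<alpha> i k * Z k a) + (\<Sum>k<m. \<beta> i k * Z k b)"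

lemma bc_add_scaled:
  "bc m a b \<alpha> \<beta> (\<lambda>k t. Z k t + c * Z' k t) i = bc m a b \<alpha> \<beta> Z i + c * bc m a b \<alpha> \<beta> Z' i"
  by (simp add: bc_def algebra_simps sum.distrib sum_distrib_left)

lemma bc_add_sum:
  "bc m a b \<alpha> \<beta> (\<lambda>k t. Z k t + (\<Sum>j<(n::nat). z j * Z' j k t)) i
    = bc m a b \<alpha> \<beta> Z i + (\<Sum>j<n. z j * bc m a b \<alpha> \<beta> (Z' j) i)"
proof (induction n)
  case (Suc n)
  have "(\<lambda>k t. Z k t + (\<Sum>j<Suc n. z j * Z' j k t))
      = (\<lambda>k t. (Z k t + (\<Sum>j<n. z j * Z' j k t)) + z n * Z' n k t)"
    by (simp add: add.assoc)
  then show ?case using Suc.IH by (simp only: bc_add_scaled) simp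
qed simp

lemma bc_diff_bound:
  assumes "\<And>k. k < m \<Longrightarrow> cmod (Z k a) \<le> M" "\<And>k. k < m \<Longrightarrow> cmod (Z k b) \<le> M"
  shows "cmod (bc m a b \<alpha> \<beta> Z i - bc m a b \<alpha>' \<beta>' Z i)
    \<le> (\<Sum>k<m. cmod (\<alpha> i k - \<alpha>' i k) + cmod (\<beta> i k - \<beta>' i k)) * M"
proof -
  have "bc m a b \<alpha> \<beta> Z i - bc m a b \<alpha>' \<beta>' Z i
      = (\<Sum>k<m. (\<alpha> i k - \<alpha>' i k) * Z k a + (\<beta> i k - \<beta>' i k) * Z k b)"
    by (simp add: bc_def sum.distrib left_diff_distrib sum_subtractf)
  also have "cmod \<dots> \<le> (\<Sum>k<m. (cmod (\<alpha> i k - \<alpha>' i k) + cmod (\<beta> i k - \<beta>' i k)) * M)"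
  proof (rule sum_norm_le)
    fix k assume "k \<in> {..<m}"
    then have k: "k < m" by simp
    have "cmod ((\<alpha> i k - \<alpha>' i k) * Z k a + (\<beta> i k - \<beta>' i k) * Z k b)
        \<le> cmod (\<alpha> i k - \<alpha>' i k) * cmod (Z k a) + cmod (\<beta> i k - \<beta>' i k) * cmod (Z k b)"
      by (metis norm_mult norm_triangle_ineq)
    also have "\<dots> \<le> cmod (\<alpha> i k - \<alpha>' i k) * M + cmod (\<beta> i k - \<beta>' i k) * M"
      by (intro add_mono mult_left_mono assms k) auto
    finally show "cmod ((\<alpha> i k - \<alpha>' i k) * Z k a + (\<beta> i k - \<beta>' i k) * Z k b)
        \<le> (cmod (\<alpha> i k - \<alpha>' i k) + cmod (\<beta> i k - \<beta>' i k)) * M" by (simp add: algebra_simps)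
  qed
  finally show ?thesis by (simp add: sum_distrib_right)
qed

lemma bc_zero_coeff: "bc m a b (\<lambda>_ _. 0) (\<lambda>_ _. 0) Z i = 0"
  by (simp add: bc_def)

lemma bc_bound:
  assumes "\<And>k. k < m \<Longrightarrow> cmod (Z k a) \<le> M" "\<And>k. k < m \<Longrightarrow> cmod (Z k b) \<le> M"
  shows "cmod (bc m a b \<alpha> \<beta> Z i) \<le> (\<Sum>k<m. cmod (\<alpha> i k) + cmod (\<beta> i k)) * M"
  using bc_diff_bound[of m Z a M b \<alpha> \<beta> i "\<lambda>_ _. 0" "\<lambda>_ _. 0", OF assms]
  by (simp add: bc_zero_coeff)

context linear_system
begin

lemma solves_add_scaled:
  assumes "solves F Z" "solves F' Z'"
  shows "solves (\<lambda>k x. F k x + c * F' k x) (\<lambda>k t. Z k t + c * Z' k t)"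
  unfolding solves_def
proof (intro allI impI conjI)
  fix k assume k: "k < m"
  show "abs_cont_on a b (\<lambda>t. Z k t + c * Z' k t)"
    using assms k unfolding solves_def
    by (intro abs_cont_on_add abs_cont_on_mult abs_cont_on_const) auto
  have "AE x in lebesgue_on {a..b}.
      (Z k has_vector_derivative (\<Sum>j<m. A k j x * Z j x) + F k x) (at x within {a..b})"
    "AE x in lebesgue_on {a..b}.
      (Z' k has_vector_derivative (\<Sum>j<m. A k j x * Z' j x) + F' k x) (at x within {a..b})"
    using assms k unfolding solves_def by blast+
  then show "AE x in lebesgue_on {a..b}. ((\<lambda>t. Z k t + c * Z' k t) has_vector_derivative
      (\<Sum>j<m. A k j x * (Z j x + c * Z' j x)) + (F k x + c * F' k x)) (at x within {a..b})"
  proof eventually_elim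
    case (elim x)
    have eq: "(\<Sum>j<m. A k j x * (Z j x + c * Z' j x)) + (F k x + c * F' k x)
      = ((\<Sum>j<m. A k j x * Z j x) + F k x) + c * ((\<Sum>j<m. A k j x * Z' j x) + F' k x)"
      by (simp add: algebra_simps sum.distrib sum_distrib_left)
    then show ?case
      using has_vector_derivative_add[OF elim(1) has_vector_derivative_mult_right[OF elim(2), of c]]
      by (simp only: eq)
  qed
qed

lemma solves_add_sum:
  assumes "solves F Z" "\<And>j. j < n \<Longrightarrow> solves (\<lambda>_ _. 0) (Z' j)"
  shows "solves F (\<lambda>k t. Z k t + (\<Sum>j<(n::nat). z j * Z' j k t))"
  using assms(2)
proof (induction n)
  case 0
  then show ?case using assms(1) by simp
next
  case (Suc n)
  from solves_add_scaled[OF Suc.IH Suc.prems, of n "z n"] Suc.prems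
  show ?case by (simp add: add.assoc)
qed

lemma solves_diff:
  assumes "solves F Z" "solves F' Z'"
  shows "solves (\<lambda>k x. F k x - F' k x) (\<lambda>k t. Z k t - Z' k t)"
  using solves_add_scaled[OF assms, of "-1"] by simp

lemma solves_zero: "solves (\<lambda>_ _. 0) (\<lambda>_ _. 0)"
  by (simp add: solves_def abs_cont_on_const)

lemma L1_zero: "L1 (\<lambda>_ _. 0)" and L1norm_zero: "L1norm (\<lambda>_ _. 0) = 0"
  by (auto simp: L1_def L1norm_def)

lemma L1_diff: "L1 F \<Longrightarrow> L1 F' \<Longrightarrow> L1 (\<lambda>k x. F k x - F' k x)"
  by (simp add: L1_def)

text \<open>Fredholm alternative in finite dimension. The solutions \<open>P j\<close> with unit
  initial data turn the boundary conditions into a square linear system for the initial values,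
  whose matrix is injective because the homogeneous problem has only the zero solution. Inverting it
  gives existence; the bound follows by estimating the initial values of Z through the inverse
  B.\<close>

theorem boundary_value_problem:
  assumes trivial: "\<And>Z. solves (\<lambda>_ _. 0) Z \<Longrightarrow> (\<forall>i<m. bc m a b \<alpha> \<beta> Z i = 0) \<Longrightarrow>
      (\<forall>k<m. \<forall>t\<in>{a..b}. Z k t = 0)"
  shows "\<And>F. L1 F \<Longrightarrow> \<exists>Z. solves F Z \<and> (\<forall>i<m. bc m a b \<alpha> \<beta> Z i = 0)"
    and "\<exists>C\<ge>0. \<forall>F Z. L1 F \<longrightarrow> solves F Z \<longrightarrow> (\<forall>k<m. \<forall>t\<in>{a..b}.
      cmod (Z k t) \<le> C * (L1norm F + (\<Sum>i<m. cmod (bc m a b \<alpha> \<beta> Z i))))"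
proof -
  let ?bc = "bc m a b \<alpha> \<beta>"
  obtain C where C: "0 \<le> C" "\<And>F Z k t. solves F Z \<Longrightarrow> L1 F \<Longrightarrow> k < m \<Longrightarrow> t \<in> {a..b} \<Longrightarrow>
    cmod (Z k t) \<le> C * ((\<Sum>k<m. cmod (Z k a)) + L1norm F)"
    using solves_bound by blast
  have "\<exists>Z. solves (\<lambda>_ _. 0) Z \<and> (\<forall>k<m. Z k a = (if k = j then 1 else 0))" for j
    by (rule initial_value_problem[OF L1_zero])
  then obtain P where P: "\<And>j. solves (\<lambda>_ _. 0) (P j)"
    "\<And>j k. k < m \<Longrightarrow> P j k a = (if k = j then 1 else 0)" by metis
  have comb_init: "(\<Sum>j<m. z j * P j k a) = z k" if "k < m" for z k
    using that by (simp add: P(2) if_distrib cong: if_cong)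
  obtain B where B: "\<And>h i. i < m \<Longrightarrow> (\<Sum>j<m. ?bc (P j) i * (\<Sum>l<m. B j l * h l)) = h i"
  proof (rule injective_square_system_inverse[of m "\<lambda>i j. ?bc (P j) i"])
    fix z assume z: "\<forall>i<m. (\<Sum>j<m. ?bc (P j) i * z j) = 0"
    \<comment> \<open>The summand 0 gives the combination the shape of \<open>solves_add_sum\<close>
      and \<open>bc_add_sum\<close>, with the zero solution as base.\<close>
    define Z where "Z k t = 0 + (\<Sum>j<m. z j * P j k t)" for k t
    have "solves (\<lambda>_ _. 0) Z"
      unfolding Z_def by (rule solves_add_sum[OF solves_zero P(1)])
    moreover have "\<forall>i<m. ?bc Z i = 0"
      unfolding Z_def bc_add_sum using z by (simp add: bc_def mult.commute)
    ultimately have "\<forall>k<m. \<forall>t\<in>{a..b}. Z k t = 0" by (rule trivial)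
    then show "\<forall>j<m. z j = 0" using comb_init[of _ z] ab by (simp add: Z_def)
  qed blast
  \<comment> \<open>B is only a right inverse so far; triviality of the kernel, applied to the
    combination with coefficients z - B h, shows that it is a left inverse too.\<close>
  have B_inv: "z j = (\<Sum>l<m. B j l * h l)"
    if z: "\<And>i. i < m \<Longrightarrow> (\<Sum>j<m. ?bc (P j) i * z j) = h i" and j: "j < m" for z h j
  proof -
    define y where "y j = z j - (\<Sum>l<m. B j l * h l)" for j
    define Z where "Z k t = 0 + (\<Sum>j<m. y j * P j k t)" for k t
    have "solves (\<lambda>_ _. 0) Z"
      unfolding Z_def by (rule solves_add_sum[OF solves_zero P(1)])
    moreover have "?bc Z i = 0" if i: "i < m" for i
    proof -
      have "?bc Z i = (\<Sum>j<m. ?bc (P j) i * z j) - (\<Sum>j<m. ?bc (P j) i * (\<Sum>l<m. B j l * h l))"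
        unfolding Z_def bc_add_sum by (simp add: bc_def y_def algebra_simps sum_subtractf)
      then show ?thesis using z[OF i] B[OF i, of h] by simp
    qed
    ultimately have "\<forall>k<m. \<forall>t\<in>{a..b}. Z k t = 0" by (intro trivial) auto
    then have "y j = 0" using comb_init[OF j, of y] j ab by (simp add: Z_def)
    then show ?thesis by (simp add: y_def)
  qed
  have zero_init: "\<exists>Z. solves F Z \<and> (\<forall>k<m. Z k a = 0)" if "L1 F" for F
    using initial_value_problem[OF that, of "\<lambda>_. 0"] .
  show "\<exists>Z. solves F Z \<and> (\<forall>i<m. ?bc Z i = 0)" if F: "L1 F" for F
  proof -
    obtain Y where Y: "solves F Y" using zero_init[OF F] by blast
    define z where "z j = (\<Sum>l<m. B j l * (- ?bc Y l))" for j
    define Z where "Z k t = Y k t + (\<Sum>j<m. z j * P j k t)" for k t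
    have "solves F Z" unfolding Z_def by (rule solves_add_sum[OF Y P(1)])
    moreover have "?bc Z i = 0" if i: "i < m" for i
      unfolding Z_def bc_add_sum using B[OF i, of "\<lambda>l. - ?bc Y l"]
      by (simp add: z_def mult.commute)
    ultimately show ?thesis by blast
  qed
  define U where "U = (\<Sum>i<m. \<Sum>k<m. cmod (\<alpha> i k) + cmod (\<beta> i k))"
  define Bn where "Bn = (\<Sum>j<m. \<Sum>l<m. cmod (B j l))"
  have UB: "0 \<le> U" "0 \<le> Bn" by (simp_all add: U_def Bn_def sum_nonneg)
  \<comment> \<open>The estimate below ends in
    \<open>C * (Bn * (H + U * (C * L1norm F)) + L1norm F)\<close>, H being the boundary defect of Z;
    K bounds both the coefficient of H and that of \<open>L1norm F\<close>.\<close>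
  define K where "K = C * (Bn + Bn * U * C + 1)"
  have "cmod (Z k t) \<le> K * (L1norm F + (\<Sum>i<m. cmod (?bc Z i)))"
    if F: "L1 F" and Z: "solves F Z" and k: "k < m" and t: "t \<in> {a..b}" for F Z k t
  proof -
    define H where "H = (\<Sum>i<m. cmod (?bc Z i))"
    have H: "0 \<le> H" by (simp add: H_def sum_nonneg)
    have F0: "0 \<le> L1norm F" by (rule L1norm_nonneg[OF F])
    obtain Y where Y: "solves F Y" "\<And>k. k < m \<Longrightarrow> Y k a = 0" using zero_init[OF F] by blast
    \<comment> \<open>X has the source and the initial values of Z, hence equals Z; this exposes the
      boundary defect of Z as an affine function of its initial values, which B inverts.\<close>
    define X where "X k t = Y k t + (\<Sum>j<m. Z j a * P j k t)" for k t
    have X: "solves F X" unfolding X_def by (rule solves_add_sum[OF Y(1) P(1)])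
    have "cmod (Z k t - X k t) \<le> C * ((\<Sum>k<m. cmod (Z k a - X k a)) + L1norm (\<lambda>k x. F k x - F k x))"
      if "k < m" "t \<in> {a..b}" for k t
      by (rule C(2)[OF solves_diff[OF Z X] L1_diff[OF F F] that])
    moreover have "X k a = Z k a" if "k < m" for k
      using that comb_init[OF that] Y(2) by (simp add: X_def)
    ultimately have ZX: "Z k t = X k t" if "k < m" "t \<in> {a..b}" for k t
      using that by (simp add: L1norm_zero)
    have "?bc Z i = ?bc X i" for i
      unfolding bc_def using ZX ab by (intro arg_cong2[of _ _ _ _ "(+)"] sum.cong) auto
    then have "(\<Sum>j<m. ?bc (P j) i * Z j a) = ?bc Z i - ?bc Y i" for i
      unfolding X_def bc_add_sum by (simp add: mult.commute)
    then have Za: "Z j a = (\<Sum>l<m. B j l * (?bc Z l - ?bc Y l))" if "j < m" for j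
      using B_inv[of "\<lambda>j. Z j a" "\<lambda>l. ?bc Z l - ?bc Y l"] that by blast
    have Yb: "cmod (Y k t) \<le> C * L1norm F" if "k < m" "t \<in> {a..b}" for k t
      using C(2)[OF Y(1) F that] Y(2) by simp
    have h: "cmod (?bc Z l - ?bc Y l) \<le> H + U * (C * L1norm F)" if "l < m" for l
    proof -
      have "cmod (?bc Z l) \<le> H" unfolding H_def using that by (intro member_le_sum) auto
      moreover have "cmod (?bc Y l) \<le> (\<Sum>k<m. cmod (\<alpha> l k) + cmod (\<beta> l k)) * (C * L1norm F)"
        using Yb ab by (intro bc_bound) auto
      moreover have "\<dots> \<le> U * (C * L1norm F)"
        unfolding U_def using that C(1) F0
        by (intro mult_right_mono member_le_sum[where f = "\<lambda>i. \<Sum>k<m. cmod (\<alpha> i k) + cmod (\<beta> i k)"])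
          (auto simp: sum_nonneg)
      ultimately show ?thesis using norm_triangle_ineq4[of "?bc Z l" "?bc Y l"] by linarith
    qed
    have "(\<Sum>j<m. cmod (Z j a)) \<le> (\<Sum>j<m. \<Sum>l<m. cmod (B j l) * (H + U * (C * L1norm F)))"
    proof (rule sum_mono)
      fix j assume "j \<in> {..<m}"
      then have "cmod (Z j a) = cmod (\<Sum>l<m. B j l * (?bc Z l - ?bc Y l))" using Za by simp
      also have "\<dots> \<le> (\<Sum>l<m. cmod (B j l) * (H + U * (C * L1norm F)))"
        by (rule sum_norm_le) (auto simp: norm_mult intro!: mult_left_mono h)
      finally show "cmod (Z j a) \<le> (\<Sum>l<m. cmod (B j l) * (H + U * (C * L1norm F)))" .
    qed
    also have "\<dots> = Bn * (H + U * (C * L1norm F))" by (simp add: Bn_def sum_distrib_right)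
    finally have "C * ((\<Sum>j<m. cmod (Z j a)) + L1norm F) \<le> C * (Bn * (H + U * (C * L1norm F)) + L1norm F)"
      using C(1) by (intro mult_left_mono) auto
    with C(2)[OF Z F k t] have "cmod (Z k t) \<le> C * (Bn * (H + U * (C * L1norm F)) + L1norm F)"
      by linarith
    also have "\<dots> \<le> K * (L1norm F + H)"
      unfolding K_def using UB C(1) F0 H by (simp add: algebra_simps mult_nonneg_nonneg)
    finally show ?thesis by (simp add: H_def)
  qed
  moreover have "0 \<le> K" using UB C(1) by (simp add: K_def)
  ultimately show "\<exists>C\<ge>0. \<forall>F Z. L1 F \<longrightarrow> solves F Z \<longrightarrow> (\<forall>k<m. \<forall>t\<in>{a..b}.
      cmod (Z k t) \<le> C * (L1norm F + (\<Sum>i<m. cmod (?bc Z i))))" by blast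
qed

end

section \<open>The quasi-derivative system and its regular perturbation\<close>

text \<open>The system for the vector of quasi-derivatives, in which \<open>D^[m]\<close> is eliminated through
  \<open>D^[m] = i^(-m) (g + \<mu> y)\<close>; \<open>src\<close> collects the contribution of \<open>g\<close>.\<close>

definition qsys :: "nat \<Rightarrow> (real \<Rightarrow> complex) \<Rightarrow> complex \<Rightarrow> nat \<Rightarrow> nat \<Rightarrow> real \<Rightarrow> complex" where
  "qsys m q \<mu> k j x = (if Suc k < m \<and> j = Suc k then 1 else 0)
     + (if k = m - 2 \<and> j = 0 then - (inverse (\<i> ^ m) * q x) else 0)
     + (if k = m - 1 \<and> j = 1 then inverse (\<i> ^ m) * q x else 0)
     + (if k = m - 1 \<and> j = 0 then inverse (\<i> ^ m) * \<mu> else 0)"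

definition src :: "nat \<Rightarrow> (real \<Rightarrow> complex) \<Rightarrow> nat \<Rightarrow> real \<Rightarrow> complex" where
  "src m g k x = (if k = m - 1 then inverse (\<i> ^ m) * g x else 0)"

abbreviation qsolves where
  "qsolves m a b q \<mu> g \<equiv> linear_system.solves m a b (qsys m q \<mu>) (src m g)"

lemma qsys_row:
  assumes "3 \<le> m" "k < m"
  shows "(\<Sum>j<m. qsys m q \<mu> k j x * Y j) = (if Suc k < m then Y (Suc k) else 0)
     + (if k = m - 2 then - (inverse (\<i> ^ m) * q x * Y 0) else 0)
     + (if k = m - 1 then inverse (\<i> ^ m) * q x * Y 1 + inverse (\<i> ^ m) * \<mu> * Y 0 else 0)"
proof -
  have delta: "(\<Sum>j<m. (if P \<and> j = i then c else 0) * Y j) = (if P then c * Y i else 0)"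
    if "i < m" for P i c
    using that by (cases P) (simp_all add: if_distrib[of "\<lambda>u. u * _"] cong: if_cong)
  have delta': "(\<Sum>j<m. (if Suc k < m \<and> j = Suc k then 1 else 0) * Y j) = (if Suc k < m then Y (Suc k) else 0)"
    by (cases "Suc k < m") (simp_all add: if_distrib[of "\<lambda>u. u * _"] cong: if_cong)
  show ?thesis
    unfolding qsys_def distrib_right sum.distrib delta'
    using assms by (simp add: delta)
qed

lemma qsys_linear_system:
  assumes "a < b" "q absolutely_integrable_on {a..b}"
  shows "linear_system m a b (qsys m q \<mu>)"
proof
  have const: "(\<lambda>x. c) absolutely_integrable_on {a..b}" for c :: complex
    by (intro absolutely_integrable_continuous_real continuous_intros)
  have cond: "(\<lambda>x. if P then f x else 0) absolutely_integrable_on {a..b}"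
    if "f absolutely_integrable_on {a..b}" for P and f :: "real \<Rightarrow> complex"
    using that const[of 0] by (cases P) simp_all
  have wq: "(\<lambda>x. inverse (\<i> ^ m) * q x) absolutely_integrable_on {a..b}"
    using assms(2) by (intro set_integrable_mult_right) simp
  have wq': "(\<lambda>x. - (inverse (\<i> ^ m) * q x)) absolutely_integrable_on {a..b}"
    using set_integrable_mult_right[OF wq, of "- 1"] by simp
  show "qsys m q \<mu> k j absolutely_integrable_on {a..b}" for k j
    unfolding qsys_def[abs_def] by (intro set_integral_add(1) cond const wq wq')
qed (rule assms)

lemma norm_inverse_i_power [simp]: "cmod (inverse (\<i> ^ m)) = 1"
  by (simp add: norm_inverse norm_power)

text \<open>Multiplication of \<open>Y\<close> by the exponential of \<open>\<integral>(q - p)\<close> times a constant nilpotent matrix turns the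
  system for \<open>q\<close> into the system for \<open>p\<close> up to a source that involves only \<open>\<integral>(q - p)\<close>, not \<open>q - p\<close>.
  The quadratic term of the exponential survives only for \<open>m = 3\<close>.\<close>

definition gauge_fun :: "nat \<Rightarrow> (real \<Rightarrow> complex) \<Rightarrow> (nat \<Rightarrow> real \<Rightarrow> complex) \<Rightarrow> nat \<Rightarrow> real \<Rightarrow> complex" where
  "gauge_fun m u Y k t = (if k = m - 2 then Y k t + u t * Y 0 t
     else if k = m - 1 then Y k t - u t * Y 1 t - (if m = 3 then u t * (u t * Y 0 t) / 2 else 0)
     else Y k t)"

text \<open>This is the commutator of the gauge matrix with the superdiagonal shift, applied to Y.
  It vanishes outside the rows m - 3, m - 2 and m - 1; the condition \<open>Suc k = m - 2\<close>
  selects row m - 3.\<close>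

definition gauge_src :: "nat \<Rightarrow> (real \<Rightarrow> complex) \<Rightarrow> (nat \<Rightarrow> real \<Rightarrow> complex) \<Rightarrow> nat \<Rightarrow> real \<Rightarrow> complex" where
  "gauge_src m u Y k t =
    (if k = m - 2 then 2 * u t * Y 1 t + (if m = 3 then u t * (u t * Y 0 t) / 2 else 0)
     else if k = m - 1 then - (u t * Y 2 t) - (if m = 3 then u t * (u t * Y 1 t) / 2 else 0)
     else if Suc k = m - 2 then - (u t * Y 0 t) else 0)"

text \<open>Differentiating u produces \<open>q - p\<close> times the nilpotent matrix, which
  exactly replaces q by p in the coefficients, so no product of u with p or q is left in the source.
  What remains is the commutator with the shift. The identity is checked row by row.\<close>

lemma gauge_fun_solves:
  assumes ab: "a < b" and m: "3 \<le> m" and q: "q absolutely_integrable_on {a..b}"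
    and p: "p absolutely_integrable_on {a..b}" and Y: "qsolves m a b q \<mu> g Y"
    and u: "\<And>t. u t = inverse (\<i> ^ m) * integral {a..t} (\<lambda>s. q s - p s)"
  shows "linear_system.solves m a b (qsys m p \<mu>) (\<lambda>k x. src m g k x + gauge_src m u Y k x) (gauge_fun m u Y)"
proof -
  interpret q: linear_system m a b "qsys m q \<mu>" by (rule qsys_linear_system[OF ab q])
  interpret p: linear_system m a b "qsys m p \<mu>" by (rule qsys_linear_system[OF ab p])
  define w where "w = inverse (\<i> ^ m)"
  have qp: "(\<lambda>s. q s - p s) absolutely_integrable_on {a..b}" using q p by simp
  have u_ac: "abs_cont_on a b u"
    unfolding u[abs_def] by (intro abs_cont_on_mult abs_cont_on_const abs_cont_on_integral qp)
  have Y_ac: "abs_cont_on a b (Y k)" if "k < m" for k using Y that by (simp add: q.solves_def)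
  define dY where "dY k x = (\<Sum>j<m. qsys m q \<mu> k j x * Y j x) + src m g k x" for k x
  have dY: "AE x in lebesgue_on {a..b}. \<forall>k\<in>{..<m}. (Y k has_vector_derivative dY k x) (at x within {a..b})"
    using Y unfolding q.solves_def dY_def by (intro eventually_ball_finite) auto
  have du: "AE x in lebesgue_on {a..b}.
      ((\<lambda>t. integral {a..t} (\<lambda>s. q s - p s)) has_vector_derivative (q x - p x)) (at x within {a..b})"
    by (intro AE_has_vector_derivative_integral set_lebesgue_integral_eq_integral(1) qp)
  \<comment> \<open>With n = m - 3, the rows n, n + 1 and n + 2 are the last three, the only ones in
    which the transformation has an effect.\<close>
  obtain n where n: "m = n + 3" using m by (metis add.commute le_Suc_ex)
  show ?thesis
    unfolding p.solves_def
  proof (intro allI impI conjI)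
    fix k assume k: "k < m"
    note ac = abs_cont_on_add abs_cont_on_diff abs_cont_on_mult abs_cont_on_const u_ac
    have half: "abs_cont_on a b (\<lambda>t. u t * (u t * Y 0 t) / 2)"
      using abs_cont_on_mult[OF abs_cont_on_mult[OF u_ac abs_cont_on_mult[OF u_ac Y_ac[of 0]]] abs_cont_on_const[of _ _ "1/2"]] m
      by simp
    show "abs_cont_on a b (gauge_fun m u Y k)"
    proof -
      have "abs_cont_on a b (\<lambda>t. Y k t + u t * Y 0 t)" "abs_cont_on a b (\<lambda>t. Y k t - u t * Y 1 t)"
        "abs_cont_on a b (\<lambda>t. Y k t - u t * Y 1 t - u t * (u t * Y 0 t) / 2)"
        using k m by (auto intro!: ac Y_ac half)
      then show ?thesis using Y_ac[OF k] unfolding gauge_fun_def[abs_def]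
        by (cases "k = m - 2"; cases "k = m - 1"; cases "m = 3") simp_all
    qed
    from dY du show "AE x in lebesgue_on {a..b}. (gauge_fun m u Y k has_vector_derivative
        (\<Sum>j<m. qsys m p \<mu> k j x * gauge_fun m u Y j x) + (src m g k x + gauge_src m u Y k x))
        (at x within {a..b})"
    proof eventually_elim
      case (elim x)
      let ?F = "at x within {a..b}"
      have D: "(Y j has_vector_derivative dY j x) ?F" if "j < m" for j using elim(1) that by simp
      have Du: "(u has_vector_derivative w * (q x - p x)) ?F"
        using has_vector_derivative_mult_right[OF elim(2), of w] by (simp add: u[abs_def] w_def)
      have d0: "dY 0 x = Y 1 x"
        using m by (simp add: dY_def qsys_row src_def)
      \<comment> \<open>For m = 3 the index 1 equals m - 2, so the derivative of \<open>Y 1\<close>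
        contains q. Its product with u is the term that the quadratic correction turns from q into
        p.\<close>
      have d1: "dY 1 x = Y 2 x - (if m = 3 then w * q x * Y 0 x else 0)"
        using m by (auto simp: dY_def qsys_row src_def w_def numeral_2_eq_2)
      have D0: "((\<lambda>t. u t * Y 0 t) has_vector_derivative u x * dY 0 x + w * (q x - p x) * Y 0 x) ?F"
        using has_vector_derivative_mult[OF Du D[of 0]] m by simp
      have D1: "((\<lambda>t. u t * Y 1 t) has_vector_derivative u x * dY 1 x + w * (q x - p x) * Y 1 x) ?F"
        using has_vector_derivative_mult[OF Du D[of 1]] m by simp
      have D00: "((\<lambda>t. u t * (u t * Y 0 t) / 2) has_vector_derivative
          (u x * (u x * dY 0 x + w * (q x - p x) * Y 0 x) + w * (q x - p x) * (u x * Y 0 x)) / 2) ?F"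
        using has_vector_derivative_divide[OF has_vector_derivative_mult[OF Du D0], of 2] by simp
      consider "k = n + 2" | "k = n + 1" | "k = n" | "k < n" using k n by linarith
      then show ?case
      proof cases
        case 1
        have dk: "dY k x = w * q x * Y 1 x + w * \<mu> * Y 0 x + w * g x"
          unfolding dY_def using 1 n by (simp add: qsys_row src_def w_def)
        have row: "(\<Sum>j<m. qsys m p \<mu> k j x * gauge_fun m u Y j x)
            = w * p x * gauge_fun m u Y 1 x + w * \<mu> * gauge_fun m u Y 0 x"
          using 1 n by (simp add: qsys_row w_def)
        show ?thesis
        proof (cases "m = 3")
          case True
          have "((\<lambda>t. Y k t - u t * Y 1 t - u t * (u t * Y 0 t) / 2) has_vector_derivative
              dY k x - (u x * dY 1 x + w * (q x - p x) * Y 1 x)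
              - (u x * (u x * dY 0 x + w * (q x - p x) * Y 0 x) + w * (q x - p x) * (u x * Y 0 x)) / 2) ?F"
            by (intro has_vector_derivative_diff D k D1 D00)
          moreover have "gauge_fun m u Y k = (\<lambda>t. Y k t - u t * Y 1 t - u t * (u t * Y 0 t) / 2)"
            using 1 n True by (simp add: gauge_fun_def[abs_def])
          moreover have "dY k x - (u x * dY 1 x + w * (q x - p x) * Y 1 x)
              - (u x * (u x * dY 0 x + w * (q x - p x) * Y 0 x) + w * (q x - p x) * (u x * Y 0 x)) / 2
            = w * p x * gauge_fun m u Y 1 x + w * \<mu> * gauge_fun m u Y 0 x
              + (src m g k x + gauge_src m u Y k x)"
          proof -
            have v: "gauge_fun m u Y 1 x = Y 1 x + u x * Y 0 x" "gauge_fun m u Y 0 x = Y 0 x"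
              "gauge_src m u Y k x = - (u x * Y 2 x) - u x * (u x * Y 1 x) / 2" "src m g k x = w * g x"
              "dY 1 x = Y 2 x - w * q x * Y 0 x"
              using 1 n True d1 by (simp_all add: gauge_fun_def gauge_src_def src_def w_def)
            show ?thesis unfolding dk d0 v by (simp add: field_simps)
          qed
          ultimately show ?thesis unfolding row by simp
        next
          case False
          have "((\<lambda>t. Y k t - u t * Y 1 t) has_vector_derivative
              dY k x - (u x * dY 1 x + w * (q x - p x) * Y 1 x)) ?F"
            by (intro has_vector_derivative_diff D k D1)
          moreover have "gauge_fun m u Y k = (\<lambda>t. Y k t - u t * Y 1 t)"
            using 1 n False by (simp add: gauge_fun_def[abs_def])
          moreover have "dY k x - (u x * dY 1 x + w * (q x - p x) * Y 1 x)
            = w * p x * gauge_fun m u Y 1 x + w * \<mu> * gauge_fun m u Y 0 x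
              + (src m g k x + gauge_src m u Y k x)"
          proof -
            have v: "gauge_fun m u Y 1 x = Y 1 x" "gauge_fun m u Y 0 x = Y 0 x"
              "gauge_src m u Y k x = - (u x * Y 2 x)" "src m g k x = w * g x" "dY 1 x = Y 2 x"
              using 1 n False d1 by (simp_all add: gauge_fun_def gauge_src_def src_def w_def)
            show ?thesis unfolding dk d0 v by (simp add: algebra_simps)
          qed
          ultimately show ?thesis unfolding row by simp
        qed
      next
        case 2
        have dk: "dY k x = Y (n + 2) x - w * q x * Y 0 x"
          unfolding dY_def using 2 n by (simp add: qsys_row src_def w_def)
        have row: "(\<Sum>j<m. qsys m p \<mu> k j x * gauge_fun m u Y j x)
            = gauge_fun m u Y (n + 2) x - w * p x * gauge_fun m u Y 0 x"
          using 2 n by (simp add: qsys_row w_def)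
        have "((\<lambda>t. Y k t + u t * Y 0 t) has_vector_derivative
            dY k x + (u x * dY 0 x + w * (q x - p x) * Y 0 x)) ?F"
          by (intro has_vector_derivative_add D k D0)
        moreover have "gauge_fun m u Y k = (\<lambda>t. Y k t + u t * Y 0 t)"
          using 2 n by (simp add: gauge_fun_def[abs_def])
        moreover have "dY k x + (u x * dY 0 x + w * (q x - p x) * Y 0 x)
            = gauge_fun m u Y (n + 2) x - w * p x * gauge_fun m u Y 0 x
              + (src m g k x + gauge_src m u Y k x)"
        proof -
          have v: "gauge_fun m u Y (n + 2) x
              = Y (n + 2) x - u x * Y 1 x - (if m = 3 then u x * (u x * Y 0 x) / 2 else 0)"
            "gauge_fun m u Y 0 x = Y 0 x" "src m g k x = 0"
            "gauge_src m u Y k x = 2 * u x * Y 1 x + (if m = 3 then u x * (u x * Y 0 x) / 2 else 0)"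
            using 2 n by (simp_all add: gauge_fun_def gauge_src_def src_def)
          show ?thesis unfolding dk d0 v by (simp add: algebra_simps)
        qed
        ultimately show ?thesis unfolding row by simp
      next
        case 3
        \<comment> \<open>This component is itself unchanged, but its derivative
          \<open>Y (n + 1)\<close> is one that the transformation shifts by
          \<open>u x * Y 0 x\<close>; the source compensates this shift.\<close>
        have "dY k x = Y (n + 1) x" unfolding dY_def using 3 n by (simp add: qsys_row src_def)
        moreover have "(\<Sum>j<m. qsys m p \<mu> k j x * gauge_fun m u Y j x) = gauge_fun m u Y (n + 1) x"
          using 3 n by (simp add: qsys_row)
        ultimately show ?thesis
          using D[OF k] 3 n by (simp add: gauge_fun_def[abs_def] gauge_src_def src_def)
      next
        case 4
        have "dY k x = Y (Suc k) x" unfolding dY_def using 4 n by (simp add: qsys_row src_def)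
        moreover have "(\<Sum>j<m. qsys m p \<mu> k j x * gauge_fun m u Y j x) = gauge_fun m u Y (Suc k) x"
          using 4 n by (simp add: qsys_row)
        ultimately show ?thesis
          using D[OF k] 4 n by (simp add: gauge_fun_def[abs_def] gauge_src_def src_def)
      qed
    qed
  qed
qed

text \<open>The condition \<open>d \<le> 1\<close> reduces the quadratic terms to linear ones in d.
  The worst case is m = 3, where the totals are 1 + 1/2 and 2 + 1/2; 2 and 3 are round upper
  bounds.\<close>

lemma gauge_bounds:
  assumes m: "3 \<le> m" and u: "cmod (u t) \<le> d" "d \<le> 1" and Y: "\<And>k. k < m \<Longrightarrow> cmod (Y k t) \<le> M" and k: "k < m"
  shows "cmod (gauge_fun m u Y k t - Y k t) \<le> 2 * d * M"
    and "cmod (gauge_src m u Y k t) \<le> 3 * d * M"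
proof -
  have d: "0 \<le> d" using u(1) norm_ge_zero order_trans by blast
  have M: "0 \<le> M" using Y[OF k] norm_ge_zero order_trans by blast
  have uY: "cmod (u t * Y j t) \<le> d * M" if "j < m" for j
    using Y[OF that] u(1) d by (simp add: norm_mult mult_mono)
  have uuY: "cmod (u t * (u t * Y j t)) \<le> d * M" if "j < m" for j
  proof -
    have "cmod (u t * (u t * Y j t)) = cmod (u t) * cmod (u t * Y j t)" by (rule norm_mult)
    also have "\<dots> \<le> 1 * (d * M)" using uY[OF that] u d M by (intro mult_mono) auto
    finally show ?thesis by simp
  qed
  note b = uY[of 0] uY[of 1] uY[of 2] uuY[of 0] uuY[of 1]
  have dM: "0 \<le> d * M" "0 \<le> M * d" using d M by simp_all
  show "cmod (gauge_fun m u Y k t - Y k t) \<le> 2 * d * M"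
  proof -
    have "cmod (- (u t * Y 1 t) - u t * (u t * Y 0 t) / 2) \<le> cmod (u t * Y 1 t) + cmod (u t * (u t * Y 0 t)) / 2"
      using norm_triangle_ineq4[of "- (u t * Y 1 t)" "u t * (u t * Y 0 t) / 2"] by (simp add: norm_divide norm_mult)
    moreover have "cmod (- (u t * Y 1 t)) = cmod (u t * Y 1 t)" by (rule norm_minus_cancel)
    ultimately show ?thesis
      using b m dM by (auto simp: gauge_fun_def)
  qed
  show "cmod (gauge_src m u Y k t) \<le> 3 * d * M"
  proof -
    have "cmod (2 * u t * Y 1 t + u t * (u t * Y 0 t) / 2) \<le> 2 * cmod (u t * Y 1 t) + cmod (u t * (u t * Y 0 t)) / 2"
      using norm_triangle_ineq[of "2 * u t * Y 1 t" "u t * (u t * Y 0 t) / 2"] by (simp add: norm_divide norm_mult)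
    moreover have "cmod (2 * u t * Y 1 t) = 2 * cmod (u t * Y 1 t)" by (simp add: norm_mult)
    moreover have "cmod (- (u t * Y 2 t) - u t * (u t * Y 1 t) / 2) \<le> cmod (u t * Y 2 t) + cmod (u t * (u t * Y 1 t)) / 2"
      using norm_triangle_ineq4[of "- (u t * Y 2 t)" "u t * (u t * Y 1 t) / 2"] by (simp add: norm_divide norm_mult)
    moreover have "cmod (- (u t * Y 2 t)) = cmod (u t * Y 2 t)" "cmod (- (u t * Y 0 t)) = cmod (u t * Y 0 t)"
      by (rule norm_minus_cancel)+
    ultimately show ?thesis
      using b m dM by (auto simp: gauge_src_def)
  qed
qed

lemma src_zero: "src m (\<lambda>_. 0) = (\<lambda>_ _. 0)"
  by (intro ext) (simp add: src_def)

context linear_system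
begin

lemma L1_src: "g absolutely_integrable_on {a..b} \<Longrightarrow> L1 (src m g)"
  unfolding L1_def
proof (intro allI impI)
  fix k assume g: "g absolutely_integrable_on {a..b}"
  have "(\<lambda>x. inverse (\<i> ^ m) * g x) absolutely_integrable_on {a..b}"
    using g by (intro set_integrable_mult_right) simp
  then show "src m g k absolutely_integrable_on {a..b}"
    by (cases "k = m - 1") (simp_all add: src_def[abs_def])
qed

lemma L1norm_src: "0 < m \<Longrightarrow> L1norm (src m g) = integral {a..b} (\<lambda>x. cmod (g x))"
proof -
  assume m: "0 < m"
  have "L1norm (src m g) = (\<Sum>k<m. if k = m - 1 then integral {a..b} (\<lambda>x. cmod (g x)) else 0)"
    unfolding L1norm_def
    by (rule sum.cong) (simp_all add: src_def norm_mult del: inverse_eq_divide power_inverse)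
  then show ?thesis using m by simp
qed

lemma L1norm_bounded:
  assumes "L1 F" "\<And>k t. k < m \<Longrightarrow> t \<in> {a..b} \<Longrightarrow> cmod (F k t) \<le> M"
  shows "L1norm F \<le> real m * (M * (b - a))"
proof -
  have "L1norm F \<le> (\<Sum>k<m. M * (b - a))"
    unfolding L1norm_def
  proof (rule sum_mono)
    fix k assume "k \<in> {..<m}"
    then have k: "k < m" by simp
    have "integral {a..b} (\<lambda>x. cmod (F k x)) \<le> integral {a..b} (\<lambda>x. M)"
      using assms k unfolding L1_def
      by (intro integral_le set_lebesgue_integral_eq_integral(1) set_integrable_norm) auto
    then show "integral {a..b} (\<lambda>x. cmod (F k x)) \<le> M * (b - a)" using ab by (simp add: mult.commute)
  qed
  then show ?thesis by simp
qed

text \<open>The absorption principle for the unweighted sup norm over all components; continuity on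
  the compact interval supplies the finite supremum.\<close>

lemma coupled_bound:
  assumes Y: "\<And>k. k < m \<Longrightarrow> continuous_on {a..b} (Y k)"
    and step: "\<And>M k t. 0 \<le> M \<Longrightarrow> (\<And>k t. k < m \<Longrightarrow> t \<in> {a..b} \<Longrightarrow> cmod (Y k t) \<le> M) \<Longrightarrow>
      k < m \<Longrightarrow> t \<in> {a..b} \<Longrightarrow> cmod (Y k t) \<le> X + M / 2"
    and k: "k < m" and t: "t \<in> {a..b}"
  shows "cmod (Y k t) \<le> 2 * X"
proof -
  obtain M0 where M0: "\<And>j t. j < m \<Longrightarrow> t \<in> {a..b} \<Longrightarrow> cmod (Y j t) \<le> M0"
    using continuous_family_bounded[where Z = Y, OF Y] by metis
  have "(\<lambda>(k, t). cmod (Y k t)) (k, t) \<le> 2 * X"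
  proof (rule bound_by_halving[where S = "{..<m} \<times> {a..b}"])
    show "bdd_above ((\<lambda>(k, t). cmod (Y k t)) ` ({..<m} \<times> {a..b}))"
      using M0 by (intro bdd_aboveI2[where M = M0]) auto
    fix M x assume M: "0 \<le> M" "\<And>y. y \<in> {..<m} \<times> {a..b} \<Longrightarrow> (\<lambda>(k, t). cmod (Y k t)) y \<le> M"
      and x: "x \<in> {..<m} \<times> {a..b}"
    have "cmod (Y (fst x) (snd x)) \<le> X + M / 2"
      using step[OF M(1), of "fst x" "snd x"] M(2) x by fastforce
    then show "(\<lambda>(k, t). cmod (Y k t)) x \<le> X + M / 2" by (simp add: split_beta)
  qed (use k t in auto)
  then show ?thesis by simp
qed

end

section \<open>The a priori estimate for perturbed boundary value problems\<close>

definition coeff_dist :: "nat \<Rightarrow> (nat \<Rightarrow> nat \<Rightarrow> complex) \<Rightarrow> (nat \<Rightarrow> nat \<Rightarrow> complex)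
    \<Rightarrow> (nat \<Rightarrow> nat \<Rightarrow> complex) \<Rightarrow> (nat \<Rightarrow> nat \<Rightarrow> complex) \<Rightarrow> real" where
  "coeff_dist m \<alpha> \<beta> \<alpha>' \<beta>' = (\<Sum>i<m. \<Sum>k<m. cmod (\<alpha> i k - \<alpha>' i k) + cmod (\<beta> i k - \<beta>' i k))"

text \<open>C and K are chosen from the limit problem alone and serve for all q, all boundary
  matrices and all right-hand sides; this uniformity is what yields convergence of the resolvents in
  norm.\<close>

theorem quasi_perturbation:
  assumes ab: "a < b" and m: "3 \<le> m" and p: "p absolutely_integrable_on {a..b}"
    and trivial: "\<And>Z. qsolves m a b p \<mu> (\<lambda>_. 0) Z \<Longrightarrow> (\<forall>i<m. bc m a b \<alpha>0 \<beta>0 Z i = 0) \<Longrightarrow>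
      (\<forall>k<m. \<forall>t\<in>{a..b}. Z k t = 0)"
  obtains C K where "0 \<le> C" "0 \<le> K"
    "\<And>q \<alpha> \<beta> d e g Y k t. q absolutely_integrable_on {a..b} \<Longrightarrow>
      (\<And>t. t \<in> {a..b} \<Longrightarrow> cmod (integral {a..t} (\<lambda>s. q s - p s)) \<le> d) \<Longrightarrow> d \<le> 1 \<Longrightarrow>
      coeff_dist m \<alpha>0 \<beta>0 \<alpha> \<beta> \<le> e \<Longrightarrow> K * (d + e) \<le> 1 / 2 \<Longrightarrow>
      g absolutely_integrable_on {a..b} \<Longrightarrow>
      qsolves m a b q \<mu> g Y \<Longrightarrow> (\<forall>i<m. bc m a b \<alpha> \<beta> Y i = 0) \<Longrightarrow> k < m \<Longrightarrow> t \<in> {a..b} \<Longrightarrow>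
      cmod (Y k t) \<le> C * integral {a..b} (\<lambda>x. cmod (g x))"
    "\<And>q \<alpha> \<beta> d e g Y Y0 k t. q absolutely_integrable_on {a..b} \<Longrightarrow>
      (\<And>t. t \<in> {a..b} \<Longrightarrow> cmod (integral {a..t} (\<lambda>s. q s - p s)) \<le> d) \<Longrightarrow> d \<le> 1 \<Longrightarrow>
      coeff_dist m \<alpha>0 \<beta>0 \<alpha> \<beta> \<le> e \<Longrightarrow> K * (d + e) \<le> 1 / 2 \<Longrightarrow>
      g absolutely_integrable_on {a..b} \<Longrightarrow>
      qsolves m a b q \<mu> g Y \<Longrightarrow> (\<forall>i<m. bc m a b \<alpha> \<beta> Y i = 0) \<Longrightarrow>
      qsolves m a b p \<mu> g Y0 \<Longrightarrow> (\<forall>i<m. bc m a b \<alpha>0 \<beta>0 Y0 i = 0) \<Longrightarrow> k < m \<Longrightarrow> t \<in> {a..b} \<Longrightarrow>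
      cmod (Y k t - Y0 k t) \<le> K * (d + e) * (C * integral {a..b} (\<lambda>x. cmod (g x)))"
proof -
  interpret p: linear_system m a b "qsys m p \<mu>" by (rule qsys_linear_system[OF ab p])
  let ?bc = "bc m a b \<alpha>0 \<beta>0"
  note trivial' = trivial[unfolded src_zero]
  have exists: "\<exists>Z. p.solves F Z \<and> (\<forall>i<m. ?bc Z i = 0)" if "p.L1 F" for F
    by (rule p.boundary_value_problem(1)[OF _ that]) (rule trivial')
  obtain C0 where C0: "0 \<le> C0" "\<And>F Z k t. p.L1 F \<Longrightarrow> p.solves F Z \<Longrightarrow> k < m \<Longrightarrow> t \<in> {a..b} \<Longrightarrow>
      cmod (Z k t) \<le> C0 * (p.L1norm F + (\<Sum>i<m. cmod (?bc Z i)))"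
    using p.boundary_value_problem(2)[of \<alpha>0 \<beta>0, OF trivial'] by blast
  define U where "U = (\<Sum>i<m. \<Sum>k<m. cmod (\<alpha>0 i k) + cmod (\<beta>0 i k))"
  have U: "0 \<le> U" by (simp add: U_def sum_nonneg)
  \<comment> \<open>The 2 comes from \<open>Z - Y\<close>, the term with \<open>b - a\<close> from
    the L1 norm of the gauge source, \<open>2 * U\<close> from the boundary values of
    \<open>Z - Y\<close>, and 1 from the difference of the boundary matrices.\<close>
  define K where "K = 2 + C0 * (3 * real m * (b - a) + 2 * U + 1)"
  have K: "0 \<le> K" using C0(1) U ab by (simp add: K_def)
  have base: "cmod (Y0 k t) \<le> C0 * integral {a..b} (\<lambda>x. cmod (g x))"
    if "g absolutely_integrable_on {a..b}" "qsolves m a b p \<mu> g Y0" "\<forall>i<m. ?bc Y0 i = 0" "k < m" "t \<in> {a..b}"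
    for g Y0 k t
    using C0(2)[OF p.L1_src[OF that(1)] that(2) that(4,5)] that(3) p.L1norm_src m by simp
  \<comment> \<open>M is any bound for Y, not yet one in terms of g. The estimate can thus serve for
    the absorption that produces such a bound, and again for the comparison with Y0 once the bound
    is known.\<close>
  have key: "cmod (Y k t - Y0 k t) \<le> K * (d + e) * M"
    if q: "q absolutely_integrable_on {a..b}"
      and d: "\<And>t. t \<in> {a..b} \<Longrightarrow> cmod (integral {a..t} (\<lambda>s. q s - p s)) \<le> d" "d \<le> 1"
      and e: "coeff_dist m \<alpha>0 \<beta>0 \<alpha> \<beta> \<le> e"
      and g: "g absolutely_integrable_on {a..b}"
      and Y: "qsolves m a b q \<mu> g Y" "\<forall>i<m. bc m a b \<alpha> \<beta> Y i = 0"
      and Y0: "qsolves m a b p \<mu> g Y0" "\<forall>i<m. ?bc Y0 i = 0"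
      and M: "0 \<le> M" "\<And>k t. k < m \<Longrightarrow> t \<in> {a..b} \<Longrightarrow> cmod (Y k t) \<le> M"
      and k: "k < m" and t: "t \<in> {a..b}" for q d e \<alpha> \<beta> g Y Y0 M k t
  proof -
    interpret q: linear_system m a b "qsys m q \<mu>" by (rule qsys_linear_system[OF ab q])
    define u where "u t = inverse (\<i> ^ m) * integral {a..t} (\<lambda>s. q s - p s)" for t
    have u: "cmod (u t) \<le> d" if "t \<in> {a..b}" for t
      using d(1)[OF that] unfolding u_def norm_mult norm_inverse_i_power by simp
    have d0: "0 \<le> d" using d(1)[OF t] norm_ge_zero order_trans by blast
    define Z where "Z = gauge_fun m u Y"
    define G where "G = gauge_src m u Y"
    have Z: "p.solves (\<lambda>k x. src m g k x + G k x) Z"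
      unfolding Z_def G_def by (rule gauge_fun_solves[OF ab m q p Y(1)]) (simp add: u_def)
    have ZY: "cmod (Z k t - Y k t) \<le> 2 * d * M" and Gb: "cmod (G k t) \<le> 3 * d * M"
      if "k < m" "t \<in> {a..b}" for k t
      unfolding Z_def G_def using gauge_bounds[where u = u and Y = Y and t = t, OF m u[OF that(2)] d(2) _ that(1)] M(2) that(2) by blast+
    \<comment> \<open>The right-hand side g cancels in the difference, so only the small gauge
      source remains.\<close>
    have W: "p.solves G (\<lambda>k t. Z k t - Y0 k t)"
      using p.solves_diff[OF Z Y0(1)] by simp
    have uc: "continuous_on {a..b} u"
    proof -
      have "(\<lambda>s. q s - p s) integrable_on {a..b}"
        using q p by (intro set_lebesgue_integral_eq_integral(1)) simp
      then show ?thesis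
        unfolding u_def[abs_def] by (intro continuous_intros indefinite_integral_continuous_1)
    qed
    have GL: "p.L1 G"
    proof -
      have Yc: "continuous_on {a..b} (Y j)" if "j < m" for j by (rule q.solves_continuous[OF Y(1) that])
      have "continuous_on {a..b} (G k)" for k
        unfolding G_def gauge_src_def[abs_def] using m
        by (cases "k = m - 2"; cases "k = m - 1"; cases "Suc k = m - 2"; cases "m = 3")
          (auto intro!: continuous_intros uc Yc)
      then show ?thesis unfolding p.L1_def by (auto intro: absolutely_integrable_continuous_real)
    qed
    have "p.L1norm G \<le> real m * (3 * d * M * (b - a))"
      by (rule p.L1norm_bounded[OF GL Gb])
    moreover have "(\<Sum>i<m. cmod (?bc (\<lambda>k t. Z k t - Y0 k t) i)) \<le> (2 * U * d + e) * M"
    proof -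
      have "cmod (?bc (\<lambda>k t. Z k t - Y0 k t) i)
          \<le> (\<Sum>k<m. cmod (\<alpha>0 i k) + cmod (\<beta>0 i k)) * (2 * d * M)
            + (\<Sum>k<m. cmod (\<alpha>0 i k - \<alpha> i k) + cmod (\<beta>0 i k - \<beta> i k)) * M" if i: "i < m" for i
      proof -
        have "?bc (\<lambda>k t. Z k t - Y0 k t) i = ?bc Z i"
          using bc_add_scaled[of m a b \<alpha>0 \<beta>0 Z "-1" Y0 i] Y0(2) i by simp
        \<comment> \<open>Y satisfies the perturbed boundary condition, so its defect under the
          limit condition is due to the change of the matrices alone.\<close>
        also have "\<dots> = ?bc (\<lambda>k t. Z k t - Y k t) i + (?bc Y i - bc m a b \<alpha> \<beta> Y i)"
          using bc_add_scaled[of m a b \<alpha>0 \<beta>0 Z "-1" Y i] Y(2) i by simp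
        finally have eq: "?bc (\<lambda>k t. Z k t - Y0 k t) i
            = ?bc (\<lambda>k t. Z k t - Y k t) i + (?bc Y i - bc m a b \<alpha> \<beta> Y i)" .
        have "cmod (?bc (\<lambda>k t. Z k t - Y0 k t) i)
            \<le> cmod (?bc (\<lambda>k t. Z k t - Y k t) i) + cmod (?bc Y i - bc m a b \<alpha> \<beta> Y i)"
          unfolding eq by (rule norm_triangle_ineq)
        also have "\<dots> \<le> (\<Sum>k<m. cmod (\<alpha>0 i k) + cmod (\<beta>0 i k)) * (2 * d * M)
            + (\<Sum>k<m. cmod (\<alpha>0 i k - \<alpha> i k) + cmod (\<beta>0 i k - \<beta> i k)) * M"
          by (intro add_mono bc_bound bc_diff_bound ZY M(2)) (use ab in auto)
        finally show ?thesis .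
      qed
      then have "(\<Sum>i<m. cmod (?bc (\<lambda>k t. Z k t - Y0 k t) i))
          \<le> (\<Sum>i<m. (\<Sum>k<m. cmod (\<alpha>0 i k) + cmod (\<beta>0 i k)) * (2 * d * M)
            + (\<Sum>k<m. cmod (\<alpha>0 i k - \<alpha> i k) + cmod (\<beta>0 i k - \<beta> i k)) * M)"
        by (intro sum_mono) auto
      also have "\<dots> = U * (2 * d * M) + coeff_dist m \<alpha>0 \<beta>0 \<alpha> \<beta> * M"
        unfolding U_def coeff_dist_def by (subst sum.distrib) (simp only: sum_distrib_right)
      also have "\<dots> \<le> U * (2 * d * M) + e * M" using e M(1) by (intro add_left_mono mult_right_mono)
      finally show ?thesis by (simp add: algebra_simps)
    qed
    ultimately have "C0 * (p.L1norm G + (\<Sum>i<m. cmod (?bc (\<lambda>k t. Z k t - Y0 k t) i)))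
        \<le> C0 * (real m * (3 * d * M * (b - a)) + (2 * U * d + e) * M)"
      using C0(1) by (intro mult_left_mono add_mono)
    with C0(2)[OF GL W k t]
    have 1: "cmod (Z k t - Y0 k t) \<le> C0 * (real m * (3 * d * M * (b - a)) + (2 * U * d + e) * M)"
      by linarith
    have "cmod (Y k t - Y0 k t) \<le> cmod (Z k t - Y k t) + cmod (Z k t - Y0 k t)"
      using norm_triangle_ineq[of "Y k t - Z k t" "Z k t - Y0 k t"] by (simp add: norm_minus_commute)
    also have "\<dots> \<le> 2 * d * M + C0 * (real m * (3 * d * M * (b - a)) + (2 * U * d + e) * M)"
      using 1 ZY[OF k t] by linarith
    also have "\<dots> \<le> K * (d + e) * M"
    proof -
      have e0: "0 \<le> e" using e by (rule order_trans[rotated]) (simp add: coeff_dist_def sum_nonneg)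
      define R where "R = b - a"
      have R: "0 \<le> R" using ab by (simp add: R_def)
      have "2 * d + C0 * (real m * (3 * d * R) + (2 * U * d + e))
          \<le> 2 * (d + e) + C0 * (real m * (3 * (d + e) * R) + (2 * U * (d + e) + (d + e)))"
        using d0 e0 C0(1) U R
        by (intro add_mono mult_left_mono mult_right_mono) auto
      also have "\<dots> = K * (d + e)" by (simp add: K_def R_def algebra_simps)
      finally have "(2 * d + C0 * (real m * (3 * d * R) + (2 * U * d + e))) * M \<le> K * (d + e) * M"
        by (rule mult_right_mono[OF _ M(1)])
      then show ?thesis by (simp add: R_def algebra_simps)
    qed
    finally show ?thesis .
  qed
  have bound: "cmod (Y k t) \<le> 2 * C0 * integral {a..b} (\<lambda>x. cmod (g x))"
    if q: "q absolutely_integrable_on {a..b}"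
      and d: "\<And>t. t \<in> {a..b} \<Longrightarrow> cmod (integral {a..t} (\<lambda>s. q s - p s)) \<le> d" "d \<le> 1"
      and e: "coeff_dist m \<alpha>0 \<beta>0 \<alpha> \<beta> \<le> e" and small: "K * (d + e) \<le> 1 / 2"
      and g: "g absolutely_integrable_on {a..b}"
      and Y: "qsolves m a b q \<mu> g Y" "\<forall>i<m. bc m a b \<alpha> \<beta> Y i = 0"
      and k: "k < m" and t: "t \<in> {a..b}" for q d e \<alpha> \<beta> g Y k t
  proof -
    interpret q: linear_system m a b "qsys m q \<mu>" by (rule qsys_linear_system[OF ab q])
    \<comment> \<open>The limit problem with the same g is solvable by the Fredholm alternative. Its
      solution carries the main term of the bound, and the difference to it is absorbed; hence the
      factor 2 in the final constant.\<close>
    obtain Y0 where Y0: "qsolves m a b p \<mu> g Y0" "\<forall>i<m. ?bc Y0 i = 0"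
      using exists[OF p.L1_src[OF g]] by blast
    have "cmod (Y k t) \<le> 2 * (C0 * integral {a..b} (\<lambda>x. cmod (g x)))"
    proof (rule q.coupled_bound[OF q.solves_continuous[OF Y(1)] _ k t])
      fix M k t assume M: "0 \<le> M" "\<And>k t. k < m \<Longrightarrow> t \<in> {a..b} \<Longrightarrow> cmod (Y k t) \<le> M"
        and k: "k < m" and t: "t \<in> {a..b}"
      have "cmod (Y k t) \<le> cmod (Y0 k t) + cmod (Y k t - Y0 k t)"
        using norm_triangle_ineq[of "Y0 k t" "Y k t - Y0 k t"] by simp
      also have "\<dots> \<le> C0 * integral {a..b} (\<lambda>x. cmod (g x)) + K * (d + e) * M"
        by (intro add_mono base[OF g Y0 k t] key[OF q d e g Y Y0 M k t])
      also have "K * (d + e) * M \<le> 1 / 2 * M" using small M(1) by (rule mult_right_mono)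
      finally show "cmod (Y k t) \<le> C0 * integral {a..b} (\<lambda>x. cmod (g x)) + M / 2" by simp
    qed
    then show ?thesis by simp
  qed
  show ?thesis
  proof (rule that[of "2 * C0" K])
    fix q \<alpha> \<beta> d e g Y Y0 k t
    assume q: "q absolutely_integrable_on {a..b}"
      and d: "\<And>t. t \<in> {a..b} \<Longrightarrow> cmod (integral {a..t} (\<lambda>s. q s - p s)) \<le> d" "d \<le> 1"
      and e: "coeff_dist m \<alpha>0 \<beta>0 \<alpha> \<beta> \<le> e" and small: "K * (d + e) \<le> 1 / 2"
      and g: "g absolutely_integrable_on {a..b}"
      and Y: "qsolves m a b q \<mu> g Y" "\<forall>i<m. bc m a b \<alpha> \<beta> Y i = 0"
      and Y0: "qsolves m a b p \<mu> g Y0" "\<forall>i<m. ?bc Y0 i = 0"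
      and k: "k < m" and t: "t \<in> {a..b}"
    have "0 \<le> integral {a..b} (\<lambda>x. cmod (g x))"
      by (intro Henstock_Kurzweil_Integration.integral_nonneg
          set_lebesgue_integral_eq_integral(1) set_integrable_norm g) simp
    then show "cmod (Y k t - Y0 k t) \<le> K * (d + e) * (2 * C0 * integral {a..b} (\<lambda>x. cmod (g x)))"
      using C0(1) by (intro key[OF q d e g Y Y0 _ bound[OF q d e small g Y] k t]) auto
  next
    fix q \<alpha> \<beta> d e g Y k t
    assume q: "q absolutely_integrable_on {a..b}"
      and d: "\<And>t. t \<in> {a..b} \<Longrightarrow> cmod (integral {a..t} (\<lambda>s. q s - p s)) \<le> d" "d \<le> 1"
      and r: "coeff_dist m \<alpha>0 \<beta>0 \<alpha> \<beta> \<le> e" "K * (d + e) \<le> 1 / 2"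
        "g absolutely_integrable_on {a..b}"
        "qsolves m a b q \<mu> g Y" "\<forall>i<m. bc m a b \<alpha> \<beta> Y i = 0" "k < m" "t \<in> {a..b}"
    show "cmod (Y k t) \<le> 2 * C0 * integral {a..b} (\<lambda>x. cmod (g x))"
      by (rule bound[OF q d r])
  qed (use C0(1) K in auto)
qed

section \<open>Resolvents\<close>

lemma integrable_lebesgue_on_iff:
  fixes f :: "real \<Rightarrow> 'a::euclidean_space"
  shows "integrable (lebesgue_on {a..b}) f \<longleftrightarrow> f absolutely_integrable_on {a..b}"
  by (simp add: integrable_restrict_space set_integrable_def)

lemma integrable_const_lebesgue_on: "integrable (lebesgue_on {a..b::real}) (\<lambda>x. c::real)"
  unfolding integrable_lebesgue_on_iff
  by (intro absolutely_integrable_continuous_real continuous_intros)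

lemma L2norm_nonneg: "0 \<le> L2norm a b f"
  by (simp add: L2norm_def)

text \<open>Young's inequality |g| <= (r + |g|^2 / r) / 2 is integrated and used with r close to the
  L2 norm of g. The factor (b - a + 1) / 2 stands in for the sharper square root of b - a.\<close>

lemma L2_imp_absolutely_integrable:
  assumes g: "L2 a b g" and ab: "a < b"
  shows "g absolutely_integrable_on {a..b}"
    and "integral {a..b} (\<lambda>x. cmod (g x)) \<le> (b - a + 1) / 2 * L2norm a b g"
proof -
  have gm: "g \<in> borel_measurable (lebesgue_on {a..b})"
    and g2: "integrable (lebesgue_on {a..b}) (\<lambda>x. (cmod (g x))\<^sup>2)"
    using g by (auto simp: L2_def)
  have young: "cmod (g x) \<le> (r + (cmod (g x))\<^sup>2 / r) / 2" if "r > 0" for r x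
  proof -
    have "0 \<le> (cmod (g x) - r)\<^sup>2" by simp
    then have "2 * cmod (g x) * r \<le> r * r + (cmod (g x))\<^sup>2"
      by (simp add: power2_eq_square algebra_simps)
    then show ?thesis using that by (simp add: field_simps power2_eq_square)
  qed
  have Y: "integrable (lebesgue_on {a..b}) (\<lambda>x. (r + (cmod (g x))\<^sup>2 / r) / 2)" for r
    by (intro integrable_divide Bochner_Integration.integrable_add integrable_const_lebesgue_on g2)
  have gi: "integrable (lebesgue_on {a..b}) g"
  proof (rule Bochner_Integration.integrable_bound[OF Y gm])
    show "AE x in lebesgue_on {a..b}. norm (g x) \<le> norm ((1 + (cmod (g x))\<^sup>2 / 1) / 2)"
      using young[of 1] by (intro AE_I2) (simp add: order_trans[OF _ abs_ge_self])
  qed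
  then show "g absolutely_integrable_on {a..b}" by (simp add: integrable_lebesgue_on_iff)
  define N where "N = L2norm a b g"
  define I where "I = integral {a..b} (\<lambda>x. cmod (g x))"
  have N2: "N\<^sup>2 = (\<integral>x. (cmod (g x))\<^sup>2 \<partial>lebesgue_on {a..b})"
    by (simp add: N_def L2norm_def integral_nonneg_AE)
  have I_eq: "I = (\<integral>x. cmod (g x) \<partial>lebesgue_on {a..b})"
    unfolding I_def using gi by (intro lebesgue_integral_eq_integral[symmetric]) auto
  \<comment> \<open>N may be 0, which excludes dividing by it; the estimate is shown for every r > N
    and the infimum over r taken afterwards.\<close>
  have "I \<le> (b - a + 1) / 2 * r" if r: "N < r" for r
  proof -
    have r0: "0 < r" using r L2norm_nonneg[of a b g] by (simp add: N_def)
    have "I \<le> (\<integral>x. (r + (cmod (g x))\<^sup>2 / r) / 2 \<partial>lebesgue_on {a..b})"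
      unfolding I_eq using gi young[OF r0] by (intro integral_mono Y) auto
    also have "\<dots> = (r * (b - a) + N\<^sup>2 / r) / 2"
      using g2 integrable_const_lebesgue_on[of a b r] by (simp add: measure_restrict_space ab less_imp_le flip: N2)
    also have "\<dots> \<le> (r * (b - a) + r) / 2"
    proof -
      have "N\<^sup>2 \<le> r\<^sup>2" using r L2norm_nonneg[of a b g] by (intro power_mono) (auto simp: N_def)
      then have "N\<^sup>2 / r \<le> r" using r0 by (simp add: field_simps power2_eq_square)
      then show ?thesis by (intro divide_right_mono add_left_mono) simp_all
    qed
    finally show ?thesis by (simp add: algebra_simps)
  qed
  then have *: "I / ((b - a + 1) / 2) \<le> r" if "N < r" for r
    using ab that by (simp add: pos_divide_le_eq mult.commute)
  have "I / ((b - a + 1) / 2) \<le> N" by (rule dense_ge) (rule *)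
  then have "I \<le> N * ((b - a + 1) / 2)" using ab pos_divide_le_eq[of "(b - a + 1) / 2" I N] by simp
  then show "integral {a..b} (\<lambda>x. cmod (g x)) \<le> (b - a + 1) / 2 * L2norm a b g"
    by (simp add: I_def N_def mult.commute)
qed

lemma L2norm_le:
  assumes "a < b" "0 \<le> B" "\<And>t. t \<in> {a..b} \<Longrightarrow> cmod (y t) \<le> B"
  shows "L2norm a b y \<le> B * sqrt (b - a)"
proof -
  have "(\<integral>x. (cmod (y x))\<^sup>2 \<partial>lebesgue_on {a..b}) \<le> B\<^sup>2 * (b - a)"
  proof (cases "integrable (lebesgue_on {a..b}) (\<lambda>x. (cmod (y x))\<^sup>2)")
    case True
    have "(\<integral>x. (cmod (y x))\<^sup>2 \<partial>lebesgue_on {a..b}) \<le> (\<integral>x. B\<^sup>2 \<partial>lebesgue_on {a..b})"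
      using assms(3) by (intro integral_mono True integrable_const_lebesgue_on) (auto intro: power_mono)
    also have "\<dots> = B\<^sup>2 * (b - a)"
      using lebesgue_integral_eq_integral[OF integrable_const_lebesgue_on, of a b "B\<^sup>2"] assms(1) by simp
    finally show ?thesis .
  next
    \<comment> \<open>Without integrability the Bochner integral has the default value 0, so the
      bound persists.\<close>
    case False
    then show ?thesis using assms(1) by (simp add: not_integrable_integral_eq)
  qed
  then have "L2norm a b y \<le> sqrt (B\<^sup>2 * (b - a))" unfolding L2norm_def by (rule real_sqrt_le_mono)
  then show ?thesis using assms(2) by (simp add: real_sqrt_mult)
qed

lemma L2_zero: "L2 a b (\<lambda>_. 0)" and L2norm_zero: "L2norm a b (\<lambda>_. 0) = 0"
  by (simp_all add: L2_def L2norm_def)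

lemma L2_combination:
  assumes g: "L2 a b g" and y: "continuous_on {a..b} y"
  shows "L2 a b (\<lambda>x. c * g x + d * y x)"
proof -
  have gm: "g \<in> borel_measurable (lebesgue_on {a..b})"
    and g2: "integrable (lebesgue_on {a..b}) (\<lambda>x. (cmod (g x))\<^sup>2)"
    using g by (auto simp: L2_def)
  have ym: "y \<in> borel_measurable (lebesgue_on {a..b})"
    using y by (rule continuous_imp_measurable_on_sets_lebesgue) simp
  have m: "(\<lambda>x. c * g x + d * y x) \<in> borel_measurable (lebesgue_on {a..b})"
    using gm ym by measurable
  have y2: "integrable (lebesgue_on {a..b}) (\<lambda>x. (cmod (y x))\<^sup>2)"
    unfolding integrable_lebesgue_on_iff
    by (intro absolutely_integrable_continuous_real continuous_intros y)
  have "integrable (lebesgue_on {a..b}) (\<lambda>x. (cmod (c * g x + d * y x))\<^sup>2)"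
  proof (rule Bochner_Integration.integrable_bound)
    show "integrable (lebesgue_on {a..b})
        (\<lambda>x. 2 * (cmod c)\<^sup>2 * (cmod (g x))\<^sup>2 + 2 * (cmod d)\<^sup>2 * (cmod (y x))\<^sup>2)"
      using g2 y2 by (intro Bochner_Integration.integrable_add integrable_mult_right)
    show "(\<lambda>x. (cmod (c * g x + d * y x))\<^sup>2) \<in> borel_measurable (lebesgue_on {a..b})"
      using m by measurable
    show "AE x in lebesgue_on {a..b}. norm ((cmod (c * g x + d * y x))\<^sup>2)
        \<le> norm (2 * (cmod c)\<^sup>2 * (cmod (g x))\<^sup>2 + 2 * (cmod d)\<^sup>2 * (cmod (y x))\<^sup>2)"
    proof (rule AE_I2)
      fix x
      define s t where "s = cmod (c * g x)" and "t = cmod (d * y x)"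
      have "(cmod (c * g x + d * y x))\<^sup>2 \<le> (s + t)\<^sup>2"
        unfolding s_def t_def by (intro power_mono norm_triangle_ineq) simp
      also have "\<dots> \<le> 2 * s\<^sup>2 + 2 * t\<^sup>2"
        using sum_squares_bound[of s t] by (simp add: power2_sum)
      also have "\<dots> = 2 * (cmod c)\<^sup>2 * (cmod (g x))\<^sup>2 + 2 * (cmod d)\<^sup>2 * (cmod (y x))\<^sup>2"
        by (simp add: s_def t_def norm_mult power_mult_distrib)
      finally show "norm ((cmod (c * g x + d * y x))\<^sup>2)
          \<le> norm (2 * (cmod c)\<^sup>2 * (cmod (g x))\<^sup>2 + 2 * (cmod d)\<^sup>2 * (cmod (y x))\<^sup>2)" by simp
    qed
  qed
  with m show ?thesis by (simp add: L2_def)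
qed

section \<open>Passage from the operator to the first-order system and back\<close>

lemma AE_lebesgue_on_mem: "AE x in lebesgue_on {a..b::real}. x \<in> {a..b}"
  by (rule AE_I2) simp

lemma L2norm_cong_AE:
  assumes "L2 a b g" "AE x in lebesgue_on {a..b}. f x = g x"
  shows "L2norm a b f = L2norm a b g"
proof -
  obtain N where N: "negligible N" "\<And>x. x \<in> {a..b} - N \<Longrightarrow> f x = g x"
    using assms(2) unfolding AE_lebesgue_on_iff_negligible by blast
  have g: "(\<lambda>x. (cmod (g x))\<^sup>2) absolutely_integrable_on {a..b}"
    using assms(1) by (simp add: L2_def integrable_lebesgue_on_iff)
  have f: "(\<lambda>x. (cmod (f x))\<^sup>2) absolutely_integrable_on {a..b}"
    by (rule absolutely_integrable_spike[OF g N(1)]) (simp add: N(2))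
  have "integral {a..b} (\<lambda>x. (cmod (f x))\<^sup>2) = integral {a..b} (\<lambda>x. (cmod (g x))\<^sup>2)"
    by (rule integral_spike[OF N(1)]) (simp add: N(2))
  then show ?thesis
    using f g by (simp add: L2norm_def lebesgue_integral_eq_integral integrable_lebesgue_on_iff)
qed

text \<open>A nonzero value at t would persist on a nondegenerate interval inside [a,b] containing
  t, and such an interval is not negligible.\<close>

lemma continuous_AE_zero:
  fixes f :: "real \<Rightarrow> complex"
  assumes ab: "a < b" and f: "continuous_on {a..b} f" and ae: "AE x in lebesgue_on {a..b}. f x = 0"
    and t: "t \<in> {a..b}"
  shows "f t = 0"
proof (rule ccontr)
  assume nz: "f t \<noteq> 0"
  obtain N where N: "negligible N" "\<And>x. x \<in> {a..b} - N \<Longrightarrow> f x = 0"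
    using ae unfolding AE_lebesgue_on_iff_negligible by blast
  obtain d where d: "d > 0" "\<And>x. x \<in> {a..b} \<Longrightarrow> dist x t < d \<Longrightarrow> dist (f x) (f t) < cmod (f t)"
    using f t nz unfolding continuous_on_iff by (metis zero_less_norm_iff)
  define l r where "l = max a (t - d / 2)" and "r = min b (t + d / 2)"
  have lr: "l < r" using t ab d(1) by (auto simp: l_def r_def)
  have "x \<in> N" if x: "x \<in> {l..r}" for x
  proof (rule ccontr)
    assume "x \<notin> N"
    moreover have "x \<in> {a..b}" using x by (auto simp: l_def r_def)
    moreover have "dist x t < d" using x d(1) by (auto simp: l_def r_def dist_real_def)
    ultimately show False using N(2)[of x] d(2)[of x] by simp
  qed
  then have "negligible {l..r}" using N(1) by (blast intro: negligible_subset)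
  then show False using lr negligible_interval(1)[of l r] by simp
qed

text \<open>The quasi-derivatives themselves form the solution vector; the term with \<mu> goes into
  the matrix and g into the source. The zeroth component agrees with y at every point of [a,b], so
  sup bounds for the system are bounds for y.\<close>

lemma L_op_imp_qsolves:
  assumes m: "3 \<le> m" and ab: "a < b" and q: "q absolutely_integrable_on {a..b}"
    and L: "L_op m q \<alpha> \<beta> a b y f" and g: "AE x in lebesgue_on {a..b}. f x - \<mu> * y x = g x"
  shows "\<exists>Y. qsolves m a b q \<mu> g Y \<and> (\<forall>i<m. bc m a b \<alpha> \<beta> Y i = 0) \<and> (\<forall>t\<in>{a..b}. Y 0 t = y t)"
proof -
  interpret q: linear_system m a b "qsys m q \<mu>" by (rule qsys_linear_system[OF ab q])
  obtain D where D: "quasi_derivs m q a b y D"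
    and bc: "\<forall>j<m. (\<Sum>k<m. \<alpha> j k * D k a) + (\<Sum>k<m. \<beta> j k * D k b) = 0"
    and f: "AE x in lebesgue_on {a..b}. f x = \<i> ^ m * D m x"
    using L unfolding L_op_def by blast
  have D0: "D 0 t = y t" if "t \<in> {a..b}" for t using D that by (simp add: quasi_derivs_def)
  have "qsolves m a b q \<mu> g D"
    unfolding q.solves_def
  proof (intro allI impI conjI)
    fix k assume k: "k < m"
    show "abs_cont_on a b (D k)" using D k by (simp add: quasi_derivs_def)
    consider "k + 2 < m" | "k = m - 2" | "k = m - 1" using k by linarith
    then show "AE x in lebesgue_on {a..b}. (D k has_vector_derivative
        (\<Sum>j<m. qsys m q \<mu> k j x * D j x) + src m g k x) (at x within {a..b})"
    proof cases
      case 1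
      then have "AE x in lebesgue_on {a..b}. (D k has_vector_derivative D (k + 1) x) (at x within {a..b})"
        using D by (simp add: quasi_derivs_def)
      moreover have "(\<Sum>j<m. qsys m q \<mu> k j x * D j x) + src m g k x = D (k + 1) x" for x
      proof -
        have "k \<noteq> m - 1" "k \<noteq> m - 2" using 1 by auto
        then show ?thesis using 1 m k by (simp add: qsys_row src_def)
      qed
      ultimately show ?thesis by simp
    next
      case 2
      have "AE x in lebesgue_on {a..b}. (D (m - 2) has_vector_derivative
          (D (m - 1) x - inverse (\<i> ^ m) * q x * D 0 x)) (at x within {a..b})"
        using D unfolding quasi_derivs_def by blast
      moreover have "(\<Sum>j<m. qsys m q \<mu> k j x * D j x) + src m g k x
          = D (m - 1) x - inverse (\<i> ^ m) * q x * D 0 x" for x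
      proof -
        have "Suc (m - 2) = m - 1" "m - 2 \<noteq> m - 1" "m - 1 < m" using m by auto
        then show ?thesis using 2 m k by (simp add: qsys_row src_def)
      qed
      ultimately show ?thesis using 2 by simp
    next
      case 3
      have "AE x in lebesgue_on {a..b}. (D (m - 1) has_vector_derivative
          (D m x + inverse (\<i> ^ m) * q x * D 1 x)) (at x within {a..b})"
        using D unfolding quasi_derivs_def by blast
      then show ?thesis
        using f g AE_lebesgue_on_mem
      proof eventually_elim
        case (elim x)
        have "\<i> ^ m * D m x = g x + \<mu> * D 0 x" using elim D0 by (simp add: algebra_simps)
        then have "D m x = inverse (\<i> ^ m) * g x + inverse (\<i> ^ m) * \<mu> * D 0 x"
          by (simp add: field_simps)
        moreover have "m - 1 \<noteq> m - 2" "\<not> Suc (m - 1) < m" using m by auto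
        then have "(\<Sum>j<m. qsys m q \<mu> k j x * D j x) + src m g k x
          = inverse (\<i> ^ m) * q x * D 1 x + inverse (\<i> ^ m) * \<mu> * D 0 x + inverse (\<i> ^ m) * g x"
          using 3 m k by (simp add: qsys_row src_def)
        ultimately show ?case using elim(1) 3 by (simp add: algebra_simps)
      qed
    qed
  qed
  with bc D0 show ?thesis by (auto simp: bc_def)
qed

text \<open>f is tied to the quasi-derivatives only almost everywhere; this supplies an L2
  representative of \<open>f x - \<mu> * y x\<close> to serve as right-hand side.\<close>

lemma L_op_imp_L2:
  assumes "0 < m" and L: "L_op m q \<alpha> \<beta> a b y f"
  shows "\<exists>g. L2 a b g \<and> (AE x in lebesgue_on {a..b}. f x - \<mu> * y x = g x)"
proof -
  obtain D where D: "quasi_derivs m q a b y D" and D2: "L2 a b (D m)"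
    and f: "AE x in lebesgue_on {a..b}. f x = \<i> ^ m * D m x"
    using L unfolding L_op_def by blast
  have D0: "D 0 t = y t" if "t \<in> {a..b}" for t using D that by (simp add: quasi_derivs_def)
  have "continuous_on {a..b} (D 0)"
    using D assms(1) by (intro abs_cont_on_imp_continuous_on) (simp add: quasi_derivs_def)
  then have "L2 a b (\<lambda>x. \<i> ^ m * D m x + (- \<mu>) * D 0 x)" by (rule L2_combination[OF D2])
  moreover have "AE x in lebesgue_on {a..b}. f x - \<mu> * y x = \<i> ^ m * D m x + (- \<mu>) * D 0 x"
    using f AE_lebesgue_on_mem by eventually_elim (simp add: D0)
  ultimately show ?thesis by blast
qed

lemma qsolves_imp_L_op:
  assumes m: "3 \<le> m" and ab: "a < b" and q: "q absolutely_integrable_on {a..b}"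
    and g: "L2 a b g" and Y: "qsolves m a b q \<mu> g Y" and bc: "\<forall>i<m. bc m a b \<alpha> \<beta> Y i = 0"
  shows "L_op m q \<alpha> \<beta> a b (Y 0) (\<lambda>x. g x + \<mu> * Y 0 x)"
proof -
  interpret q: linear_system m a b "qsys m q \<mu>" by (rule qsys_linear_system[OF ab q])
  define w where "w = inverse (\<i> ^ m)"
  \<comment> \<open>The system has only the components 0, ..., m - 1; the m-th quasi-derivative is
    read off from the equation, as i^(-m) (g + \<mu> y).\<close>
  define D where "D k = (if k < m then Y k else (\<lambda>x. w * g x + w * \<mu> * Y 0 x))" for k
  have Dm: "D m = (\<lambda>x. w * g x + w * \<mu> * Y 0 x)" by (simp add: D_def)
  have DY: "D k = Y k" if "k < m" for k using that by (simp add: D_def)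
  have der: "AE x in lebesgue_on {a..b}. (Y k has_vector_derivative
      (\<Sum>j<m. qsys m q \<mu> k j x * Y j x) + src m g k x) (at x within {a..b})" if "k < m" for k
    using Y that unfolding q.solves_def by blast
  have row0: "(\<Sum>j<m. qsys m q \<mu> k j x * Y j x) + src m g k x = Y (k + 1) x" if "k + 2 < m" for k x
  proof -
    have "k \<noteq> m - 1" "k \<noteq> m - 2" using that by auto
    then show ?thesis using that m by (simp add: qsys_row src_def)
  qed
  have row1: "(\<Sum>j<m. qsys m q \<mu> (m - 2) j x * Y j x) + src m g (m - 2) x
      = Y (m - 1) x - inverse (\<i> ^ m) * q x * Y 0 x" for x
  proof -
    have "Suc (m - 2) = m - 1" "m - 2 \<noteq> m - 1" "m - 1 < m" "m - 2 < m" using m by auto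
    then show ?thesis using m by (simp add: qsys_row src_def)
  qed
  have row2: "(\<Sum>j<m. qsys m q \<mu> (m - 1) j x * Y j x) + src m g (m - 1) x
      = D m x + inverse (\<i> ^ m) * q x * Y 1 x" for x
  proof -
    have "m - 1 \<noteq> m - 2" "\<not> Suc (m - 1) < m" "m - 1 < m" using m by auto
    then show ?thesis using m by (simp add: qsys_row src_def Dm w_def)
  qed
  have "quasi_derivs m q a b (Y 0) D"
    unfolding quasi_derivs_def
  proof (intro conjI allI impI ballI)
    show "D 0 x = Y 0 x" for x using m by (simp add: DY)
    show "abs_cont_on a b (D k)" if "k < m" for k using Y that by (simp add: DY q.solves_def)
    show "AE x in lebesgue_on {a..b}. (D k has_vector_derivative D (k + 1) x) (at x within {a..b})"
      if "k + 2 < m" for k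
      using der[of k] that by (simp add: row0 DY)
    show "AE x in lebesgue_on {a..b}. (D (m - 2) has_vector_derivative
        (D (m - 1) x - inverse (\<i> ^ m) * q x * D 0 x)) (at x within {a..b})"
      using der[of "m - 2", unfolded row1] m DY[of "m - 2"] DY[of "m - 1"] DY[of 0] by simp
    show "AE x in lebesgue_on {a..b}. (D (m - 1) has_vector_derivative
        (D m x + inverse (\<i> ^ m) * q x * D 1 x)) (at x within {a..b})"
      using der[of "m - 1", unfolded row2] m DY[of "m - 1"] DY[of 1] by simp
  qed
  moreover have "L2 a b (D m)"
    unfolding Dm using m by (intro L2_combination g q.solves_continuous[OF Y]) simp
  moreover have "(\<Sum>k<m. \<alpha> j k * D k a) + (\<Sum>k<m. \<beta> j k * D k b) = 0" if "j < m" for j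
    using bc that by (simp add: bc_def DY)
  moreover have "g x + \<mu> * Y 0 x = \<i> ^ m * D m x" for x
    unfolding Dm w_def by (simp add: field_simps)
  ultimately show ?thesis unfolding L_op_def by (intro exI[of _ D]) simp
qed

text \<open>Injectivity gives \<open>Y 0 = 0\<close> almost everywhere, and continuity improves this
  to everywhere. Row k then identifies \<open>Y (Suc k)\<close> with the derivative of
  \<open>Y k\<close>, up to the q-term of row m - 2, which carries the factor \<open>Y 0\<close>; so
  the components vanish one after the other.\<close>

lemma resolvent_trivial_kernel:
  assumes m: "3 \<le> m" and ab: "a < b" and q: "q absolutely_integrable_on {a..b}"
    and res: "in_resolvent_set a b (L_op m q \<alpha> \<beta> a b) \<mu>"
    and Y: "qsolves m a b q \<mu> (\<lambda>_. 0) Y" and bc: "\<forall>i<m. bc m a b \<alpha> \<beta> Y i = 0"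
  shows "\<forall>k<m. \<forall>t\<in>{a..b}. Y k t = 0"
proof -
  interpret q: linear_system m a b "qsys m q \<mu>" by (rule qsys_linear_system[OF ab q])
  have cont: "continuous_on {a..b} (Y k)" if "k < m" for k by (rule q.solves_continuous[OF Y that])
  have L: "L_op m q \<alpha> \<beta> a b (Y 0) (\<lambda>x. 0 + \<mu> * Y 0 x)"
    by (rule qsolves_imp_L_op[OF m ab q L2_zero Y bc])
  have ae: "AE x in lebesgue_on {a..b}. Y 0 x = 0"
    using conjunct1[OF res[unfolded in_resolvent_set_def], rule_format, OF L] by simp
  have "0 < m" using m by simp
  then have Y0: "Y 0 t = 0" if "t \<in> {a..b}" for t
    using that by (intro continuous_AE_zero[OF ab cont ae])
  have "\<forall>t\<in>{a..b}. Y k t = 0" if "k < m" for k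
    using that
  proof (induction k)
    case (Suc k)
    have "AE x in lebesgue_on {a..b}. (Y k has_vector_derivative
        (\<Sum>j<m. qsys m q \<mu> k j x * Y j x) + src m (\<lambda>_. 0) k x) (at x within {a..b})"
      using Y Suc.prems unfolding q.solves_def by simp
    then have "AE x in lebesgue_on {a..b}. Y (Suc k) x = 0"
      using AE_lebesgue_on_mem
    proof eventually_elim
      case (elim x)
      have "((\<lambda>_. 0) has_vector_derivative (0::complex)) (at x within {a..b})"
        by (rule has_vector_derivative_const)
      then have "(Y k has_vector_derivative 0) (at x within {a..b})"
        by (rule has_vector_derivative_transform[OF elim(2), rotated]) (use Suc in simp)
      then have "(\<Sum>j<m. qsys m q \<mu> k j x * Y j x) + src m (\<lambda>_. 0) k x = 0"
        using vector_derivative_unique_within_closed_interval[of a b x] elim ab by auto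
      moreover have "k \<noteq> m - 1" using Suc.prems by simp
      ultimately show ?case using Suc.prems m Y0[OF elim(2)] by (simp add: qsys_row src_def split: if_splits)
    qed
    then show ?case using continuous_AE_zero[OF ab cont[OF Suc.prems]] by blast
  qed (use Y0 in blast)
  then show ?thesis by blast
qed

text \<open>Injectivity is the sup bound for g = 0, surjectivity is solvability of the boundary
  value problem, and boundedness follows by chaining L2 to L1, the sup bound, and sup to L2.\<close>

lemma in_resolvent_setI:
  assumes m: "3 \<le> m" and ab: "a < b" and q: "q absolutely_integrable_on {a..b}" and C: "0 \<le> C"
    and bound: "\<And>g Y t. g absolutely_integrable_on {a..b} \<Longrightarrow> qsolves m a b q \<mu> g Y \<Longrightarrow>
      (\<forall>i<m. bc m a b \<alpha> \<beta> Y i = 0) \<Longrightarrow> t \<in> {a..b} \<Longrightarrow>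
      cmod (Y 0 t) \<le> C * integral {a..b} (\<lambda>x. cmod (g x))"
    and ex: "\<And>g. g absolutely_integrable_on {a..b} \<Longrightarrow>
      \<exists>Y. qsolves m a b q \<mu> g Y \<and> (\<forall>i<m. bc m a b \<alpha> \<beta> Y i = 0)"
  shows "in_resolvent_set a b (L_op m q \<alpha> \<beta> a b) \<mu>"
  unfolding in_resolvent_set_def
proof (intro conjI allI impI)
  fix y f assume L: "L_op m q \<alpha> \<beta> a b y f" and z: "AE x in lebesgue_on {a..b}. f x - \<mu> * y x = 0"
  obtain Y where Y: "qsolves m a b q \<mu> (\<lambda>_. 0) Y" "\<forall>i<m. bc m a b \<alpha> \<beta> Y i = 0"
    "\<forall>t\<in>{a..b}. Y 0 t = y t"
    using L_op_imp_qsolves[OF m ab q L z] by blast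
  have y0: "y t = 0" if "t \<in> {a..b}" for t
    using bound[OF _ Y(1,2) that] Y(3) that by (simp add: set_integrable_def)
  show "AE x in lebesgue_on {a..b}. y x = 0"
    using AE_lebesgue_on_mem by eventually_elim (rule y0)
next
  fix g assume g: "L2 a b g"
  obtain Y where Y: "qsolves m a b q \<mu> g Y" "\<forall>i<m. bc m a b \<alpha> \<beta> Y i = 0"
    using ex[OF L2_imp_absolutely_integrable(1)[OF g ab]] by blast
  have "L_op m q \<alpha> \<beta> a b (Y 0) (\<lambda>x. g x + \<mu> * Y 0 x)"
    by (rule qsolves_imp_L_op[OF m ab q g Y])
  then show "\<exists>y f. L_op m q \<alpha> \<beta> a b y f \<and> (AE x in lebesgue_on {a..b}. f x - \<mu> * y x = g x)"
    by (intro exI[of _ "Y 0"] exI[of _ "\<lambda>x. g x + \<mu> * Y 0 x"]) simp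
next
  define K where "K = C * ((b - a + 1) / 2) * sqrt (b - a)"
  have "L2norm a b y \<le> K * L2norm a b (\<lambda>x. f x - \<mu> * y x)" if L: "L_op m q \<alpha> \<beta> a b y f" for y f
  proof -
    obtain g where g: "L2 a b g" "AE x in lebesgue_on {a..b}. f x - \<mu> * y x = g x"
      using L_op_imp_L2[of m, OF _ L] m by auto
    obtain Y where Y: "qsolves m a b q \<mu> g Y" "\<forall>i<m. bc m a b \<alpha> \<beta> Y i = 0"
      "\<forall>t\<in>{a..b}. Y 0 t = y t"
      using L_op_imp_qsolves[OF m ab q L g(2)] by blast
    note ai = L2_imp_absolutely_integrable[OF g(1) ab]
    have "cmod (y t) \<le> C * ((b - a + 1) / 2 * L2norm a b g)" if "t \<in> {a..b}" for t
      using bound[OF ai(1) Y(1,2) that] mult_left_mono[OF ai(2) C] Y(3) that by simp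
    then have "L2norm a b y \<le> C * ((b - a + 1) / 2 * L2norm a b g) * sqrt (b - a)"
      using C ab by (intro L2norm_le) (auto simp: L2norm_nonneg)
    then show ?thesis by (simp add: K_def L2norm_cong_AE[OF g] mult_ac)
  qed
  then show "\<exists>C. \<forall>y f. L_op m q \<alpha> \<beta> a b y f \<longrightarrow>
      L2norm a b y \<le> C * L2norm a b (\<lambda>x. f x - \<mu> * y x)" by blast
qed

text \<open>Whichever function the choice operator picks, on [a,b] it is the zeroth component of a
  solution of the boundary value problem; pointwise estimates thus apply to the resolvent
  itself.\<close>

lemma resolvent_qsolves:
  assumes m: "3 \<le> m" and ab: "a < b" and q: "q absolutely_integrable_on {a..b}"
    and res: "in_resolvent_set a b (L_op m q \<alpha> \<beta> a b) \<mu>" and g: "L2 a b g"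
  shows "\<exists>Y. qsolves m a b q \<mu> g Y \<and> (\<forall>i<m. bc m a b \<alpha> \<beta> Y i = 0) \<and>
    (\<forall>t\<in>{a..b}. Y 0 t = resolvent a b (L_op m q \<alpha> \<beta> a b) \<mu> g t)"
proof -
  have "\<exists>y f. L_op m q \<alpha> \<beta> a b y f \<and> (AE x in lebesgue_on {a..b}. f x - \<mu> * y x = g x)"
    using res g unfolding in_resolvent_set_def by blast
  then have "\<exists>f. L_op m q \<alpha> \<beta> a b (resolvent a b (L_op m q \<alpha> \<beta> a b) \<mu> g) f \<and>
      (AE x in lebesgue_on {a..b}. f x - \<mu> * resolvent a b (L_op m q \<alpha> \<beta> a b) \<mu> g x = g x)"
    unfolding resolvent_def by (rule someI_ex)
  then show ?thesis using L_op_imp_qsolves[OF m ab q] by blast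
qed

text \<open>A real supremum is meaningful for nonempty sets that are bounded above: the zero
  function provides an element of the unit ball, and B the bound.\<close>

lemma resolvent_diff_norm_bounds:
  assumes "\<And>g. L2 a b g \<Longrightarrow> L2norm a b g \<le> 1 \<Longrightarrow>
    L2norm a b (\<lambda>x. resolvent a b T \<mu> g x - resolvent a b S \<mu> g x) \<le> B"
  shows "0 \<le> resolvent_diff_norm a b T S \<mu>" "resolvent_diff_norm a b T S \<mu> \<le> B"
proof -
  define G where "G = {g. L2 a b g \<and> L2norm a b g \<le> 1}"
  define F where "F g = L2norm a b (\<lambda>x. resolvent a b T \<mu> g x - resolvent a b S \<mu> g x)" for g
  have 0: "(\<lambda>_. 0) \<in> G" by (simp add: G_def L2_zero L2norm_zero)
  have B: "F g \<le> B" if "g \<in> G" for g using assms that by (simp add: F_def G_def)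
  have eq: "resolvent_diff_norm a b T S \<mu> = (SUP g\<in>G. F g)"
    by (simp add: resolvent_diff_norm_def G_def F_def)
  have "bdd_above (F ` G)" using B by (intro bdd_aboveI2)
  then have "F (\<lambda>_. 0) \<le> (SUP g\<in>G. F g)" by (intro cSUP_upper 0)
  then show "0 \<le> resolvent_diff_norm a b T S \<mu>"
    unfolding eq using L2norm_nonneg by (force simp: F_def intro: order_trans)
  show "resolvent_diff_norm a b T S \<mu> \<le> B"
    unfolding eq using 0 B by (intro cSUP_least) auto
qed

theorem theorem2:
  fixes a b \<epsilon>0 :: real and m :: nat
    and Q :: "real \<Rightarrow> real \<Rightarrow> complex"
    and \<alpha> \<beta> :: "real \<Rightarrow> nat \<Rightarrow> nat \<Rightarrow> complex"
  assumes "a < b" and "m \<ge> 3" and "\<epsilon>0 > 0"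
    and "\<forall>\<epsilon>\<in>{0..\<epsilon>0}. integrable (lebesgue_on {a..b}) (Q \<epsilon>)"
    and "\<exists>\<mu>. in_resolvent_set a b (L_op m (Q 0) (\<alpha> 0) (\<beta> 0) a b) \<mu>"
    and "((\<lambda>\<epsilon>. SUP t\<in>{a..b}. cmod (\<integral>s. (Q \<epsilon> s - Q 0 s) \<partial>lebesgue_on {a..t})) \<longlongrightarrow> 0) (at_right 0)"
    and "\<forall>j<m. \<forall>k<m. ((\<lambda>\<epsilon>. \<alpha> \<epsilon> j k) \<longlongrightarrow> \<alpha> 0 j k) (at_right 0)"
    and "\<forall>j<m. \<forall>k<m. ((\<lambda>\<epsilon>. \<beta> \<epsilon> j k) \<longlongrightarrow> \<beta> 0 j k) (at_right 0)"
  shows "\<exists>\<mu>. in_resolvent_set a b (L_op m (Q 0) (\<alpha> 0) (\<beta> 0) a b) \<mu> \<and>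
             (\<forall>\<^sub>F \<epsilon> in at_right 0. in_resolvent_set a b (L_op m (Q \<epsilon>) (\<alpha> \<epsilon>) (\<beta> \<epsilon>) a b) \<mu>) \<and>
             ((\<lambda>\<epsilon>. resolvent_diff_norm a b (L_op m (Q \<epsilon>) (\<alpha> \<epsilon>) (\<beta> \<epsilon>) a b)
                                             (L_op m (Q 0) (\<alpha> 0) (\<beta> 0) a b) \<mu>) \<longlongrightarrow> 0) (at_right 0)"
proof -
  note ab = assms(1) and m = assms(2)
  obtain \<mu> where \<mu>: "in_resolvent_set a b (L_op m (Q 0) (\<alpha> 0) (\<beta> 0) a b) \<mu>" using assms(5) by blast
  have Q: "Q \<epsilon> absolutely_integrable_on {a..b}" if "0 \<le> \<epsilon>" "\<epsilon> \<le> \<epsilon>0" for \<epsilon>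
    using assms(4) that by (simp add: integrable_lebesgue_on_iff)
  have Q0: "Q 0 absolutely_integrable_on {a..b}" using Q assms(3) by simp
  obtain C K where CK: "0 \<le> C" "0 \<le> K"
    and bound: "\<And>q \<alpha>' \<beta>' d e g Y k t. q absolutely_integrable_on {a..b} \<Longrightarrow>
      (\<And>t. t \<in> {a..b} \<Longrightarrow> cmod (integral {a..t} (\<lambda>s. q s - Q 0 s)) \<le> d) \<Longrightarrow> d \<le> 1 \<Longrightarrow>
      coeff_dist m (\<alpha> 0) (\<beta> 0) \<alpha>' \<beta>' \<le> e \<Longrightarrow> K * (d + e) \<le> 1 / 2 \<Longrightarrow>
      g absolutely_integrable_on {a..b} \<Longrightarrow>
      qsolves m a b q \<mu> g Y \<Longrightarrow> (\<forall>i<m. bc m a b \<alpha>' \<beta>' Y i = 0) \<Longrightarrow> k < m \<Longrightarrow> t \<in> {a..b} \<Longrightarrow>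
      cmod (Y k t) \<le> C * integral {a..b} (\<lambda>x. cmod (g x))"
    and diff: "\<And>q \<alpha>' \<beta>' d e g Y Y0 k t. q absolutely_integrable_on {a..b} \<Longrightarrow>
      (\<And>t. t \<in> {a..b} \<Longrightarrow> cmod (integral {a..t} (\<lambda>s. q s - Q 0 s)) \<le> d) \<Longrightarrow> d \<le> 1 \<Longrightarrow>
      coeff_dist m (\<alpha> 0) (\<beta> 0) \<alpha>' \<beta>' \<le> e \<Longrightarrow> K * (d + e) \<le> 1 / 2 \<Longrightarrow>
      g absolutely_integrable_on {a..b} \<Longrightarrow>
      qsolves m a b q \<mu> g Y \<Longrightarrow> (\<forall>i<m. bc m a b \<alpha>' \<beta>' Y i = 0) \<Longrightarrow>
      qsolves m a b (Q 0) \<mu> g Y0 \<Longrightarrow> (\<forall>i<m. bc m a b (\<alpha> 0) (\<beta> 0) Y0 i = 0) \<Longrightarrow> k < m \<Longrightarrow> t \<in> {a..b} \<Longrightarrow>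
      cmod (Y k t - Y0 k t) \<le> K * (d + e) * (C * integral {a..b} (\<lambda>x. cmod (g x)))"
    using quasi_perturbation[OF ab m Q0 resolvent_trivial_kernel[OF m ab Q0 \<mu>]] by blast
  define d where "d \<epsilon> = (SUP t\<in>{a..b}. cmod (\<integral>s. (Q \<epsilon> s - Q 0 s) \<partial>lebesgue_on {a..t}))" for \<epsilon>
  define e where "e \<epsilon> = coeff_dist m (\<alpha> 0) (\<beta> 0) (\<alpha> \<epsilon>) (\<beta> \<epsilon>)" for \<epsilon>
  have d_lim: "(d \<longlongrightarrow> 0) (at_right 0)" using assms(6) by (simp add: d_def[abs_def])
  have e_lim: "(e \<longlongrightarrow> 0) (at_right 0)"
  proof -
    have "((\<lambda>\<epsilon>. cmod (\<alpha> 0 i k - \<alpha> \<epsilon> i k) + cmod (\<beta> 0 i k - \<beta> \<epsilon> i k)) \<longlongrightarrow> 0) (at_right 0)"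
      if "i < m" "k < m" for i k
    proof -
      have "((\<lambda>\<epsilon>. cmod (\<alpha> 0 i k - \<alpha> \<epsilon> i k) + cmod (\<beta> 0 i k - \<beta> \<epsilon> i k))
          \<longlongrightarrow> cmod (\<alpha> 0 i k - \<alpha> 0 i k) + cmod (\<beta> 0 i k - \<beta> 0 i k)) (at_right 0)"
        using assms(7,8) that by (intro tendsto_intros) auto
      then show ?thesis by simp
    qed
    then have "((\<lambda>\<epsilon>. \<Sum>i<m. \<Sum>k<m. cmod (\<alpha> 0 i k - \<alpha> \<epsilon> i k) + cmod (\<beta> 0 i k - \<beta> \<epsilon> i k))
        \<longlongrightarrow> (\<Sum>i<m. \<Sum>k<m. 0)) (at_right 0)"
      by (intro tendsto_sum) auto
    then show ?thesis by (simp add: e_def[abs_def] coeff_dist_def)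
  qed
  have lim: "((\<lambda>\<epsilon>. K * (d \<epsilon> + e \<epsilon>)) \<longlongrightarrow> 0) (at_right 0)"
    using tendsto_mult[OF tendsto_const tendsto_add[OF d_lim e_lim], of K] by simp
  \<comment> \<open>The range of \<epsilon> makes \<open>Q \<epsilon>\<close> integrable; the other
    two conditions are the smallness under which the perturbation estimate holds.\<close>
  have good: "\<forall>\<^sub>F \<epsilon> in at_right 0. 0 < \<epsilon> \<and> \<epsilon> \<le> \<epsilon>0 \<and> d \<epsilon> \<le> 1 \<and> K * (d \<epsilon> + e \<epsilon>) \<le> 1 / 2"
  proof -
    have "\<forall>\<^sub>F \<epsilon> in at_right 0. d \<epsilon> < 1" using d_lim by (rule order_tendstoD) simp
    moreover have "\<forall>\<^sub>F \<epsilon> in at_right 0. K * (d \<epsilon> + e \<epsilon>) < 1 / 2" using lim by (rule order_tendstoD) simp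
    moreover have "\<forall>\<^sub>F \<epsilon> in at_right 0. \<epsilon> \<in> {0<..<\<epsilon>0}"
      using assms(3) by (rule eventually_at_right_real)
    ultimately show ?thesis by eventually_elim auto
  qed
  \<comment> \<open>Comparing one value with the real supremum requires boundedness above, which
    continuity of the indefinite integral provides. The Lebesgue integrals of the hypothesis are
    converted to the gauge integrals used for the systems.\<close>
  have d: "cmod (integral {a..t} (\<lambda>s. Q \<epsilon> s - Q 0 s)) \<le> d \<epsilon>"
    if \<epsilon>: "0 < \<epsilon>" "\<epsilon> \<le> \<epsilon>0" and t: "t \<in> {a..b}" for \<epsilon> t
  proof -
    have ai: "(\<lambda>s. Q \<epsilon> s - Q 0 s) absolutely_integrable_on {a..b}" using Q[of \<epsilon>] Q0 \<epsilon> by simp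
    have eq: "(\<integral>s. (Q \<epsilon> s - Q 0 s) \<partial>lebesgue_on {a..t}) = integral {a..t} (\<lambda>s. Q \<epsilon> s - Q 0 s)"
      if "t \<in> {a..b}" for t
    proof (rule lebesgue_integral_eq_integral)
      show "integrable (lebesgue_on {a..t}) (\<lambda>s. Q \<epsilon> s - Q 0 s)"
        unfolding integrable_lebesgue_on_iff using that
        by (intro absolutely_integrable_on_subinterval[OF ai]) auto
    qed simp
    have "continuous_on {a..b} (\<lambda>t. integral {a..t} (\<lambda>s. Q \<epsilon> s - Q 0 s))"
      by (intro indefinite_integral_continuous_1 set_lebesgue_integral_eq_integral(1) ai)
    then have "bounded ((\<lambda>t. integral {a..t} (\<lambda>s. Q \<epsilon> s - Q 0 s)) ` {a..b})"
      by (intro compact_imp_bounded compact_continuous_image) auto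
    then obtain B where "\<And>t. t \<in> {a..b} \<Longrightarrow> cmod (integral {a..t} (\<lambda>s. Q \<epsilon> s - Q 0 s)) \<le> B"
      unfolding bounded_iff by blast
    then have "bdd_above ((\<lambda>t. cmod (\<integral>s. (Q \<epsilon> s - Q 0 s) \<partial>lebesgue_on {a..t})) ` {a..b})"
      using eq by (intro bdd_aboveI2[where M = B]) simp
    then have "cmod (\<integral>s. (Q \<epsilon> s - Q 0 s) \<partial>lebesgue_on {a..t}) \<le> d \<epsilon>"
      unfolding d_def by (rule cSUP_upper[OF t])
    then show ?thesis using eq[OF t] by simp
  qed
  \<comment> \<open>The factor \<open>(b - a + 1) / 2\<close> bounds the L1 norm of g when its L2
    norm is at most 1; \<open>sqrt (b - a)\<close> turns the sup bound of the difference into an L2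
    bound.\<close>
  define R where "R \<epsilon> = K * (d \<epsilon> + e \<epsilon>) * (C * ((b - a + 1) / 2)) * sqrt (b - a)" for \<epsilon>
  have main: "in_resolvent_set a b (L_op m (Q \<epsilon>) (\<alpha> \<epsilon>) (\<beta> \<epsilon>) a b) \<mu> \<and>
      0 \<le> resolvent_diff_norm a b (L_op m (Q \<epsilon>) (\<alpha> \<epsilon>) (\<beta> \<epsilon>) a b) (L_op m (Q 0) (\<alpha> 0) (\<beta> 0) a b) \<mu> \<and>
      resolvent_diff_norm a b (L_op m (Q \<epsilon>) (\<alpha> \<epsilon>) (\<beta> \<epsilon>) a b) (L_op m (Q 0) (\<alpha> 0) (\<beta> 0) a b) \<mu> \<le> R \<epsilon>"
    if \<epsilon>: "0 < \<epsilon> \<and> \<epsilon> \<le> \<epsilon>0 \<and> d \<epsilon> \<le> 1 \<and> K * (d \<epsilon> + e \<epsilon>) \<le> 1 / 2" for \<epsilon>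
  proof -
    have Qe: "Q \<epsilon> absolutely_integrable_on {a..b}" using Q \<epsilon> by simp
    interpret q: linear_system m a b "qsys m (Q \<epsilon>) \<mu>" by (rule qsys_linear_system[OF ab Qe])
    have d1: "d \<epsilon> \<le> 1" and Kde: "K * (d \<epsilon> + e \<epsilon>) \<le> 1 / 2" using \<epsilon> by auto
    have ce: "coeff_dist m (\<alpha> 0) (\<beta> 0) (\<alpha> \<epsilon>) (\<beta> \<epsilon>) \<le> e \<epsilon>" by (simp add: e_def)
    have de: "cmod (integral {a..t} (\<lambda>s. Q \<epsilon> s - Q 0 s)) \<le> d \<epsilon>" if "t \<in> {a..b}" for t
      using d \<epsilon> that by blast
    have bound': "cmod (Y k t) \<le> C * integral {a..b} (\<lambda>x. cmod (g x))"
      if "g absolutely_integrable_on {a..b}" "qsolves m a b (Q \<epsilon>) \<mu> g Y"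
        "\<forall>i<m. bc m a b (\<alpha> \<epsilon>) (\<beta> \<epsilon>) Y i = 0" "k < m" "t \<in> {a..b}" for g Y k t
      by (rule bound[OF Qe de d1 ce Kde that])
    \<comment> \<open>The uniform bound with g = 0 gives uniqueness for the perturbed problem;
      existence then follows from the Fredholm alternative for the perturbed system itself.\<close>
    have triv: "\<forall>k<m. \<forall>t\<in>{a..b}. Z k t = 0"
      if "q.solves (\<lambda>_ _. 0) Z" "\<forall>i<m. bc m a b (\<alpha> \<epsilon>) (\<beta> \<epsilon>) Z i = 0" for Z
      using bound'[of "\<lambda>_. 0" Z] that by (simp add: src_zero set_integrable_def)
    have res: "in_resolvent_set a b (L_op m (Q \<epsilon>) (\<alpha> \<epsilon>) (\<beta> \<epsilon>) a b) \<mu>"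
    proof (rule in_resolvent_setI[OF m ab Qe CK(1)])
      show "cmod (Y 0 t) \<le> C * integral {a..b} (\<lambda>x. cmod (g x))"
        if "g absolutely_integrable_on {a..b}" "qsolves m a b (Q \<epsilon>) \<mu> g Y"
          "\<forall>i<m. bc m a b (\<alpha> \<epsilon>) (\<beta> \<epsilon>) Y i = 0" "t \<in> {a..b}" for g Y t
        using bound'[OF that(1-3) _ that(4)] m by simp
      show "\<exists>Y. qsolves m a b (Q \<epsilon>) \<mu> g Y \<and> (\<forall>i<m. bc m a b (\<alpha> \<epsilon>) (\<beta> \<epsilon>) Y i = 0)"
        if "g absolutely_integrable_on {a..b}" for g
        by (rule q.boundary_value_problem(1)[OF triv q.L1_src[OF that]])
    qed
    have "L2norm a b (\<lambda>x. resolvent a b (L_op m (Q \<epsilon>) (\<alpha> \<epsilon>) (\<beta> \<epsilon>) a b) \<mu> g x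
        - resolvent a b (L_op m (Q 0) (\<alpha> 0) (\<beta> 0) a b) \<mu> g x) \<le> R \<epsilon>"
      if g: "L2 a b g" "L2norm a b g \<le> 1" for g
    proof -
      note ai = L2_imp_absolutely_integrable[OF g(1) ab]
      obtain Y where Y: "qsolves m a b (Q \<epsilon>) \<mu> g Y" "\<forall>i<m. bc m a b (\<alpha> \<epsilon>) (\<beta> \<epsilon>) Y i = 0"
        "\<forall>t\<in>{a..b}. Y 0 t = resolvent a b (L_op m (Q \<epsilon>) (\<alpha> \<epsilon>) (\<beta> \<epsilon>) a b) \<mu> g t"
        using resolvent_qsolves[OF m ab Qe res g(1)] by blast
      obtain Y0 where Y0: "qsolves m a b (Q 0) \<mu> g Y0" "\<forall>i<m. bc m a b (\<alpha> 0) (\<beta> 0) Y0 i = 0"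
        "\<forall>t\<in>{a..b}. Y0 0 t = resolvent a b (L_op m (Q 0) (\<alpha> 0) (\<beta> 0) a b) \<mu> g t"
        using resolvent_qsolves[OF m ab Q0 \<mu> g(1)] by blast
      have de0: "0 \<le> K * (d \<epsilon> + e \<epsilon>)"
      proof -
        have "0 \<le> d \<epsilon>" using de[of a] ab norm_ge_zero order_trans by fastforce
        moreover have "0 \<le> e \<epsilon>" by (simp add: e_def coeff_dist_def sum_nonneg)
        ultimately show ?thesis using CK(2) by simp
      qed
      have "(b - a + 1) / 2 * L2norm a b g \<le> (b - a + 1) / 2 * 1"
        using g(2) ab by (intro mult_left_mono) auto
      with ai(2) have "integral {a..b} (\<lambda>x. cmod (g x)) \<le> (b - a + 1) / 2" by linarith
      then have I: "K * (d \<epsilon> + e \<epsilon>) * (C * integral {a..b} (\<lambda>x. cmod (g x)))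
          \<le> K * (d \<epsilon> + e \<epsilon>) * (C * ((b - a + 1) / 2))"
        using CK(1) de0 by (intro mult_left_mono)
      have "cmod (resolvent a b (L_op m (Q \<epsilon>) (\<alpha> \<epsilon>) (\<beta> \<epsilon>) a b) \<mu> g t
          - resolvent a b (L_op m (Q 0) (\<alpha> 0) (\<beta> 0) a b) \<mu> g t)
          \<le> K * (d \<epsilon> + e \<epsilon>) * (C * ((b - a + 1) / 2))" if t: "t \<in> {a..b}" for t
        using diff[OF Qe de d1 ce Kde ai(1) Y(1,2) Y0(1,2) _ t, of 0] I m Y(3) Y0(3) t by simp
      then show ?thesis
        unfolding R_def using ab CK(1) de0 by (intro L2norm_le) auto
    qed
    then show ?thesis using res resolvent_diff_norm_bounds by blast
  qed
  have "\<forall>\<^sub>F \<epsilon> in at_right 0. in_resolvent_set a b (L_op m (Q \<epsilon>) (\<alpha> \<epsilon>) (\<beta> \<epsilon>) a b) \<mu>"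
    by (rule eventually_mono[OF good]) (use main in blast)
  moreover have "((\<lambda>\<epsilon>. resolvent_diff_norm a b (L_op m (Q \<epsilon>) (\<alpha> \<epsilon>) (\<beta> \<epsilon>) a b)
      (L_op m (Q 0) (\<alpha> 0) (\<beta> 0) a b) \<mu>) \<longlongrightarrow> 0) (at_right 0)"
  proof (rule tendsto_sandwich[where f = "\<lambda>_. 0" and h = R])
    show "(R \<longlongrightarrow> 0) (at_right 0)"
      unfolding R_def[abs_def] by (intro tendsto_mult_left_zero lim)
    show "\<forall>\<^sub>F \<epsilon> in at_right 0. 0 \<le> resolvent_diff_norm a b (L_op m (Q \<epsilon>) (\<alpha> \<epsilon>) (\<beta> \<epsilon>) a b)
        (L_op m (Q 0) (\<alpha> 0) (\<beta> 0) a b) \<mu>"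
      by (rule eventually_mono[OF good]) (use main in blast)
    show "\<forall>\<^sub>F \<epsilon> in at_right 0. resolvent_diff_norm a b (L_op m (Q \<epsilon>) (\<alpha> \<epsilon>) (\<beta> \<epsilon>) a b)
        (L_op m (Q 0) (\<alpha> 0) (\<beta> 0) a b) \<mu> \<le> R \<epsilon>"
      by (rule eventually_mono[OF good]) (use main in blast)
  qed simp
  ultimately show ?thesis using \<mu> by blast
qed

end
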